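(* Let $\mathbb{X},\mathbb{A},A(\cdot),c,q$ be as in the context. Suppose that: (HT) there exist a state $\ell\in\mathbb{X}$ and a constant $K_\ell$ such that $\sum_{n=0}^\infty{}_\ell Q_\phi^n\mathbf{e}(x)\le K_\ell<\infty$ for all $\phi\in\mathbb{F}$ and $x\in\mathbb{X}$, and this state $\ell$ is isolated from $\mathbb{X}$; (W-i) the set-valued mapping $x\mapsto A(x)$ is compact-valued and continuous on $\mathbb{X}$; (W-ii) the transition kernel $q$ is weakly continuous; (W-iii) $(x,a)\mapsto c(x,a)$ is lower semicontinuous on $\mathrm{Gr}(A)$. Consider the MDP defined by the HV-AG transformation described in the context, with its function $\mu_\ell$, discount factor $\bar\beta$ and value function $\bar v$. Then: (i) the constant $w:=\bar v(\ell)$ and the function $h(x):=\mu_\ell(x)[\bar v(x)-\bar v(\ell)]$, $x\in\mathbb{X}$, satisfy $$w+h(x)=\min_{a\in A(x)}\Big[c(x,a)+\int_{\mathbb{X}}h(y)\,q(dy|x,a)\Big]\qquad\text{for all }x\in\mathbb{X};$$ (ii) if the one-step cost function $c$ is bounded and $q$ is a transition probability kernel, then there exists a stationary average-cost optimal policy, and any stationary policy $\phi$ satisfying $$w+h(x)=c(x,\phi(x))+\int_{\mathbb{X}}h(y)\,q(dy|x,\phi(x))\qquad\text{for all }x\in\mathbb{X},$$ with $w$ and $h$ defined in (i), is average-cost optimal; (iii) there exists a $\bar\beta$-optimal stationary policy for the MDP defined by the HV-AG transformation, and if $c$ is bounded and $q$ is a transition probability kernel, then every such policy is average-cost optimal for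 the original MDP.
   Context: Setting. $\mathbb{X}$ and $\mathbb{A}$ are Borel subsets of complete separable metric spaces, with Borel $\sigma$-algebras. For each $x\in\mathbb{X}$, $A(x)$ is a nonempty Borel subset of $\mathbb{A}$. $\mathrm{Gr}(A):=\{(x,a):x\in\mathbb{X},a\in A(x)\}$ is Borel in $\mathbb{X}\times\mathbb{A}$ and contains the graph of a Borel function $\mathbb{X}\to\mathbb{A}$. The one-step cost $c:\mathrm{Gr}(A)\to[0,\infty)$ is Borel. For each $(x,a)\in\mathrm{Gr}(A)$, $q(\cdot|x,a)$ is a finite measure on $(\mathbb{X},\mathcal{B}(\mathbb{X}))$, $q(B|\cdot)$ is Borel on $\mathrm{Gr}(A)$ for each $B\in\mathcal{B}(\mathbb{X})$, and $\sup_{\mathrm{Gr}(A)}q(\mathbb{X}|x,a)<\infty$ (the mass need not be one). $q$ is a transition probability kernel if every $q(\cdot|x,a)$ is a probability measure. $\mathbb{F}$ is the set of Borel $\phi:\mathbb{X}\to\mathbb{A}$ with $\phi(x)\in A(x)$ for all $x$ (stationary policies). For $\phi\in\mathbb{F}$, $z\in\mathbb{X}$ and Borel $u$: ${}_zQ_\phi u(x):=\int_{\mathbb{X}\setminus\{z\}}u(y)\,q(dy|x,\phi(x))$, ${}_zQ_\phi^0u:=u$, ${}_zQ_\phi^nu:={}_zQ_\phi({}_zQ_\phi^{n-1}u)$ for $n\ge1$. $\mathbf{e}(x):=1$ for all $x$. The state $\ell$ is isolated from $\mathbb{X}$ if there is $\epsilon>0$ such that the distance from $\ell$ to every element of $\mathbb{X}\setminus\{\ell\}$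 is larger than $\epsilon$. A set-valued mapping $s\mapsto\Phi(s)\subseteq\mathbb{T}$ between metric spaces is compact-valued if every $\Phi(s)$ is compact, and continuous if for every open $O\subseteq\mathbb{T}$ the sets $\{s:\Phi(s)\subseteq O\}$ and $\{s:\Phi(s)\cap O\neq\emptyset\}$ are open. $q$ is weakly continuous if $(x,a)\mapsto\int f(y)\,q(dy|x,a)$ is continuous on $\mathrm{Gr}(A)$ for every bounded continuous $f:\mathbb{X}\to\mathbb{R}$. Policies and average cost. A policy $\pi$ is a sequence of Borel-measurable, history-dependent, possibly randomized decision rules $\pi_n(\cdot|x_0a_0\cdots x_n)$, probability measures concentrated on the set of actions available at $x_n$. When $q$ is a transition probability kernel, the average cost of $\pi$ from $x\in\mathbb{X}$ is $w^\pi(x):=\limsup_{N\to\infty}\frac1N\mathbb{E}_x^\pi\sum_{n=0}^{N-1}c(x_n,a_n)$, where $\mathbb{E}_x^\pi$ is expectation for the process with $x_0=x$, actions chosen by $\pi$, and transition probabilities $q$; $\pi$ is average-cost optimal if $w^\pi(x)=\inf_{\pi'}w^{\pi'}(x)$ for all $x\in\mathbb{X}$. HV-AG transformation. Let $\mu_\ell:\mathbb{X}\to[1,\infty)$ be a continuous function with $\mu_\ell\le K_\ell$ and $\mu_\ell(x)\ge1+\int_{\mathbb{X}\setminus\{\ell\}}\mu_\ell(y)\,q(dy|x,a)$ for all $(x,a)\in\mathrm{Gr}(A)$ (under the hypotheses of the claim such a $\mu_\ell$ exists), and choose a discount factor $\bar\beta\in[(K_\ell-1)/K_\ell,1)$.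 The new MDP has: - state space $\bar{\mathbb{X}}:=\mathbb{X}\cup\{\bar x\}$, where $\bar x\notin\mathbb{X}$ is isolated from $\mathbb{X}$ (its distance to all points of $\mathbb{X}$ is bounded below by a positive constant); - action space $\bar{\mathbb{A}}:=\mathbb{A}\cup\{\bar a\}$, with $\bar A(x):=A(x)$ for $x\in\mathbb{X}$ and $\bar A(\bar x):=\{\bar a\}$; - costs $\bar c(x,a):=c(x,a)/\mu_\ell(x)$ for $(x,a)\in\mathrm{Gr}(A)$ and $\bar c(\bar x,\bar a):=0$; - transition probabilities, for $(x,a)\in\mathrm{Gr}(A)$: $\bar p(B|x,a):=\frac{1}{\bar\beta\mu_\ell(x)}\int_B\mu_\ell(y)\,q(dy|x,a)$ for Borel $B\subseteq\mathbb{X}\setminus\{\ell\}$; $\bar p(\{\ell\}|x,a):=\frac{1}{\bar\beta\mu_\ell(x)}\big[\mu_\ell(x)-1-\int_{\mathbb{X}\setminus\{\ell\}}\mu_\ell(y)\,q(dy|x,a)\big]$; $\bar p(\{\bar x\}|x,a):=1-\frac{\mu_\ell(x)-1}{\bar\beta\mu_\ell(x)}$; and $\bar p(\{\bar x\}|\bar x,\bar a):=1$. Policies of the two MDPs are identified, since $\bar a$ is the only action at $\bar x$. $\bar v^\pi(x):=\bar{\mathbb{E}}_x^\pi\sum_{n=0}^\infty\bar\beta^n\bar c(x_n,a_n)$ is the expected total discounted cost in the new MDP (process governed by $\bar p$ and $\pi$, $x_0=x$), $\bar v(x):=\inf_\pi\bar v^\pi(x)$, and $\pi$ is $\bar\beta$-optimal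 if $\bar v^\pi(x)=\bar v(x)$ for all $x\in\bar{\mathbb{X}}$.
   Formalization: Part (i) additionally assumes that v̄(ℓ) is finite: for unbounded c the hypotheses allow v̄(ℓ)=∞, and then h(ℓ)=μ_ℓ(ℓ)[∞−∞] is undefined. For bounded c this holds automatically, and parts (ii) and (iii) are unaffected. *)

theory Defs
  imports "HOL-Probability.Probability"
begin

record ('s, 'a) mdp =
  states :: "'s measure"
  actions :: "'a measure"
  avail :: "'s \<Rightarrow> 'a set"
  cost :: "'s \<times> 'a \<Rightarrow> real"
  kern :: "'s \<times> 'a \<Rightarrow> 's measure"

text \<open>In \<open>states\<close> and \<open>actions\<close> only the underlying set and the \<open>\<sigma>\<close>-algebra are relevant.\<close>

definition graph :: "('s \<Rightarrow> 'a set) \<Rightarrow> 's set \<Rightarrow> ('s \<times> 'a) set" where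
  "graph A S = {(x, a). x \<in> S \<and> a \<in> A x}"

definition graph_space :: "('s, 'a) mdp \<Rightarrow> ('s \<times> 'a) measure" where
  "graph_space M =
     restrict_space (states M \<Otimes>\<^sub>M actions M) (graph (avail M) (space (states M)))"

text \<open>A history \<open>x\<^sub>0, a\<^sub>0, \<dots>, x\<^bsub>n-1\<^esub>, a\<^bsub>n-1\<^esub>, x\<^sub>n\<close> is encoded as \<open>(\<omega>, x\<^sub>n)\<close> with
  \<open>\<omega> i = (x\<^sub>i, a\<^sub>i)\<close> for \<open>i < n\<close>; each \<open>(x\<^sub>i, a\<^sub>i)\<close> is a feasible state-action pair.\<close>

type_synonym ('s, 'a) policy = "nat \<Rightarrow> (nat \<Rightarrow> 's \<times> 'a) \<times> 's \<Rightarrow> 'a measure"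

definition history_space :: "('s, 'a) mdp \<Rightarrow> nat \<Rightarrow> ((nat \<Rightarrow> 's \<times> 'a) \<times> 's) measure" where
  "history_space M n = (\<Pi>\<^sub>M i\<in>{0..<n}. graph_space M) \<Otimes>\<^sub>M states M"

definition policies :: "('s, 'a) mdp \<Rightarrow> ('s, 'a) policy set" where
  "policies M = {\<pi>. \<forall>n.
     \<pi> n \<in> history_space M n \<rightarrow>\<^sub>M prob_algebra (actions M) \<and>
     (\<forall>(\<omega>, x) \<in> space (history_space M n). emeasure (\<pi> n (\<omega>, x)) (avail M x) = 1)}"

definition stationary_policies :: "('s, 'a) mdp \<Rightarrow> ('s \<Rightarrow> 'a) set" where
  "stationary_policies M =
     {\<phi> \<in> states M \<rightarrow>\<^sub>M actions M. \<forall>x \<in> space (states M). \<phi> x \<in> avail M x}"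

definition stationary :: "('s, 'a) mdp \<Rightarrow> ('s \<Rightarrow> 'a) \<Rightarrow> ('s, 'a) policy" where
  "stationary M \<phi> = (\<lambda>n (\<omega>, x). return (actions M) (\<phi> x))"

text \<open>The conditional law of \<open>(x\<^sub>n, a\<^sub>n)\<close> given \<open>\<omega> i = (x\<^sub>i, a\<^sub>i)\<close>, \<open>i < n\<close>: the state is drawn
  first (it is the initial state \<open>x\<close> if \<open>n = 0\<close>), then the action.  This law is concentrated on the
  graph of feasible pairs, and is regarded as a measure on that graph, because the transition law
  at the next step is only specified there.\<close>

definition step_law ::
  "('s, 'a) mdp \<Rightarrow> ('s, 'a) policy \<Rightarrow> 's \<Rightarrow> nat \<Rightarrow> (nat \<Rightarrow> 's \<times> 'a) \<Rightarrow> ('s \<times> 'a) measure" where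
  "step_law M \<pi> x n \<omega> = restrict_space
     ((case n of 0 \<Rightarrow> return (states M) x | Suc m \<Rightarrow> kern M (\<omega> m)) \<bind>
        (\<lambda>y. distr (\<pi> n (\<omega>, y)) (states M \<Otimes>\<^sub>M actions M) (Pair y)))
     (graph (avail M) (space (states M)))"

text \<open>The law of the process \<open>(x\<^sub>n, a\<^sub>n)\<^sub>n\<close>, given by the Ionescu-Tulcea theorem.\<close>

definition trajectory ::
  "('s, 'a) mdp \<Rightarrow> ('s, 'a) policy \<Rightarrow> 's \<Rightarrow> (nat \<Rightarrow> 's \<times> 'a) measure" where
  "trajectory M \<pi> x = projective_family.lim UNIV
     (Ionescu_Tulcea.CI (step_law M \<pi> x) (\<lambda>_. graph_space M)) (\<lambda>_. graph_space M)"

text \<open>Expected costs are nonnegative integrals: one-step costs are nonnegative on feasible pairs.\<close>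

definition average_cost :: "('s, 'a) mdp \<Rightarrow> ('s, 'a) policy \<Rightarrow> 's \<Rightarrow> ennreal" where
  "average_cost M \<pi> x =
     limsup (\<lambda>N. (\<integral>\<^sup>+\<omega>. (\<Sum>n<N. ennreal (cost M (\<omega> n))) \<partial>trajectory M \<pi> x) / of_nat N)"

definition average_optimal :: "('s, 'a) mdp \<Rightarrow> ('s, 'a) policy \<Rightarrow> bool" where
  "average_optimal M \<pi> \<longleftrightarrow> \<pi> \<in> policies M \<and>
     (\<forall>x \<in> space (states M). average_cost M \<pi> x = (INF \<pi>' \<in> policies M. average_cost M \<pi>' x))"

definition discounted_cost :: "('s, 'a) mdp \<Rightarrow> real \<Rightarrow> ('s, 'a) policy \<Rightarrow> 's \<Rightarrow> ennreal" where
  "discounted_cost M \<beta> \<pi> x =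
     (\<integral>\<^sup>+\<omega>. (\<Sum>n. ennreal (\<beta> ^ n * cost M (\<omega> n))) \<partial>trajectory M \<pi> x)"

definition discounted_value :: "('s, 'a) mdp \<Rightarrow> real \<Rightarrow> 's \<Rightarrow> ennreal" where
  "discounted_value M \<beta> x = (INF \<pi> \<in> policies M. discounted_cost M \<beta> \<pi> x)"

definition discounted_optimal :: "('s, 'a) mdp \<Rightarrow> real \<Rightarrow> ('s, 'a) policy \<Rightarrow> bool" where
  "discounted_optimal M \<beta> \<pi> \<longleftrightarrow> \<pi> \<in> policies M \<and>
     (\<forall>x \<in> space (states M). discounted_cost M \<beta> \<pi> x = discounted_value M \<beta> x)"

definition borel_mdp_of ::
  "'x::polish_space set \<Rightarrow> 'a::polish_space set \<Rightarrow> ('x \<Rightarrow> 'a set) \<Rightarrow> ('x \<times> 'a \<Rightarrow> real) \<Rightarrow>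
    ('x \<times> 'a \<Rightarrow> 'x measure) \<Rightarrow> ('x, 'a) mdp" where
  "borel_mdp_of X Act A c q =
     \<lparr>states = restrict_space borel X, actions = restrict_space borel Act,
      avail = A, cost = c, kern = q\<rparr>"

text \<open>The measures \<open>q (x, a)\<close> are finite, but their total mass may differ from one.\<close>

locale borel_mdp =
  fixes X :: "'x::polish_space set" and Act :: "'a::polish_space set"
    and A :: "'x \<Rightarrow> 'a set" and c :: "'x \<times> 'a \<Rightarrow> real" and q :: "'x \<times> 'a \<Rightarrow> 'x measure"
  assumes X_borel: "X \<in> sets borel"
    and Act_borel: "Act \<in> sets borel"
    and A_nonempty: "\<And>x. x \<in> X \<Longrightarrow> A x \<noteq> {}"
    and A_subset: "\<And>x. x \<in> X \<Longrightarrow> A x \<subseteq> Act"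
    and A_borel: "\<And>x. x \<in> X \<Longrightarrow> A x \<in> sets borel"
    and graph_borel: "graph A X \<in> sets borel"
    and selector: "stationary_policies (borel_mdp_of X Act A c q) \<noteq> {}"
    and c_nonneg: "\<And>z. z \<in> graph A X \<Longrightarrow> 0 \<le> c z"
    and c_borel: "c \<in> borel_measurable (restrict_space borel (graph A X))"
    and q_sets: "\<And>z. z \<in> graph A X \<Longrightarrow> sets (q z) = sets (restrict_space borel X)"
    and q_finite: "\<And>z. z \<in> graph A X \<Longrightarrow> finite_measure (q z)"
    and q_borel: "\<And>B. B \<in> sets (restrict_space borel X) \<Longrightarrow>
      (\<lambda>z. measure (q z) B) \<in> borel_measurable (restrict_space borel (graph A X))"
    and q_bounded: "\<exists>C. \<forall>z \<in> graph A X. measure (q z) X \<le> C"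

definition probability_kernel :: "('s \<times> 'a) set \<Rightarrow> ('s \<times> 'a \<Rightarrow> 's measure) \<Rightarrow> bool" where
  "probability_kernel G q \<longleftrightarrow> (\<forall>z \<in> G. prob_space (q z))"

text \<open>The operator \<open>\<^sub>zQ\<^sub>\<phi>\<close>, acting on nonnegative functions.\<close>

definition taboo_op ::
  "'s set \<Rightarrow> ('s \<times> 'a \<Rightarrow> 's measure) \<Rightarrow> ('s \<Rightarrow> 'a) \<Rightarrow> 's \<Rightarrow> ('s \<Rightarrow> ennreal) \<Rightarrow> 's \<Rightarrow> ennreal" where
  "taboo_op X q \<phi> z u x = (\<integral>\<^sup>+y \<in> X - {z}. u y \<partial>q (x, \<phi> x))"

definition isolated_from :: "'x::metric_space \<Rightarrow> 'x set \<Rightarrow> bool" where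
  "isolated_from l X \<longleftrightarrow> (\<exists>\<epsilon>>0. \<forall>y \<in> X - {l}. \<epsilon> < dist l y)"

definition continuous_set_map ::
  "'s::metric_space set \<Rightarrow> 't::metric_space set \<Rightarrow> ('s \<Rightarrow> 't set) \<Rightarrow> bool" where
  "continuous_set_map S T \<Phi> \<longleftrightarrow> (\<forall>U. openin (top_of_set T) U \<longrightarrow>
     openin (top_of_set S) {s \<in> S. \<Phi> s \<subseteq> U} \<and>
     openin (top_of_set S) {s \<in> S. \<Phi> s \<inter> U \<noteq> {}})"

definition weakly_continuous_kernel ::
  "'x::metric_space set \<Rightarrow> ('x \<times> 'a::metric_space) set \<Rightarrow> ('x \<times> 'a \<Rightarrow> 'x measure) \<Rightarrow> bool" where
  "weakly_continuous_kernel X G q \<longleftrightarrow>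
     (\<forall>f :: 'x \<Rightarrow> real. continuous_on X f \<and> bounded (f ` X) \<longrightarrow>
        continuous_on G (\<lambda>z. \<integral>y. f y \<partial>q z))"

definition lower_semicontinuous_on :: "'z::topological_space set \<Rightarrow> ('z \<Rightarrow> real) \<Rightarrow> bool" where
  "lower_semicontinuous_on S f \<longleftrightarrow>
     (\<forall>z \<in> S. \<forall>r < f z. \<forall>\<^sub>F z' in at z within S. r < f z')"

text \<open>The additional point is \<open>None\<close>.  The \<open>\<sigma>\<close>-algebra is the Borel \<open>\<sigma>\<close>-algebra of the topology
  on \<open>{None} \<union> Some ` S\<close> in which \<open>None\<close> is an isolated point and \<open>S\<close> is embedded by \<open>Some\<close> as an
  open and closed subspace.\<close>

definition borel_adjoin :: "'x::topological_space set \<Rightarrow> 'x option measure" where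
  "borel_adjoin S = sigma (insert None (Some ` S))
     {U. U \<subseteq> insert None (Some ` S) \<and> openin (top_of_set S) (Some -` U)}"

fun hvag_avail :: "('x \<Rightarrow> 'a set) \<Rightarrow> 'x option \<Rightarrow> 'a option set" where
  "hvag_avail A (Some x) = Some ` A x"
| "hvag_avail A None = {None}"

fun hvag_cost ::
  "('x \<times> 'a \<Rightarrow> real) \<Rightarrow> ('x \<Rightarrow> real) \<Rightarrow> 'x option \<times> 'a option \<Rightarrow> real" where
  "hvag_cost c \<mu> (Some x, Some a) = c (x, a) / \<mu> x"
| "hvag_cost c \<mu> _ = 0"

text \<open>The value on \<open>B\<close> is the sum of the contributions of \<open>B \<inter> Some ` (X - {l})\<close>, of \<open>Some l\<close>, and
  of the additional point.\<close>

definition hvag_prob ::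
  "'x set \<Rightarrow> ('x \<times> 'a \<Rightarrow> 'x measure) \<Rightarrow> 'x \<Rightarrow> ('x \<Rightarrow> real) \<Rightarrow> real \<Rightarrow> 'x \<Rightarrow> 'a \<Rightarrow>
    'x option set \<Rightarrow> real" where
  "hvag_prob X q l \<mu> \<beta> x a B =
     1 / (\<beta> * \<mu> x) * (LINT y : Some -` B - {l} | q (x, a). \<mu> y) +
     indicator B (Some l) *
       (1 / (\<beta> * \<mu> x) * (\<mu> x - 1 - (LINT y : X - {l} | q (x, a). \<mu> y))) +
     indicator B None * (1 - (\<mu> x - 1) / (\<beta> * \<mu> x))"

text \<open>The last equation also covers the infeasible pairs, whose transition law plays no role.\<close>

fun hvag_kern ::
  "'x::topological_space set \<Rightarrow> ('x \<times> 'a \<Rightarrow> 'x measure) \<Rightarrow> 'x \<Rightarrow> ('x \<Rightarrow> real) \<Rightarrow> real \<Rightarrow>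
    'x option \<times> 'a option \<Rightarrow> 'x option measure" where
  "hvag_kern X q l \<mu> \<beta> (Some x, Some a) =
     measure_of (space (borel_adjoin X)) (sets (borel_adjoin X))
       (\<lambda>B. ennreal (hvag_prob X q l \<mu> \<beta> x a B))"
| "hvag_kern X q l \<mu> \<beta> _ = return (borel_adjoin X) None"

definition hvag ::
  "'x::polish_space set \<Rightarrow> 'a::polish_space set \<Rightarrow> ('x \<Rightarrow> 'a set) \<Rightarrow> ('x \<times> 'a \<Rightarrow> real) \<Rightarrow>
    ('x \<times> 'a \<Rightarrow> 'x measure) \<Rightarrow> 'x \<Rightarrow> ('x \<Rightarrow> real) \<Rightarrow> real \<Rightarrow> ('x option, 'a option) mdp" where
  "hvag X Act A c q l \<mu> \<beta> =
     \<lparr>states = borel_adjoin X, actions = borel_adjoin Act,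
      avail = hvag_avail A, cost = hvag_cost c \<mu>, kern = hvag_kern X q l \<mu> \<beta>\<rparr>"

text \<open>A stationary policy of the transformed process is determined by this restriction, as \<open>None\<close>
  is the only action available at \<open>None\<close>.\<close>

definition original_policy :: "('x option \<Rightarrow> 'a option) \<Rightarrow> 'x \<Rightarrow> 'a" where
  "original_policy \<phi> x = the (\<phi> (Some x))"

text \<open>The integral of an extended-real function whose negative part has a finite integral.\<close>

definition ext_integral :: "'x measure \<Rightarrow> ('x \<Rightarrow> ereal) \<Rightarrow> ereal" where
  "ext_integral M f =
     enn2ereal (\<integral>\<^sup>+x. e2ennreal (f x) \<partial>M) - enn2ereal (\<integral>\<^sup>+x. e2ennreal (- f x) \<partial>M)"

definition is_minimum :: "'b::order \<Rightarrow> ('a \<Rightarrow> 'b) \<Rightarrow> 'a set \<Rightarrow> bool" where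
  "is_minimum m f S \<longleftrightarrow> (\<exists>a \<in> S. f a = m) \<and> (\<forall>a \<in> S. m \<le> f a)"

end

theory Submission
  imports Defs
begin

text \<open>The average-cost equation of the original process is the discounted optimality equation of
  the transformed process, multiplied by \<open>\<mu>\<close>: since \<open>h l = 0\<close>, the mass that the transformation
  moves to \<open>l\<close> accounts exactly for the constant \<open>w\<close>.  The discounted equation comes from value
  iteration in the class of lower semicontinuous functions.  Weak continuity of \<open>q\<close> and isolation
  of \<open>l\<close> keep the integral over \<open>X - {l}\<close> in that class, minima over the compact sets \<open>A x\<close> are
  attained and pass to increasing limits, and a measurable selection theorem yields a minimizing
  policy.  For bounded costs, iterating the average-cost inequality \<open>w + h \<le> c + \<integral> h dq\<close> along the
  process bounds every average cost from below by \<open>w\<close>, with equality for stationary policies that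
  attain the minimum.\<close>

section \<open>Processes governed by a stochastic kernel\<close>

text \<open>Costs may be unbounded, so every value lies in [0, \<infinity>] and may be infinite. All
  iterations therefore run on \<open>ennreal\<close> functions, where monotone convergence needs no
  integrability; the difference defining \<open>h\<close> is formed only at the end. It makes sense
  as soon as the value \<open>b\<close> at \<open>l\<close> is finite: \<open>h x\<close> is at
  least \<open>- \<mu> x * b\<close>, so its negative part has a finite integral, while
  \<open>h\<close> itself may be infinite. The working unknown is \<open>W x\<close>, which turns
  out to be \<open>\<mu> x\<close> times the discounted value: in this scale the density
  \<open>\<mu>\<close> of the transformed kernel cancels and the Bellman operator contains
  \<open>q\<close> itself. What remains is \<open>slack\<close>, and I + slack =
  \<open>\<mu> x - 1\<close> with I the integral of \<open>\<mu>\<close> over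
  \<open>X - {l}\<close>. This identity drives both the passage to the average-cost equation and the
  bound \<open>W x \<le> \<mu> x * C\<close> for costs bounded by \<open>C\<close>. Processes are
  treated abstractly because two occur: the transformed one always, the original one only if
  \<open>q\<close> has mass one.\<close>

locale mdp_kernel =
  fixes M :: "('s, 'a) mdp"
  assumes graph_sets: "graph (avail M) (space (states M)) \<in> sets (states M \<Otimes>\<^sub>M actions M)"
    and kern_measurable [measurable]: "kern M \<in> graph_space M \<rightarrow>\<^sub>M prob_algebra (states M)"
    and cost_measurable [measurable]: "cost M \<in> borel_measurable (graph_space M)"
    and cost_nonneg: "z \<in> space (graph_space M) \<Longrightarrow> 0 \<le> cost M z"
begin

lemma space_graph_space: "space (graph_space M) = graph (avail M) (space (states M))"
  using sets.sets_into_space[OF graph_sets]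
  by (auto simp: graph_space_def space_restrict_space)

lemma avail_sets: "x \<in> space (states M) \<Longrightarrow> avail M x \<in> sets (actions M)"
  using sets_Pair1[OF graph_sets, of x] by (simp add: graph_def vimage_def)

lemma measurable_fst_graph_space [measurable]: "fst \<in> graph_space M \<rightarrow>\<^sub>M states M"
  unfolding graph_space_def by (rule measurable_restrict_space1) simp

section \<open>Law of the trajectory under a fixed policy\<close>

context
  fixes \<pi> x assumes \<pi>: "\<pi> \<in> policies M" and x: "x \<in> space (states M)"
begin

abbreviation (input) state_law :: "nat \<Rightarrow> (nat \<Rightarrow> 's \<times> 'a) \<Rightarrow> 's measure" where
  "state_law n \<omega> \<equiv> (case n of 0 \<Rightarrow> return (states M) x | Suc m \<Rightarrow> kern M (\<omega> m))"

lemma policy_measurable: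
  "\<pi> n \<in> (\<Pi>\<^sub>M i\<in>{0..<n}. graph_space M) \<Otimes>\<^sub>M states M \<rightarrow>\<^sub>M prob_algebra (actions M)"
  using \<pi> by (auto simp: policies_def history_space_def)

lemma policy_concentrated:
  assumes "\<omega> \<in> space (\<Pi>\<^sub>M i\<in>{0..<n}. graph_space M)" "y \<in> space (states M)"
  shows "emeasure (\<pi> n (\<omega>, y)) (avail M y) = 1"
  using \<pi> assms by (fastforce simp: policies_def history_space_def space_pair_measure)

lemma state_law_measurable:
  "state_law n \<in> (\<Pi>\<^sub>M i\<in>{0..<n}. graph_space M) \<rightarrow>\<^sub>M prob_algebra (states M)"
proof (cases n)
  case 0
  have "return (states M) x \<in> space (prob_algebra (states M))"
    using x by (simp add: space_prob_algebra prob_space_return)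
  then show ?thesis using 0 by simp
next
  case (Suc m)
  have "(\<lambda>\<omega>. \<omega> m) \<in> (\<Pi>\<^sub>M i\<in>{0..<n}. graph_space M) \<rightarrow>\<^sub>M graph_space M"
    using Suc by (intro measurable_component_singleton) auto
  from measurable_compose[OF this kern_measurable] show ?thesis using Suc by simp
qed

lemma pair_law_measurable:
  "(\<lambda>(\<omega>, y). distr (\<pi> n (\<omega>, y)) (states M \<Otimes>\<^sub>M actions M) (Pair y))
    \<in> (\<Pi>\<^sub>M i\<in>{0..<n}. graph_space M) \<Otimes>\<^sub>M states M \<rightarrow>\<^sub>M prob_algebra (states M \<Otimes>\<^sub>M actions M)"
proof -
  note policy_measurable[measurable]
  show ?thesis by measurable
qed

text \<open>\<open>f\<close> is measurable on the graph only, so the restriction in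
  \<open>step_law\<close> is traded for the indicator of the graph on the full product space; its
  section at \<open>y\<close> is \<open>avail M y\<close>.\<close>

lemma nn_integral_step_law:
  assumes \<omega>: "\<omega> \<in> space (\<Pi>\<^sub>M i\<in>{0..<n}. graph_space M)"
    and f: "f \<in> borel_measurable (graph_space M)"
  shows "(\<integral>\<^sup>+z. f z \<partial>step_law M \<pi> x n \<omega>) =
    (\<integral>\<^sup>+y. (\<integral>\<^sup>+a. f (y, a) * indicator (avail M y) a \<partial>\<pi> n (\<omega>, y)) \<partial>state_law n \<omega>)"
proof -
  let ?S = "states M \<Otimes>\<^sub>M actions M"
  let ?G = "graph (avail M) (space (states M))"
  let ?f = "\<lambda>z. f z * indicator ?G z"
  have L: "state_law n \<omega> \<in> space (prob_algebra (states M))"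
    by (rule measurable_space[OF state_law_measurable \<omega>])
  then have sL: "sets (state_law n \<omega>) = sets (states M)" and spL: "space (state_law n \<omega>) = space (states M)"
    by (auto simp: space_prob_algebra dest: sets_eq_imp_space_eq)
  have B: "(\<lambda>y. distr (\<pi> n (\<omega>, y)) ?S (Pair y)) \<in> states M \<rightarrow>\<^sub>M prob_algebra ?S"
    using measurable_Pair2[OF pair_law_measurable \<omega>] by simp
  have B': "(\<lambda>y. distr (\<pi> n (\<omega>, y)) ?S (Pair y)) \<in> state_law n \<omega> \<rightarrow>\<^sub>M subprob_algebra ?S"
    using measurable_prob_algebraD[OF B] by (simp cong: measurable_cong_sets add: sL)
  have sB: "sets (state_law n \<omega> \<bind> (\<lambda>y. distr (\<pi> n (\<omega>, y)) ?S (Pair y))) = sets ?S"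
    by (rule sets_bind'[OF L B])
  have G: "?G \<inter> space ?S \<in> sets ?S" using graph_sets by auto
  have f': "?f \<in> borel_measurable ?S"
    using f unfolding graph_space_def by (subst (asm) borel_measurable_restrict_space_iff_ennreal[OF G]) 
  have "(\<integral>\<^sup>+z. f z \<partial>step_law M \<pi> x n \<omega>) =
      (\<integral>\<^sup>+z. ?f z \<partial>(state_law n \<omega> \<bind> (\<lambda>y. distr (\<pi> n (\<omega>, y)) ?S (Pair y))))"
    unfolding step_law_def using graph_sets
    by (subst nn_integral_restrict_space) (auto simp: sB sets_eq_imp_space_eq[OF sB])
  also have "\<dots> = (\<integral>\<^sup>+y. (\<integral>\<^sup>+z. ?f z \<partial>distr (\<pi> n (\<omega>, y)) ?S (Pair y)) \<partial>state_law n \<omega>)"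
    by (rule nn_integral_bind[OF f' B'])
  also have "\<dots> = (\<integral>\<^sup>+y. (\<integral>\<^sup>+a. f (y, a) * indicator (avail M y) a \<partial>\<pi> n (\<omega>, y)) \<partial>state_law n \<omega>)"
  proof (rule nn_integral_cong)
    fix y assume "y \<in> space (state_law n \<omega>)"
    then have y: "y \<in> space (states M)" by (simp add: spL)
    have "\<pi> n (\<omega>, y) \<in> space (prob_algebra (actions M))"
      using measurable_space[OF policy_measurable, of "(\<omega>, y)" n] \<omega> y by (simp add: space_pair_measure)
    then have s: "sets (\<pi> n (\<omega>, y)) = sets (actions M)" by (simp add: space_prob_algebra)
    have "Pair y \<in> \<pi> n (\<omega>, y) \<rightarrow>\<^sub>M ?S" using y by (simp cong: measurable_cong_sets add: s)
    then have "(\<integral>\<^sup>+z. ?f z \<partial>distr (\<pi> n (\<omega>, y)) ?S (Pair y)) = (\<integral>\<^sup>+a. ?f (y, a) \<partial>\<pi> n (\<omega>, y))"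
      by (rule nn_integral_distr) (simp add: f')
    also have "\<dots> = (\<integral>\<^sup>+a. f (y, a) * indicator (avail M y) a \<partial>\<pi> n (\<omega>, y))"
      using y by (intro nn_integral_cong) (auto simp: graph_def split: split_indicator)
    finally show "(\<integral>\<^sup>+z. ?f z \<partial>distr (\<pi> n (\<omega>, y)) ?S (Pair y)) = \<dots>" .
  qed
  finally show ?thesis .
qed

text \<open>The decision rule gives \<open>avail M y\<close> mass one, so a function of the state
  alone passes through the action integral unchanged.\<close>

lemma nn_integral_step_law_fst:
  assumes \<omega>: "\<omega> \<in> space (\<Pi>\<^sub>M i\<in>{0..<n}. graph_space M)"
    and f [measurable]: "f \<in> borel_measurable (states M)"
  shows "(\<integral>\<^sup>+z. f (fst z) \<partial>step_law M \<pi> x n \<omega>) = (\<integral>\<^sup>+y. f y \<partial>state_law n \<omega>)"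
proof (subst nn_integral_step_law[OF \<omega>])
  have L: "state_law n \<omega> \<in> space (prob_algebra (states M))"
    by (rule measurable_space[OF state_law_measurable \<omega>])
  then have spL: "space (state_law n \<omega>) = space (states M)"
    by (auto simp: space_prob_algebra dest: sets_eq_imp_space_eq)
  show "(\<integral>\<^sup>+y. \<integral>\<^sup>+a. f (fst (y, a)) * indicator (avail M y) a \<partial>\<pi> n (\<omega>, y) \<partial>state_law n \<omega>) = (\<integral>\<^sup>+y. f y \<partial>state_law n \<omega>)"
  proof (rule nn_integral_cong)
    fix y assume "y \<in> space (state_law n \<omega>)"
    then have y: "y \<in> space (states M)" by (simp add: spL)
    have "\<pi> n (\<omega>, y) \<in> space (prob_algebra (actions M))"
      using measurable_space[OF policy_measurable, of "(\<omega>, y)" n] \<omega> y by (simp add: space_pair_measure)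
    then have s: "sets (\<pi> n (\<omega>, y)) = sets (actions M)" by (simp add: space_prob_algebra)
    show "(\<integral>\<^sup>+a. f (fst (y, a)) * indicator (avail M y) a \<partial>\<pi> n (\<omega>, y)) = f y"
      using avail_sets[OF y] policy_concentrated[OF \<omega> y]
      by (simp add: nn_integral_cmult_indicator s)
  qed
qed simp

text \<open>Restricting to the graph loses no mass: the total is the integral of 1, which reduces to
  the total mass of the state law.\<close>

lemma step_law_prob_algebra:
  "step_law M \<pi> x n \<in> (\<Pi>\<^sub>M i\<in>{0..<n}. graph_space M) \<rightarrow>\<^sub>M prob_algebra (graph_space M)"
proof (rule measurable_prob_algebraI)
  fix \<omega> assume \<omega>: "\<omega> \<in> space (\<Pi>\<^sub>M i\<in>{0..<n}. graph_space M)"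
  have L: "state_law n \<omega> \<in> space (prob_algebra (states M))"
    by (rule measurable_space[OF state_law_measurable \<omega>])
  then interpret L: prob_space "state_law n \<omega>" by (simp add: space_prob_algebra)
  have "emeasure (step_law M \<pi> x n \<omega>) (space (step_law M \<pi> x n \<omega>)) = 1"
    using nn_integral_step_law_fst[OF \<omega>, of "\<lambda>_. 1"] L.emeasure_space_1 by simp
  then show "prob_space (step_law M \<pi> x n \<omega>)" by (rule prob_spaceI)
next
  let ?S = "states M \<Otimes>\<^sub>M actions M"
  let ?G = "graph (avail M) (space (states M))"
  have N: "(\<lambda>\<omega>. state_law n \<omega> \<bind> (\<lambda>y. distr (\<pi> n (\<omega>, y)) ?S (Pair y)))
      \<in> (\<Pi>\<^sub>M i\<in>{0..<n}. graph_space M) \<rightarrow>\<^sub>M prob_algebra ?S"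
    by (rule measurable_bind_prob_space2[OF state_law_measurable pair_law_measurable])
  \<comment> \<open>An empty \<open>avail M x\<close> would have mass 0 instead of 1 under the
    decision rule at time 0.\<close>
  have "?G \<noteq> {}"
  proof
    assume "?G = {}"
    then have e: "avail M x = {}" using x by (auto simp: graph_def)
    have "(\<lambda>_. undefined) \<in> space (\<Pi>\<^sub>M i\<in>{0..<0::nat}. graph_space M)" by (simp add: space_PiM)
    from policy_concentrated[OF this x] e show False by simp
  qed
  then show "step_law M \<pi> x n \<in> (\<Pi>\<^sub>M i\<in>{0..<n}. graph_space M) \<rightarrow>\<^sub>M subprob_algebra (graph_space M)"
    unfolding step_law_def
    using restrict_space_measurable[OF _ graph_sets measurable_prob_algebraD[OF N]]
    by (simp add: graph_space_def)
qed

lemma step_law_subprob_algebra: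
  "step_law M \<pi> x n \<in> (\<Pi>\<^sub>M i\<in>{0..<n}. graph_space M) \<rightarrow>\<^sub>M subprob_algebra (graph_space M)"
  by (rule measurable_prob_algebraD[OF step_law_prob_algebra])

lemma prob_space_step_law:
  "\<omega> \<in> space (\<Pi>\<^sub>M i\<in>{0..<n}. graph_space M) \<Longrightarrow> prob_space (step_law M \<pi> x n \<omega>)"
  using measurable_space[OF step_law_prob_algebra] by (simp add: space_prob_algebra)

interpretation IT: Ionescu_Tulcea "step_law M \<pi> x" "\<lambda>_. graph_space M"
  by (rule Ionescu_Tulcea.intro) (fact step_law_subprob_algebra, fact prob_space_step_law)

lemma sets_trajectory [measurable_cong]:
  "sets (trajectory M \<pi> x) = sets (\<Pi>\<^sub>M i\<in>UNIV. graph_space M)"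
  unfolding trajectory_def by (rule IT.PF.sets_lim)

lemma space_trajectory: "space (trajectory M \<pi> x) = space (\<Pi>\<^sub>M i\<in>UNIV. graph_space M)"
  by (rule sets_eq_imp_space_eq[OF sets_trajectory])

text \<open>The projective family is built from \<open>IT.C\<close> on initial segments; over an
  initial segment itself the cylinder extension is the identity.\<close>

lemma distr_trajectory:
  "distr (trajectory M \<pi> x) (\<Pi>\<^sub>M i\<in>{0..<n}. graph_space M) (\<lambda>\<omega>. restrict \<omega> {0..<n}) =
    IT.C 0 n (\<lambda>_. undefined)"
proof -
  have u: "(\<lambda>_. undefined) \<in> space (\<Pi>\<^sub>M i\<in>{0..<0::nat}. graph_space M)" by (simp add: space_PiM)
  have sC: "sets (IT.C 0 n (\<lambda>_. undefined)) = sets (\<Pi>\<^sub>M i\<in>{0..<n}. graph_space M)"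
    using IT.sets_C[OF u] by simp
  have "IT.CI {0..<n} = IT.C 0 n (\<lambda>_. undefined)"
  proof (rule measure_eqI)
    show "sets (IT.CI {0..<n}) = sets (IT.C 0 n (\<lambda>_. undefined))"
      by (simp add: IT.CI_def sC)
    fix B assume "B \<in> sets (IT.CI {0..<n})"
    then have B: "B \<in> sets (\<Pi>\<^sub>M i\<in>{0..<n}. graph_space M)" by (simp add: IT.CI_def)
    then have "prod_emb {0..<n} (\<lambda>_. graph_space M) {0..<n} B = B"
      using sets.sets_into_space[OF B] by (intro prod_emb_id) (simp add: space_PiM)
    then show "emeasure (IT.CI {0..<n}) B = emeasure (IT.C 0 n (\<lambda>_. undefined)) B"
      using IT.emeasure_CI[of "{0..<n}" n B] B by simp
  qed
  then show ?thesis
    unfolding trajectory_def by (simp add: IT.distr_lim)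
qed

lemma nn_integral_trajectory_restrict:
  assumes "g \<in> borel_measurable (\<Pi>\<^sub>M i\<in>{0..<n}. graph_space M)"
  shows "(\<integral>\<^sup>+\<omega>. g (restrict \<omega> {0..<n}) \<partial>trajectory M \<pi> x) = (\<integral>\<^sup>+\<omega>. g \<omega> \<partial>IT.C 0 n (\<lambda>_. undefined))"
proof -
  have "(\<lambda>\<omega>. restrict \<omega> {0..<n}) \<in> trajectory M \<pi> x \<rightarrow>\<^sub>M (\<Pi>\<^sub>M i\<in>{0..<n}. graph_space M)"
    by (simp cong: measurable_cong_sets add: sets_trajectory measurable_restrict_subset)
  then show ?thesis
    using assms by (simp flip: distr_trajectory add: nn_integral_distr)
qed

lemma prob_space_trajectory: "prob_space (trajectory M \<pi> x)"
proof (rule prob_spaceI)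
  have u: "(\<lambda>_. undefined) \<in> space (\<Pi>\<^sub>M i\<in>{0..<0::nat}. graph_space M)" by (simp add: space_PiM)
  show "emeasure (trajectory M \<pi> x) (space (trajectory M \<pi> x)) = 1"
    using nn_integral_trajectory_restrict[of "\<lambda>_. 1" 0] prob_space.emeasure_space_1[OF IT.prob_space_C[OF u, of 0]]
    by simp
qed

text \<open>Tower property: the law of n + 1 pairs is the law of n pairs extended by
  \<open>step_law\<close>, and the integrand depends on the last pair only.\<close>

lemma nn_integral_trajectory:
  assumes f [measurable]: "f \<in> borel_measurable (graph_space M)"
  shows "(\<integral>\<^sup>+\<omega>. f (\<omega> n) \<partial>trajectory M \<pi> x) =
    (\<integral>\<^sup>+\<omega>. (\<integral>\<^sup>+z. f z \<partial>step_law M \<pi> x n (restrict \<omega> {0..<n})) \<partial>trajectory M \<pi> x)"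
proof -
  have u: "(\<lambda>_. undefined) \<in> space (\<Pi>\<^sub>M i\<in>{0..<0::nat}. graph_space M)" by (simp add: space_PiM)
  have spC: "space (IT.C 0 n (\<lambda>_. undefined)) = space (\<Pi>\<^sub>M i\<in>{0..<n}. graph_space M)"
    using IT.space_C[OF u] by simp
  have [measurable_cong]: "sets (IT.C 0 n (\<lambda>_. undefined)) = sets (\<Pi>\<^sub>M i\<in>{0..<n}. graph_space M)"
    using IT.sets_C[OF u] by simp
  have comp: "(\<lambda>\<omega>. \<omega> n) \<in> (\<Pi>\<^sub>M i\<in>{0..<Suc n}. graph_space M) \<rightarrow>\<^sub>M graph_space M"
    by (rule measurable_component_singleton) auto
  have "(\<integral>\<^sup>+\<omega>. f (\<omega> n) \<partial>trajectory M \<pi> x) = (\<integral>\<^sup>+\<omega>. f (restrict \<omega> {0..<Suc n} n) \<partial>trajectory M \<pi> x)"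
    by simp
  also have "\<dots> = (\<integral>\<^sup>+\<omega>. f (\<omega> n) \<partial>IT.C 0 (Suc n) (\<lambda>_. undefined))"
    by (rule nn_integral_trajectory_restrict) (rule measurable_compose[OF comp f])
  also have "\<dots> = (\<integral>\<^sup>+\<omega>. (\<integral>\<^sup>+\<omega>'. f (\<omega>' n) \<partial>IT.eP n \<omega>) \<partial>IT.C 0 n (\<lambda>_. undefined))"
    using IT.measurable_eP[of n] measurable_compose[OF comp f]
    by (simp, subst nn_integral_bind[where B="\<Pi>\<^sub>M i\<in>{0..<Suc n}. graph_space M"]) auto
  also have "\<dots> = (\<integral>\<^sup>+\<omega>. (\<integral>\<^sup>+z. f z \<partial>step_law M \<pi> x n \<omega>) \<partial>IT.C 0 n (\<lambda>_. undefined))"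
    using measurable_compose[OF comp f]
    by (intro nn_integral_cong) (simp add: spC IT.nn_integral_eP)
  also have "\<dots> = (\<integral>\<^sup>+\<omega>. (\<integral>\<^sup>+z. f z \<partial>step_law M \<pi> x n (restrict \<omega> {0..<n})) \<partial>trajectory M \<pi> x)"
    by (intro nn_integral_trajectory_restrict[symmetric]
        measurable_compose[OF step_law_subprob_algebra nn_integral_measurable_subprob_algebra] f)
  finally show ?thesis .
qed

lemma restrict_trajectory:
  "\<omega> \<in> space (trajectory M \<pi> x) \<Longrightarrow> restrict \<omega> {0..<n} \<in> space (\<Pi>\<^sub>M i\<in>{0..<n}. graph_space M)"
  by (auto simp: space_trajectory space_PiM)

lemma expectation_initial_state:
  assumes f [measurable]: "f \<in> borel_measurable (states M)"
  shows "(\<integral>\<^sup>+\<omega>. f (fst (\<omega> 0)) \<partial>trajectory M \<pi> x) = f x"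
proof -
  interpret T: prob_space "trajectory M \<pi> x" by (rule prob_space_trajectory)
  have "(\<integral>\<^sup>+\<omega>. f (fst (\<omega> 0)) \<partial>trajectory M \<pi> x) = (\<integral>\<^sup>+\<omega>. f x \<partial>trajectory M \<pi> x)"
    using x by (subst nn_integral_trajectory[of "\<lambda>z. f (fst z)"], simp)
      (intro nn_integral_cong, subst nn_integral_step_law_fst[OF restrict_trajectory f],
        simp_all add: nn_integral_return)
  then show ?thesis by (simp add: T.emeasure_space_1)
qed

lemma expectation_next_state:
  assumes f [measurable]: "f \<in> borel_measurable (states M)"
  shows "(\<integral>\<^sup>+\<omega>. f (fst (\<omega> (Suc n))) \<partial>trajectory M \<pi> x) =
    (\<integral>\<^sup>+\<omega>. (\<integral>\<^sup>+y. f y \<partial>kern M (\<omega> n)) \<partial>trajectory M \<pi> x)"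
  by (subst nn_integral_trajectory[of "\<lambda>z. f (fst z)"], simp)
    (intro nn_integral_cong, subst nn_integral_step_law_fst[OF restrict_trajectory f], simp_all)

end

end

section \<open>One-step inequalities and discounted cost\<close>

context mdp_kernel begin

lemma measurable_state_action [measurable]: "\<pi> \<in> policies M \<Longrightarrow> x \<in> space (states M) \<Longrightarrow>
    (\<lambda>\<omega>. \<omega> n) \<in> trajectory M \<pi> x \<rightarrow>\<^sub>M graph_space M"
  by (simp cong: measurable_cong_sets add: sets_trajectory measurable_component_singleton)

text \<open>The parameters serve both criteria: \<open>r = 0\<close> and \<open>b = \<beta>\<close>
  for discounted costs, \<open>b = 1\<close> and \<open>r\<close> the constant of the average-cost
  equation.\<close>

lemma expectation_le_next_state:
  assumes \<pi>: "\<pi> \<in> policies M" and x: "x \<in> space (states M)"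
    and f [measurable]: "f \<in> borel_measurable (states M)" and g [measurable]: "g \<in> borel_measurable (states M)"
    and le: "\<And>y a. y \<in> space (states M) \<Longrightarrow> a \<in> avail M y \<Longrightarrow>
      r + f y \<le> ennreal (cost M (y, a)) + b * (\<integral>\<^sup>+z. g z \<partial>kern M (y, a))"
  shows "r + (\<integral>\<^sup>+\<omega>. f (fst (\<omega> n)) \<partial>trajectory M \<pi> x) \<le>
    (\<integral>\<^sup>+\<omega>. ennreal (cost M (\<omega> n)) \<partial>trajectory M \<pi> x) + b * (\<integral>\<^sup>+\<omega>. g (fst (\<omega> (Suc n))) \<partial>trajectory M \<pi> x)"
proof -
  interpret T: prob_space "trajectory M \<pi> x" by (rule prob_space_trajectory[OF \<pi> x])
  note [measurable] = measurable_state_action[OF \<pi> x]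
  have K [measurable]: "(\<lambda>z. \<integral>\<^sup>+y. g y \<partial>kern M z) \<in> borel_measurable (graph_space M)"
    by (rule measurable_compose[OF measurable_prob_algebraD[OF kern_measurable] nn_integral_measurable_subprob_algebra[OF g]])
  have "r + (\<integral>\<^sup>+\<omega>. f (fst (\<omega> n)) \<partial>trajectory M \<pi> x) = (\<integral>\<^sup>+\<omega>. r + f (fst (\<omega> n)) \<partial>trajectory M \<pi> x)"
    by (simp add: nn_integral_add T.emeasure_space_1)
  also have "\<dots> \<le> (\<integral>\<^sup>+\<omega>. ennreal (cost M (\<omega> n)) + b * (\<integral>\<^sup>+y. g y \<partial>kern M (\<omega> n)) \<partial>trajectory M \<pi> x)"
  proof (rule nn_integral_mono)
    fix \<omega> assume "\<omega> \<in> space (trajectory M \<pi> x)"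
    then have "\<omega> n \<in> graph (avail M) (space (states M))"
      by (auto simp: space_trajectory[OF \<pi> x] space_PiM space_graph_space)
    then show "r + f (fst (\<omega> n)) \<le> ennreal (cost M (\<omega> n)) + b * (\<integral>\<^sup>+y. g y \<partial>kern M (\<omega> n))"
      using le[of "fst (\<omega> n)" "snd (\<omega> n)"] by (auto simp: graph_def)
  qed
  also have "\<dots> = (\<integral>\<^sup>+\<omega>. ennreal (cost M (\<omega> n)) \<partial>trajectory M \<pi> x) + b * (\<integral>\<^sup>+\<omega>. g (fst (\<omega> (Suc n))) \<partial>trajectory M \<pi> x)"
    by (simp add: nn_integral_add nn_integral_cmult expectation_next_state[OF \<pi> x g])
  finally show ?thesis .
qed

lemma discounted_cost_eq_suminf:
  assumes \<pi>: "\<pi> \<in> policies M" and x: "x \<in> space (states M)" and \<beta>: "0 \<le> \<beta>"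
  shows "discounted_cost M \<beta> \<pi> x =
    (\<Sum>n. ennreal (\<beta> ^ n) * (\<integral>\<^sup>+\<omega>. ennreal (cost M (\<omega> n)) \<partial>trajectory M \<pi> x))"
proof -
  note [measurable] = measurable_state_action[OF \<pi> x]
  have "discounted_cost M \<beta> \<pi> x = (\<Sum>n. \<integral>\<^sup>+\<omega>. ennreal (\<beta> ^ n * cost M (\<omega> n)) \<partial>trajectory M \<pi> x)"
    unfolding discounted_cost_def by (rule nn_integral_suminf) simp
  also have "\<dots> = (\<Sum>n. \<integral>\<^sup>+\<omega>. ennreal (\<beta> ^ n) * ennreal (cost M (\<omega> n)) \<partial>trajectory M \<pi> x)"
    using \<beta> by (simp add: ennreal_mult')
  also have "\<dots> = (\<Sum>n. ennreal (\<beta> ^ n) * (\<integral>\<^sup>+\<omega>. ennreal (cost M (\<omega> n)) \<partial>trajectory M \<pi> x))"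
    by (simp add: nn_integral_cmult)
  finally show ?thesis .
qed

text \<open>Dynamic programming bound for history-dependent policies: \<open>V n x\<close> is at
  most the cost of the first \<open>n\<close> stages, and later costs are nonnegative.\<close>

lemma discounted_cost_ge:
  assumes \<pi>: "\<pi> \<in> policies M" and x: "x \<in> space (states M)" and \<beta>: "0 \<le> \<beta>"
    and V [measurable]: "\<And>n. V n \<in> borel_measurable (states M)"
    and V0: "\<And>y. y \<in> space (states M) \<Longrightarrow> V 0 y = 0"
    and step: "\<And>n y a. y \<in> space (states M) \<Longrightarrow> a \<in> avail M y \<Longrightarrow>
      V (Suc n) y \<le> ennreal (cost M (y, a)) + ennreal \<beta> * (\<integral>\<^sup>+z. V n z \<partial>kern M (y, a))"
  shows "V n x \<le> discounted_cost M \<beta> \<pi> x"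
proof -
  define E where "E k = (\<integral>\<^sup>+\<omega>. ennreal (cost M (\<omega> k)) \<partial>trajectory M \<pi> x)" for k
  \<comment> \<open>Here \<open>j\<close> stages are played and a horizon of \<open>n\<close> is
    left. The index \<open>n\<close> must vary in the induction, because playing one more stage
    turns \<open>V (Suc n)\<close> into \<open>V n\<close>.\<close>
  have *: "V (n + j) x \<le> (\<Sum>k<j. ennreal (\<beta> ^ k) * E k) +
      ennreal (\<beta> ^ j) * (\<integral>\<^sup>+\<omega>. V n (fst (\<omega> j)) \<partial>trajectory M \<pi> x)" for j n
  proof (induction j arbitrary: n)
    case 0
    then show ?case by (simp add: expectation_initial_state[OF \<pi> x V])
  next
    case (Suc j)
    have "V (n + Suc j) x \<le> (\<Sum>k<j. ennreal (\<beta> ^ k) * E k) +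
        ennreal (\<beta> ^ j) * (\<integral>\<^sup>+\<omega>. V (Suc n) (fst (\<omega> j)) \<partial>trajectory M \<pi> x)"
      using Suc[of "Suc n"] by simp
    also have "\<dots> \<le> (\<Sum>k<j. ennreal (\<beta> ^ k) * E k) + ennreal (\<beta> ^ j) *
        (E j + ennreal \<beta> * (\<integral>\<^sup>+\<omega>. V n (fst (\<omega> (Suc j))) \<partial>trajectory M \<pi> x))"
      using expectation_le_next_state[OF \<pi> x V[of "Suc n"] V[of n], of 0 "ennreal \<beta>" j] step
      by (intro add_left_mono mult_left_mono) (auto simp: E_def)
    finally show ?case
      using \<beta> by (simp add: distrib_left mult.assoc[symmetric] ennreal_mult' add.assoc mult.commute)
  qed
  have "V n x \<le> (\<Sum>k<n. ennreal (\<beta> ^ k) * E k)"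
  proof -
    have "(\<integral>\<^sup>+\<omega>. V 0 (fst (\<omega> n)) \<partial>trajectory M \<pi> x) = (\<integral>\<^sup>+\<omega>. 0 \<partial>trajectory M \<pi> x)"
      using measurable_space[OF measurable_state_action[OF \<pi> x], of _ n]
      by (intro nn_integral_cong V0 measurable_space[OF measurable_fst_graph_space]) auto
    then show ?thesis using *[of 0 n] by simp
  qed
  also have "\<dots> \<le> (\<Sum>k. ennreal (\<beta> ^ k) * E k)"
    by (rule sum_le_suminf) auto
  finally show ?thesis by (simp add: discounted_cost_eq_suminf[OF \<pi> x \<beta>] E_def)
qed

lemma stationary_in_policies:
  assumes \<phi>: "\<phi> \<in> stationary_policies M"
  shows "stationary M \<phi> \<in> policies M"
proof -
  have [measurable]: "\<phi> \<in> states M \<rightarrow>\<^sub>M actions M" using \<phi> by (simp add: stationary_policies_def)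
  have "stationary M \<phi> n \<in> history_space M n \<rightarrow>\<^sub>M prob_algebra (actions M)" for n
    unfolding stationary_def history_space_def by measurable
  moreover have "emeasure (stationary M \<phi> n (\<omega>, x)) (avail M x) = 1"
    if "(\<omega>, x) \<in> space (history_space M n)" for n \<omega> x
  proof -
    have "x \<in> space (states M)" using that by (auto simp: history_space_def space_pair_measure)
    then show ?thesis using \<phi> by (simp add: stationary_def avail_sets stationary_policies_def)
  qed
  ultimately show ?thesis by (auto simp: policies_def)
qed

section \<open>Processes under a stationary policy\<close>

context
  fixes \<phi> assumes \<phi>: "\<phi> \<in> stationary_policies M"
begin

lemma measurable_stationary_graph [measurable]: "(\<lambda>y. (y, \<phi> y)) \<in> states M \<rightarrow>\<^sub>M graph_space M"
proof -
  have [measurable]: "\<phi> \<in> states M \<rightarrow>\<^sub>M actions M" using \<phi> by (simp add: stationary_policies_def)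
  show ?thesis
    unfolding graph_space_def
    by (rule measurable_restrict_space2) (use \<phi> in \<open>auto simp: stationary_policies_def graph_def\<close>)
qed

text \<open>The decision rule is a Dirac measure, so every step law charges only pairs
  \<open>(y, \<phi> y)\<close>.\<close>

lemma expectation_stationary:
  assumes x: "x \<in> space (states M)" and f [measurable]: "f \<in> borel_measurable (graph_space M)"
  shows "(\<integral>\<^sup>+\<omega>. f (\<omega> n) \<partial>trajectory M (stationary M \<phi>) x) =
    (\<integral>\<^sup>+\<omega>. f (fst (\<omega> n), \<phi> (fst (\<omega> n))) \<partial>trajectory M (stationary M \<phi>) x)"
proof -
  note \<pi> = stationary_in_policies[OF \<phi>]
  have m: "(\<lambda>z. f (fst z, \<phi> (fst z))) \<in> borel_measurable (graph_space M)"
    by (rule measurable_compose[OF measurable_compose[OF measurable_fst_graph_space measurable_stationary_graph] f])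
  \<comment> \<open>The integral against a Dirac measure is evaluated for functions measurable on
    all actions; extending \<open>g\<close> by 0 off the graph supplies this.\<close>
  have avm: "(\<lambda>a. g (y, a) * indicator (avail M y) a) \<in> borel_measurable (actions M)"
    if g: "g \<in> borel_measurable (graph_space M)" and y: "y \<in> space (states M)" for g :: "_ \<Rightarrow> ennreal" and y
  proof -
    let ?G = "graph (avail M) (space (states M))"
    have "?G \<inter> space (states M \<Otimes>\<^sub>M actions M) \<in> sets (states M \<Otimes>\<^sub>M actions M)" using graph_sets by auto
    then have "(\<lambda>z. g z * indicator ?G z) \<in> borel_measurable (states M \<Otimes>\<^sub>M actions M)"
      using g unfolding graph_space_def by (simp add: borel_measurable_restrict_space_iff_ennreal)
    then have "(\<lambda>a. g (y, a) * indicator ?G (y, a)) \<in> borel_measurable (actions M)"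
      by (rule measurable_Pair2) (rule y)
    also have "(\<lambda>a. g (y, a) * indicator ?G (y, a)) = (\<lambda>a. g (y, a) * indicator (avail M y) a)"
      using y by (auto simp: graph_def split: split_indicator)
    finally show ?thesis .
  qed
  show ?thesis
  proof (subst (1 2) nn_integral_trajectory[OF \<pi> x])
    show "(\<integral>\<^sup>+\<omega>. (\<integral>\<^sup>+z. f z \<partial>step_law M (stationary M \<phi>) x n (restrict \<omega> {0..<n})) \<partial>trajectory M (stationary M \<phi>) x)
     = (\<integral>\<^sup>+\<omega>. (\<integral>\<^sup>+z. f (fst z, \<phi> (fst z)) \<partial>step_law M (stationary M \<phi>) x n (restrict \<omega> {0..<n})) \<partial>trajectory M (stationary M \<phi>) x)"
    proof (rule nn_integral_cong)
      fix \<omega> assume "\<omega> \<in> space (trajectory M (stationary M \<phi>) x)"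
      note r = restrict_trajectory[OF \<pi> x this, of n]
      have sp: "space (case n of 0 \<Rightarrow> return (states M) x | Suc m \<Rightarrow> kern M (restrict \<omega> {0..<n} m)) = space (states M)"
        using measurable_space[OF state_law_measurable[OF \<pi> x] r]
        by (auto simp: space_prob_algebra dest: sets_eq_imp_space_eq)
      show "(\<integral>\<^sup>+z. f z \<partial>step_law M (stationary M \<phi>) x n (restrict \<omega> {0..<n})) =
        (\<integral>\<^sup>+z. f (fst z, \<phi> (fst z)) \<partial>step_law M (stationary M \<phi>) x n (restrict \<omega> {0..<n}))"
      proof (subst (1 2) nn_integral_step_law[OF \<pi> x r])
        show "(\<integral>\<^sup>+y. (\<integral>\<^sup>+a. f (y, a) * indicator (avail M y) a \<partial>stationary M \<phi> n (restrict \<omega> {0..<n}, y))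
            \<partial>(case n of 0 \<Rightarrow> return (states M) x | Suc m \<Rightarrow> kern M (restrict \<omega> {0..<n} m))) =
          (\<integral>\<^sup>+y. (\<integral>\<^sup>+a. f (fst (y, a), \<phi> (fst (y, a))) * indicator (avail M y) a \<partial>stationary M \<phi> n (restrict \<omega> {0..<n}, y))
            \<partial>(case n of 0 \<Rightarrow> return (states M) x | Suc m \<Rightarrow> kern M (restrict \<omega> {0..<n} m)))"
        proof (rule nn_integral_cong, unfold sp)
          fix y assume y: "y \<in> space (states M)"
          then have "\<phi> y \<in> avail M y" "\<phi> y \<in> space (actions M)"
            using \<phi> by (auto simp: stationary_policies_def dest: measurable_space)
          then show "(\<integral>\<^sup>+a. f (y, a) * indicator (avail M y) a \<partial>stationary M \<phi> n (restrict \<omega> {0..<n}, y)) =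
            (\<integral>\<^sup>+a. f (fst (y, a), \<phi> (fst (y, a))) * indicator (avail M y) a \<partial>stationary M \<phi> n (restrict \<omega> {0..<n}, y))"
            using avm[OF f y] avm[OF m y] by (simp add: stationary_def nn_integral_return)
        qed
      qed (rule f m)+
    qed
  qed (rule f m)+
qed

text \<open>Reverse of \<open>expectation_le_next_state\<close>: the upper estimate is available
  only at the chosen actions, which suffices because almost surely only pairs
  \<open>(y, \<phi> y)\<close> occur.\<close>

lemma expectation_stationary_step:
  assumes x: "x \<in> space (states M)"
    and f [measurable]: "f \<in> borel_measurable (states M)" and g [measurable]: "g \<in> borel_measurable (states M)"
    and le: "\<And>y. y \<in> space (states M) \<Longrightarrow>
      ennreal (cost M (y, \<phi> y)) + b * (\<integral>\<^sup>+z. g z \<partial>kern M (y, \<phi> y)) \<le> r + f y"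
  shows "(\<integral>\<^sup>+\<omega>. ennreal (cost M (\<omega> n)) \<partial>trajectory M (stationary M \<phi>) x) +
      b * (\<integral>\<^sup>+\<omega>. g (fst (\<omega> (Suc n))) \<partial>trajectory M (stationary M \<phi>) x) \<le>
      r + (\<integral>\<^sup>+\<omega>. f (fst (\<omega> n)) \<partial>trajectory M (stationary M \<phi>) x)"
proof -
  note \<pi> = stationary_in_policies[OF \<phi>]
  interpret T: prob_space "trajectory M (stationary M \<phi>) x" by (rule prob_space_trajectory[OF \<pi> x])
  note [measurable] = measurable_state_action[OF \<pi> x]
  have K [measurable]: "(\<lambda>z. \<integral>\<^sup>+y. g y \<partial>kern M z) \<in> borel_measurable (graph_space M)"
    by (rule measurable_compose[OF measurable_prob_algebraD[OF kern_measurable] nn_integral_measurable_subprob_algebra[OF g]])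
  have "(\<integral>\<^sup>+\<omega>. ennreal (cost M (\<omega> n)) \<partial>trajectory M (stationary M \<phi>) x) +
      b * (\<integral>\<^sup>+\<omega>. g (fst (\<omega> (Suc n))) \<partial>trajectory M (stationary M \<phi>) x) =
    (\<integral>\<^sup>+\<omega>. ennreal (cost M (\<omega> n)) + b * (\<integral>\<^sup>+y. g y \<partial>kern M (\<omega> n)) \<partial>trajectory M (stationary M \<phi>) x)"
    by (simp add: nn_integral_add nn_integral_cmult expectation_next_state[OF \<pi> x g])
  also have "\<dots> = (\<integral>\<^sup>+\<omega>. ennreal (cost M (fst (\<omega> n), \<phi> (fst (\<omega> n)))) +
      b * (\<integral>\<^sup>+y. g y \<partial>kern M (fst (\<omega> n), \<phi> (fst (\<omega> n)))) \<partial>trajectory M (stationary M \<phi>) x)"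
    by (rule expectation_stationary[OF x, of "\<lambda>z. ennreal (cost M z) + b * (\<integral>\<^sup>+y. g y \<partial>kern M z)"]) simp
  also have "\<dots> \<le> (\<integral>\<^sup>+\<omega>. r + f (fst (\<omega> n)) \<partial>trajectory M (stationary M \<phi>) x)"
    by (intro nn_integral_mono le measurable_space[OF measurable_fst_graph_space]
        measurable_space[OF measurable_state_action[OF \<pi> x]])
  also have "\<dots> = r + (\<integral>\<^sup>+\<omega>. f (fst (\<omega> n)) \<partial>trajectory M (stationary M \<phi>) x)"
    by (simp add: nn_integral_add T.emeasure_space_1)
  finally show ?thesis .
qed

text \<open>A nonnegative supersolution dominates the cost: iteration keeps the
  \<open>j\<close>-stage cost plus a nonnegative remainder below \<open>v x\<close>, and dropping
  the remainder needs no decay of \<open>v\<close> along the process.\<close>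

lemma discounted_cost_stationary_le:
  assumes x: "x \<in> space (states M)" and \<beta>: "0 \<le> \<beta>"
    and v [measurable]: "v \<in> borel_measurable (states M)"
    and le: "\<And>y. y \<in> space (states M) \<Longrightarrow>
      ennreal (cost M (y, \<phi> y)) + ennreal \<beta> * (\<integral>\<^sup>+z. v z \<partial>kern M (y, \<phi> y)) \<le> v y"
  shows "discounted_cost M \<beta> (stationary M \<phi>) x \<le> v x"
proof -
  note \<pi> = stationary_in_policies[OF \<phi>]
  define E where "E k = (\<integral>\<^sup>+\<omega>. ennreal (cost M (\<omega> k)) \<partial>trajectory M (stationary M \<phi>) x)" for k
  have *: "(\<Sum>k<j. ennreal (\<beta> ^ k) * E k) +
      ennreal (\<beta> ^ j) * (\<integral>\<^sup>+\<omega>. v (fst (\<omega> j)) \<partial>trajectory M (stationary M \<phi>) x) \<le> v x" for j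
  proof (induction j)
    case 0
    then show ?case by (simp add: expectation_initial_state[OF \<pi> x v])
  next
    case (Suc j)
    have "(\<Sum>k<j. ennreal (\<beta> ^ k) * E k) + ennreal (\<beta> ^ j) *
        (E j + ennreal \<beta> * (\<integral>\<^sup>+\<omega>. v (fst (\<omega> (Suc j))) \<partial>trajectory M (stationary M \<phi>) x)) \<le> 
        (\<Sum>k<j. ennreal (\<beta> ^ k) * E k) +
        ennreal (\<beta> ^ j) * (\<integral>\<^sup>+\<omega>. v (fst (\<omega> j)) \<partial>trajectory M (stationary M \<phi>) x)"
      using expectation_stationary_step[OF x v v, of "ennreal \<beta>" 0 j] le
      by (intro add_left_mono mult_left_mono) (auto simp: E_def)
    also note Suc
    finally show ?case
      using \<beta> by (simp add: distrib_left mult.assoc[symmetric] ennreal_mult' add.assoc mult.commute)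
  qed
  have "(\<Sum>k<j. ennreal (\<beta> ^ k) * E k) \<le> v x" for j
    using *[of j] by (rule order_trans[rotated]) simp
  then have "(\<Sum>k. ennreal (\<beta> ^ k) * E k) \<le> v x"
    by (intro suminf_le_const) auto
  then show ?thesis by (simp add: discounted_cost_eq_suminf[OF \<pi> x \<beta>] E_def)
qed

abbreviation (input) stationary_op :: "('s \<Rightarrow> ennreal) \<Rightarrow> 's \<Rightarrow> ennreal" where
  "stationary_op g \<equiv> (\<lambda>x. \<integral>\<^sup>+y. g y \<partial>kern M (x, \<phi> x))"

lemma measurable_stationary_op:
  assumes "g \<in> borel_measurable (states M)"
  shows "stationary_op g \<in> borel_measurable (states M)"
  by (rule measurable_compose[OF measurable_compose[OF measurable_stationary_graph
        measurable_prob_algebraD[OF kern_measurable]] nn_integral_measurable_subprob_algebra[OF assms]])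

lemma measurable_stationary_op_power:
  "g \<in> borel_measurable (states M) \<Longrightarrow> (stationary_op ^^ n) g \<in> borel_measurable (states M)"
  by (induction n) (auto intro: measurable_stationary_op)

text \<open>The kernel acts on \<open>g\<close> at the last transition, so the induction step
  replaces \<open>g\<close> by its image under the operator; hence \<open>g\<close> is kept
  arbitrary.\<close>

lemma expectation_stationary_power:
  assumes x: "x \<in> space (states M)" and "g \<in> borel_measurable (states M)"
  shows "(\<integral>\<^sup>+\<omega>. g (fst (\<omega> n)) \<partial>trajectory M (stationary M \<phi>) x) = (stationary_op ^^ n) g x"
  using assms(2)
proof (induction n arbitrary: g)
  case 0
  then show ?case by (simp add: expectation_initial_state[OF stationary_in_policies[OF \<phi>] x])
next
  case (Suc n)
  note g = Suc.prems
  have K: "(\<lambda>z. \<integral>\<^sup>+y. g y \<partial>kern M z) \<in> borel_measurable (graph_space M)"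
    by (rule measurable_compose[OF measurable_prob_algebraD[OF kern_measurable] nn_integral_measurable_subprob_algebra[OF g]])
  show ?case
    unfolding expectation_next_state[OF stationary_in_policies[OF \<phi>] x g]
      expectation_stationary[OF x K] funpow_Suc_right o_def
    by (rule Suc.IH[OF measurable_stationary_op[OF g]])
qed

text \<open>First-step decomposition without shifting trajectories: the cost is a series in powers
  of the kernel operator, and its tail from index 1 is \<open>\<beta>\<close> times the kernel
  applied to the whole series. It is used to show that an optimal policy attains the minimum in the
  discounted equation.\<close>

lemma discounted_cost_stationary:
  assumes x: "x \<in> space (states M)" and \<beta>: "0 \<le> \<beta>"
  shows "discounted_cost M \<beta> (stationary M \<phi>) x = ennreal (cost M (x, \<phi> x)) +
    ennreal \<beta> * (\<integral>\<^sup>+y. discounted_cost M \<beta> (stationary M \<phi>) y \<partial>kern M (x, \<phi> x))"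
proof -
  note \<pi> = stationary_in_policies[OF \<phi>]
  define C where "C y = ennreal (cost M (y, \<phi> y))" for y
  have C: "C \<in> borel_measurable (states M)"
    unfolding C_def using measurable_compose[OF measurable_stationary_graph cost_measurable] by simp
  have J: "discounted_cost M \<beta> (stationary M \<phi>) y = (\<Sum>n. ennreal (\<beta> ^ n) * (stationary_op ^^ n) C y)"
    if y: "y \<in> space (states M)" for y
  proof -
    have "(\<integral>\<^sup>+\<omega>. ennreal (cost M (\<omega> n)) \<partial>trajectory M (stationary M \<phi>) y) = (stationary_op ^^ n) C y" for n
      unfolding expectation_stationary_power[OF y C, symmetric]
      using expectation_stationary[OF y, of "\<lambda>z. ennreal (cost M z)" n] by (simp add: C_def)
    then show ?thesis by (simp add: discounted_cost_eq_suminf[OF \<pi> y \<beta>])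
  qed
  have kx: "kern M (x, \<phi> x) \<in> space (prob_algebra (states M))"
    by (rule measurable_space[OF measurable_compose[OF measurable_stationary_graph kern_measurable] x])
  then have [measurable_cong]: "sets (kern M (x, \<phi> x)) = sets (states M)"
    and sp: "space (kern M (x, \<phi> x)) = space (states M)"
    by (auto simp: space_prob_algebra dest: sets_eq_imp_space_eq)
  note [measurable] = measurable_stationary_op_power[OF C]
  have "discounted_cost M \<beta> (stationary M \<phi>) x = C x + (\<Sum>n. ennreal (\<beta> ^ Suc n) * (stationary_op ^^ Suc n) C x)"
    unfolding J[OF x] by (subst suminf_offset[of _ 1]) (auto simp: add.commute)
  also have "(\<Sum>n. ennreal (\<beta> ^ Suc n) * (stationary_op ^^ Suc n) C x) =
      (\<Sum>n. ennreal \<beta> * (\<integral>\<^sup>+y. ennreal (\<beta> ^ n) * (stationary_op ^^ n) C y \<partial>kern M (x, \<phi> x)))"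
    using \<beta> by (intro suminf_cong) (simp add: nn_integral_cmult ennreal_mult' mult.assoc)
  also have "\<dots> = ennreal \<beta> * (\<integral>\<^sup>+y. (\<Sum>n. ennreal (\<beta> ^ n) * (stationary_op ^^ n) C y) \<partial>kern M (x, \<phi> x))"
    by (simp add: nn_integral_suminf)
  also have "(\<integral>\<^sup>+y. (\<Sum>n. ennreal (\<beta> ^ n) * (stationary_op ^^ n) C y) \<partial>kern M (x, \<phi> x)) =
     (\<integral>\<^sup>+y. discounted_cost M \<beta> (stationary M \<phi>) y \<partial>kern M (x, \<phi> x))"
    by (intro nn_integral_cong) (simp add: sp J)
  finally show ?thesis by (simp add: C_def)
qed

end

section \<open>Bounds on the average cost\<close>

lemma average_cost_eq:
  assumes \<pi>: "\<pi> \<in> policies M" and x: "x \<in> space (states M)"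
  shows "average_cost M \<pi> x =
    limsup (\<lambda>N. (\<Sum>n<N. \<integral>\<^sup>+\<omega>. ennreal (cost M (\<omega> n)) \<partial>trajectory M \<pi> x) / of_nat N)"
proof -
  note [measurable] = measurable_state_action[OF \<pi> x]
  show ?thesis unfolding average_cost_def by (subst nn_integral_sum) auto
qed

lemma nn_integral_trajectory_le:
  assumes \<pi>: "\<pi> \<in> policies M" and x: "x \<in> space (states M)"
    and g: "\<And>y. y \<in> space (states M) \<Longrightarrow> g y \<le> B"
  shows "(\<integral>\<^sup>+\<omega>. g (fst (\<omega> n)) \<partial>trajectory M \<pi> x) \<le> B"
proof -
  interpret T: prob_space "trajectory M \<pi> x" by (rule prob_space_trajectory[OF \<pi> x])
  have "(\<integral>\<^sup>+\<omega>. g (fst (\<omega> n)) \<partial>trajectory M \<pi> x) \<le> (\<integral>\<^sup>+\<omega>. B \<partial>trajectory M \<pi> x)"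
    by (intro nn_integral_mono g measurable_space[OF measurable_fst_graph_space]
        measurable_space[OF measurable_state_action[OF \<pi> x]])
  then show ?thesis by (simp add: T.emeasure_space_1)
qed

lemma tendsto_divide_nat_ennreal: "B < \<infinity> \<Longrightarrow> (\<lambda>n. (B::ennreal) / of_nat n) \<longlonglongrightarrow> 0"
proof -
  assume "B < \<infinity>"
  then obtain b where b: "B = ennreal b" "0 \<le> b" by (cases B) auto
  have "(\<lambda>n. ennreal (b / real n)) \<longlonglongrightarrow> ennreal 0"
    by (intro tendsto_ennrealI tendsto_divide_0[OF tendsto_const] filterlim_real_at_infinity_sequentially)
  moreover have "\<forall>\<^sub>F n in sequentially. ennreal (b / real n) = B / of_nat n"
    using eventually_gt_at_top[of 0]
    by eventually_elim (simp add: b ennreal_of_nat_eq_real_of_nat divide_ennreal)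
  ultimately show ?thesis by (simp add: tendsto_cong)
qed

text \<open>The inequality telescopes over \<open>n\<close> stages; the boundary terms lie between 0
  and \<open>B\<close>, so they disappear after division by \<open>n\<close>.\<close>

lemma average_cost_ge:
  assumes \<pi>: "\<pi> \<in> policies M" and x: "x \<in> space (states M)"
    and g [measurable]: "g \<in> borel_measurable (states M)"
    and gB: "\<And>y. y \<in> space (states M) \<Longrightarrow> g y \<le> B" and B: "B < \<infinity>" and r: "r < \<infinity>"
    and le: "\<And>y a. y \<in> space (states M) \<Longrightarrow> a \<in> avail M y \<Longrightarrow>
      r + g y \<le> ennreal (cost M (y, a)) + (\<integral>\<^sup>+z. g z \<partial>kern M (y, a))"
  shows "r \<le> average_cost M \<pi> x"
proof -
  define E where "E k = (\<integral>\<^sup>+\<omega>. ennreal (cost M (\<omega> k)) \<partial>trajectory M \<pi> x)" for k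
  define I where "I k = (\<integral>\<^sup>+\<omega>. g (fst (\<omega> k)) \<partial>trajectory M \<pi> x)" for k
  have IB: "I k \<le> B" for k unfolding I_def by (rule nn_integral_trajectory_le[OF \<pi> x gB])
  have "of_nat n * r + I 0 \<le> (\<Sum>k<n. E k) + I n" for n
  proof (induction n)
    case (Suc n)
    have "of_nat (Suc n) * r + I 0 \<le> r + ((\<Sum>k<n. E k) + I n)"
      using add_left_mono[OF Suc, of r] by (simp add: distrib_right add.assoc)
    also have "\<dots> = (\<Sum>k<n. E k) + (r + I n)" by (simp add: ac_simps)
    also have "\<dots> \<le> (\<Sum>k<n. E k) + (E n + I (Suc n))"
      using expectation_le_next_state[OF \<pi> x g g, of r 1 n] le
      by (intro add_left_mono) (simp add: E_def I_def)
    finally show ?case by (simp add: ac_simps)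
  qed simp
  then have *: "of_nat n * r \<le> (\<Sum>k<n. E k) + B" for n
    by (meson IB add_left_mono add_increasing2 le_iff_add order_trans zero_le)
  have "\<forall>\<^sub>F n in sequentially. r - B / of_nat n \<le> (\<Sum>k<n. E k) / of_nat n"
    using eventually_gt_at_top[of 0]
  proof eventually_elim
    case (elim n)
    have "r = of_nat n * r / of_nat n"
      using elim by (metis ennreal_mult_divide_eq mult.commute of_nat_eq_0_iff ennreal_of_nat_neq_top less_irrefl)
    also have "\<dots> \<le> ((\<Sum>k<n. E k) + B) / of_nat n" by (rule divide_right_mono_ennreal[OF *])
    finally have "r \<le> (\<Sum>k<n. E k) / of_nat n + B / of_nat n" by (simp add: add_divide_distrib_ennreal)
    then show ?case using r by (auto simp: ennreal_minus_le_iff add.commute)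
  qed
  then have "limsup (\<lambda>n. r - B / of_nat n) \<le> limsup (\<lambda>n. (\<Sum>k<n. E k) / of_nat n)"
    by (rule Limsup_mono)
  moreover have "(\<lambda>n. r - B / of_nat n) \<longlonglongrightarrow> r - 0"
    using r by (intro tendsto_diff_ennreal tendsto_const tendsto_divide_nat_ennreal B) auto
  ultimately show ?thesis
    by (simp add: average_cost_eq[OF \<pi> x] E_def lim_imp_Limsup)
qed

text \<open>The same telescoping with the reverse inequality along \<open>\<phi>\<close>: now
  \<open>I n\<close> is dropped and \<open>I 0\<close> is the bounded error.\<close>

lemma average_cost_stationary_le:
  assumes \<phi>: "\<phi> \<in> stationary_policies M" and x: "x \<in> space (states M)"
    and g [measurable]: "g \<in> borel_measurable (states M)"
    and gB: "\<And>y. y \<in> space (states M) \<Longrightarrow> g y \<le> B" and B: "B < \<infinity>"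
    and le: "\<And>y. y \<in> space (states M) \<Longrightarrow>
      ennreal (cost M (y, \<phi> y)) + (\<integral>\<^sup>+z. g z \<partial>kern M (y, \<phi> y)) \<le> r + g y"
  shows "average_cost M (stationary M \<phi>) x \<le> r"
proof -
  note \<pi> = stationary_in_policies[OF \<phi>]
  define E where "E k = (\<integral>\<^sup>+\<omega>. ennreal (cost M (\<omega> k)) \<partial>trajectory M (stationary M \<phi>) x)" for k
  define I where "I k = (\<integral>\<^sup>+\<omega>. g (fst (\<omega> k)) \<partial>trajectory M (stationary M \<phi>) x)" for k
  have IB: "I k \<le> B" for k unfolding I_def by (rule nn_integral_trajectory_le[OF \<pi> x gB])
  have le': "(\<Sum>k<n. E k) + I n \<le> of_nat n * r + I 0" for n
  proof (induction n)
    case (Suc n)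
    have "(\<Sum>k<Suc n. E k) + I (Suc n) = (\<Sum>k<n. E k) + (E n + I (Suc n))" by (simp add: ac_simps)
    also have "\<dots> \<le> (\<Sum>k<n. E k) + (r + I n)"
      using expectation_stationary_step[OF \<phi> x g g, of 1 r n] le
      by (intro add_left_mono) (simp add: E_def I_def)
    also have "\<dots> = r + ((\<Sum>k<n. E k) + I n)" by (simp add: ac_simps)
    also have "\<dots> \<le> r + (of_nat n * r + I 0)" by (rule add_left_mono[OF Suc])
    finally show ?case by (simp add: distrib_right distrib_left ac_simps)
  qed simp
  have *: "(\<Sum>k<n. E k) \<le> of_nat n * r + B" for n
  proof -
    have "(\<Sum>k<n. E k) \<le> (\<Sum>k<n. E k) + I n" by simp
    also have "\<dots> \<le> of_nat n * r + B" using le'[of n] IB[of 0] by (meson add_left_mono order_trans)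
    finally show ?thesis .
  qed
  have "\<forall>\<^sub>F n in sequentially. (\<Sum>k<n. E k) / of_nat n \<le> r + B / of_nat n"
    using eventually_gt_at_top[of 0]
  proof eventually_elim
    case (elim n)
    have "(\<Sum>k<n. E k) / of_nat n \<le> (of_nat n * r + B) / of_nat n" by (rule divide_right_mono_ennreal[OF *])
    also have "\<dots> = of_nat n * r / of_nat n + B / of_nat n" by (simp add: add_divide_distrib_ennreal)
    also have "of_nat n * r / of_nat n = r"
      using elim by (metis ennreal_mult_divide_eq mult.commute of_nat_eq_0_iff ennreal_of_nat_neq_top less_irrefl)
    finally show ?case .
  qed
  then have "limsup (\<lambda>n. (\<Sum>k<n. E k) / of_nat n) \<le> limsup (\<lambda>n. r + B / of_nat n)"
    by (rule Limsup_mono)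
  moreover have "(\<lambda>n. r + B / of_nat n) \<longlonglongrightarrow> r + 0"
    by (intro tendsto_add tendsto_const tendsto_divide_nat_ennreal B)
  ultimately show ?thesis
    by (simp add: average_cost_eq[OF \<pi> x] E_def lim_imp_Limsup)
qed

end

section \<open>Lower semicontinuous functions\<close>

text \<open>Values are in [0, \<infinity>], unlike in \<open>lower_semicontinuous_on\<close>,
  because value functions may be infinite. With strict superlevel sets, suprema and Borel
  measurability are immediate.\<close>

definition lsc_on :: "'z::metric_space set \<Rightarrow> ('z \<Rightarrow> ennreal) \<Rightarrow> bool" where
  "lsc_on S f \<longleftrightarrow> (\<forall>r. openin (top_of_set S) {z \<in> S. r < f z})"

lemma openin_sets_restrict_borel:
  assumes "openin (top_of_set S) U" shows "U \<in> sets (restrict_space borel S)"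
proof -
  obtain T where "open T" "U = S \<inter> T" using assms unfolding openin_open by (elim exE conjE)
  then show ?thesis unfolding sets_restrict_space by (intro image_eqI[of _ _ T] borel_open)
qed

lemma lsc_on_openE:
  assumes "lsc_on S f"
  obtains W where "open W" "\<And>z. z \<in> S \<Longrightarrow> r < f z \<longleftrightarrow> z \<in> W"
proof -
  obtain W where W: "open W" "{z \<in> S. r < f z} = S \<inter> W"
    using assms[unfolded lsc_on_def openin_open, THEN spec, of r] by (elim exE conjE)
  show ?thesis
  proof (rule that[OF W(1)])
    fix z assume "z \<in> S"
    then show "r < f z \<longleftrightarrow> z \<in> W" using eqset_imp_iff[OF W(2), of z] by simp
  qed
qed

lemma lsc_on_borel_measurable: "lsc_on S f \<Longrightarrow> f \<in> borel_measurable (restrict_space borel S)"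
  by (rule borel_measurableI_greater)
    (simp add: lsc_on_def openin_sets_restrict_borel space_restrict_space)

lemma lsc_on_cong: "(\<And>z. z \<in> S \<Longrightarrow> f z = g z) \<Longrightarrow> lsc_on S f \<longleftrightarrow> lsc_on S g"
  by (simp add: lsc_on_def cong: conj_cong)

lemma lsc_on_subset:
  assumes "lsc_on S f" "T \<subseteq> S" shows "lsc_on T f"
  unfolding lsc_on_def
proof
  fix r
  obtain O' where "open O'" "\<And>z. z \<in> S \<Longrightarrow> r < f z \<longleftrightarrow> z \<in> O'"
    using lsc_on_openE[OF assms(1), of r] by metis
  then have "{z \<in> T. r < f z} = T \<inter> O'" using assms(2) by (auto simp: set_eq_iff)
  with \<open>open O'\<close> show "openin (top_of_set T) {z \<in> T. r < f z}" unfolding openin_open by (intro exI conjI)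
qed

lemma lsc_on_SUP:
  assumes "\<And>i. i \<in> I \<Longrightarrow> lsc_on S (f i)"
  shows "lsc_on S (\<lambda>z. SUP i\<in>I. f i z)"
  unfolding lsc_on_def
proof
  fix r
  have "{z \<in> S. r < (SUP i\<in>I. f i z)} = (\<Union>i\<in>I. {z \<in> S. r < f i z})"
    by (auto simp: less_SUP_iff)
  then show "openin (top_of_set S) {z \<in> S. r < (SUP i\<in>I. f i z)}"
    using assms unfolding lsc_on_def by (metis (no_types, lifting) openin_Union imageE)
qed

lemma continuous_on_imp_lsc_on:
  assumes "continuous_on S f"
  shows "lsc_on S (\<lambda>z. ennreal (f z))"
  unfolding lsc_on_def
proof
  fix r
  have "openin (top_of_set S) (S \<inter> (\<lambda>z. ennreal (f z)) -` {r<..})"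
    by (intro continuous_openin_preimage_gen continuous_on_ennreal assms) simp
  then show "openin (top_of_set S) {z \<in> S. r < ennreal (f z)}"
    by (simp add: vimage_def Int_def)
qed

lemma lower_semicontinuous_on_imp_lsc_on:
  fixes S :: "'z::metric_space set"
  assumes "lower_semicontinuous_on S f" and nonneg: "\<And>z. z \<in> S \<Longrightarrow> 0 \<le> f z"
  shows "lsc_on S (\<lambda>z. ennreal (f z))"
  unfolding lsc_on_def openin_euclidean_subtopology_iff
proof (intro allI conjI ballI)
  fix r z assume "z \<in> {z \<in> S. r < ennreal (f z)}"
  then have z: "z \<in> S" "r < ennreal (f z)" by auto
  then obtain s where s: "r = ennreal s" "0 \<le> s" "s < f z"
    by (cases r) (auto simp: ennreal_less_iff)
  then have "\<forall>\<^sub>F z' in at z within S. s < f z'"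
    using assms z by (auto simp: lower_semicontinuous_on_def)
  then obtain d where d: "d > 0" "\<And>y. y \<in> S \<Longrightarrow> y \<noteq> z \<Longrightarrow> dist y z < d \<Longrightarrow> s < f y"
    unfolding eventually_at by blast
  then have "\<forall>y\<in>S. dist y z < d \<longrightarrow> s < f y" using s(3) by blast
  with \<open>d > 0\<close> show "\<exists>e>0. \<forall>y\<in>S. dist y z < e \<longrightarrow> y \<in> {z \<in> S. r < ennreal (f z)}"
    using s(1,2) by (intro exI[of _ d]) (auto simp: ennreal_less_iff)
qed auto

text \<open>The approximants are the Lipschitz functions \<open>z \<mapsto> inf\<^sub>y (min (f y) k + k d(z, y))\<close>.\<close>

lemma lsc_on_imp_SUP_continuous:
  fixes S :: "'z::metric_space set"
  assumes f: "lsc_on S f"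
  obtains g :: "nat \<Rightarrow> 'z \<Rightarrow> real" where
    "\<And>k. continuous_on S (g k)" "\<And>k z. z \<in> S \<Longrightarrow> 0 \<le> g k z" "\<And>k z. z \<in> S \<Longrightarrow> g k z \<le> real k"
    "\<And>z. z \<in> S \<Longrightarrow> incseq (\<lambda>k. g k z)" "\<And>z. z \<in> S \<Longrightarrow> f z = (SUP k. ennreal (g k z))"
proof
  \<comment> \<open>Truncation makes the approximants real-valued even where \<open>f\<close> is
    infinite.\<close>
  define F where "F k y = enn2real (min (f y) (of_nat k))" for k y
  define g where "g k z = (INF y\<in>S. F k y + real k * dist z y)" for k z
  have F_eq: "ennreal (F k y) = min (f y) (of_nat k)" for k y
    unfolding F_def by (rule ennreal_enn2real) (auto simp: min_less_iff_disj ennreal_of_nat_eq_real_of_nat)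
  have F0: "0 \<le> F k y" for k y by (simp add: F_def)
  have Fk: "F k y \<le> real k" for k y
  proof -
    have "ennreal (F k y) \<le> ennreal (real k)" by (simp add: F_eq ennreal_of_nat_eq_real_of_nat)
    then show ?thesis by (simp add: ennreal_le_iff)
  qed
  have bdd: "bdd_below ((\<lambda>y. F k y + real k * dist z y) ` S)" for k z
    by (rule bdd_belowI[of _ 0]) (auto simp: F0)
  have g_le: "g k z \<le> F k y + real k * dist z y" if "y \<in> S" for k z y
    unfolding g_def using that by (rule cINF_lower[OF bdd])
  have g_ge: "b \<le> g k z" if "z \<in> S" "\<And>y. y \<in> S \<Longrightarrow> b \<le> F k y + real k * dist z y" for b k z
    unfolding g_def using that by (intro cINF_greatest) auto
  show g0: "0 \<le> g k z" if "z \<in> S" for k z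
    using that by (intro g_ge) (auto simp: F0)
  show gk: "g k z \<le> real k" if "z \<in> S" for k z
    using g_le[OF that, of k z] Fk[of k z] by simp
  have lip: "g k z \<le> g k z' + real k * dist z z'" if "z \<in> S" "z' \<in> S" for k z z'
  proof -
    have "g k z - real k * dist z z' \<le> g k z'"
    proof (rule g_ge[OF that(2)])
      fix y assume "y \<in> S"
      have "real k * dist z y \<le> real k * (dist z z' + dist z' y)"
        by (intro mult_left_mono dist_triangle) simp
      then show "g k z - real k * dist z z' \<le> F k y + real k * dist z' y"
        using g_le[OF \<open>y \<in> S\<close>, of k z] by (simp add: distrib_left)
    qed
    then show ?thesis by simp
  qed
  show "continuous_on S (g k)" for k
  proof (rule lipschitz_on_continuous_on)
    show "(real k)-lipschitz_on S (g k)"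
    proof (rule lipschitz_onI)
      fix z z' assume "z \<in> S" "z' \<in> S"
      with lip[of z z' k] lip[of z' z k] show "dist (g k z) (g k z') \<le> real k * dist z z'"
        by (auto simp: dist_real_def abs_le_iff dist_commute)
    qed simp
  qed
  show inc: "incseq (\<lambda>k. g k z)" if z: "z \<in> S" for z
  proof (rule incseq_SucI, rule g_ge[OF z])
    fix k y assume y: "y \<in> S"
    have "ennreal (F k y) \<le> ennreal (F (Suc k) y)"
      unfolding F_eq by (intro min.mono order_refl) (simp only: of_nat_le_iff)
    then have "F k y \<le> F (Suc k) y" by (simp add: ennreal_le_iff F0)
    moreover have "real k * dist z y \<le> real (Suc k) * dist z y" by (intro mult_right_mono) auto
    ultimately show "g k z \<le> F (Suc k) y + real (Suc k) * dist z y"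
      using g_le[OF y, of k z] by linarith
  qed
  show "f z = (SUP k. ennreal (g k z))" if z: "z \<in> S" for z
  proof (rule antisym)
    show "(SUP k. ennreal (g k z)) \<le> f z"
    proof (rule SUP_least)
      fix k
      have "ennreal (g k z) \<le> ennreal (F k z)" using g_le[OF z, of k z] by (intro ennreal_leI) simp
      then show "ennreal (g k z) \<le> f z" by (simp add: F_eq)
    qed
    show "f z \<le> (SUP k. ennreal (g k z))"
    proof (rule dense_le)
      fix s assume s: "s < f z"
      then obtain r where r: "s = ennreal r" "0 \<le> r" by (cases s) auto
      have "openin (top_of_set S) {z \<in> S. s < f z}" using f by (simp add: lsc_on_def)
      then obtain d where d: "d > 0" "\<And>y. y \<in> S \<Longrightarrow> dist y z < d \<Longrightarrow> s < f y"
        unfolding openin_euclidean_subtopology_iff using z s by blast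
      \<comment> \<open>\<open>k \<ge> r\<close> keeps the truncation from cutting below
        \<open>r\<close>; \<open>k \<ge> r / d\<close> makes the distance penalty at least
        \<open>r\<close> outside the ball of radius \<open>d\<close>, where \<open>f\<close> is not
        controlled.\<close>
      obtain k :: nat where k: "max r (r / d) \<le> real k" using real_arch_simple by blast
      have "r \<le> g k z"
      proof (rule g_ge[OF z])
        fix y assume y: "y \<in> S"
        show "r \<le> F k y + real k * dist z y"
        proof (cases "dist y z < d")
          case True
          have "ennreal r \<le> ennreal (F k y)"
            unfolding F_eq using d(2)[OF y True] k r by (simp add: ennreal_of_nat_eq_real_of_nat ennreal_leI)
          then show ?thesis using F0[of k y] by (simp add: ennreal_le_iff add_increasing2)
        next
          case False
          have "r \<le> real k * d" using k d(1) by (simp add: divide_le_eq)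
          also have "\<dots> \<le> real k * dist z y" using False by (intro mult_left_mono) (auto simp: dist_commute)
          finally show ?thesis using F0[of k y] by simp
        qed
      qed
      then show "s \<le> (SUP k. ennreal (g k z))"
        unfolding r by (intro SUP_upper2[of k] ennreal_leI) auto
    qed
  qed
qed

text \<open>Increasing continuous approximants avoid decomposing the superlevel sets of a sum and
  treat infinite values uniformly.\<close>

lemma lsc_on_add:
  assumes "lsc_on S f" "lsc_on S g"
  shows "lsc_on S (\<lambda>z. f z + g z)"
proof -
  obtain f' where f': "\<And>k. continuous_on S (f' k)" "\<And>k z. z \<in> S \<Longrightarrow> 0 \<le> f' k z"
    "\<And>z. z \<in> S \<Longrightarrow> incseq (\<lambda>k::nat. f' k z)" "\<And>z. z \<in> S \<Longrightarrow> f z = (SUP k. ennreal (f' k z))"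
    by (rule lsc_on_imp_SUP_continuous[OF assms(1)]) blast
  obtain g' where g': "\<And>k. continuous_on S (g' k)" "\<And>k z. z \<in> S \<Longrightarrow> 0 \<le> g' k z"
    "\<And>z. z \<in> S \<Longrightarrow> incseq (\<lambda>k::nat. g' k z)" "\<And>z. z \<in> S \<Longrightarrow> g z = (SUP k. ennreal (g' k z))"
    by (rule lsc_on_imp_SUP_continuous[OF assms(2)]) blast
  have "lsc_on S (\<lambda>z. SUP k. ennreal (f' k z + g' k z))"
    by (intro lsc_on_SUP continuous_on_imp_lsc_on continuous_on_add f' g')
  moreover have "(SUP k. ennreal (f' k z + g' k z)) = f z + g z" if z: "z \<in> S" for z
  proof -
    have "(SUP k. ennreal (f' k z + g' k z)) = (SUP k. ennreal (f' k z) + ennreal (g' k z))"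
      using z by (simp add: f' g')
    also have "\<dots> = f z + g z"
      unfolding f'(4)[OF z] g'(4)[OF z] using f'(3)[OF z] g'(3)[OF z]
      by (intro ennreal_SUP_add) (auto simp: mono_def intro: ennreal_leI)
    finally show ?thesis .
  qed
  ultimately show ?thesis by (simp cong: lsc_on_cong)
qed

text \<open>In \<open>bellman\<close> the constant is the value at \<open>l\<close>, which may be
  infinite, and the function is \<open>slack\<close>, which may vanish. Finite truncations of
  \<open>C\<close> give continuous functions whose supremum respects the convention that 0 times
  \<infinity> is 0.\<close>

lemma lsc_on_cmult_continuous:
  fixes C :: ennreal
  assumes "continuous_on S f" "\<And>z. z \<in> S \<Longrightarrow> 0 \<le> f z"
  shows "lsc_on S (\<lambda>z. C * ennreal (f z))"
proof -
  define t where "t n = enn2real (min C (of_nat n))" for n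
  have t: "ennreal (t n) = min C (of_nat n)" for n
    unfolding t_def by (rule ennreal_enn2real) (auto simp: min_less_iff_disj ennreal_of_nat_eq_real_of_nat)
  have C: "C = (SUP n. ennreal (t n))"
  proof (cases "C = \<infinity>")
    case True
    then show ?thesis using ennreal_SUP_of_nat_eq_top[symmetric] by (simp add: t)
  next
    case False
    then obtain c where c: "C = ennreal c" by (cases C) auto
    obtain n :: nat where "c \<le> real n" using real_arch_simple by blast
    then have "C \<le> of_nat n" by (simp add: c ennreal_of_nat_eq_real_of_nat ennreal_leI)
    then have "C \<le> ennreal (t n)" by (simp add: t)
    then show ?thesis by (intro antisym SUP_upper2[of n] SUP_least) (auto simp: t)
  qed
  have "lsc_on S (\<lambda>z. SUP n. ennreal (t n * f z))"
    by (intro lsc_on_SUP continuous_on_imp_lsc_on continuous_intros assms)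
  moreover have "(SUP n. ennreal (t n * f z)) = C * ennreal (f z)" if "z \<in> S" for z
    unfolding C using assms(2)[OF that] by (simp add: SUP_mult_right_ennreal ennreal_mult t_def)
  ultimately show ?thesis by (simp cong: lsc_on_cong)
qed

section \<open>Compactness and minimization\<close>

lemma compact_decseq_nonempty:
  fixes F :: "nat \<Rightarrow> 'a::metric_space set"
  assumes F: "\<And>n. compact (F n)" "\<And>n. F n \<noteq> {}" and dec: "decseq F"
  shows "(\<Inter>n. F n) \<noteq> {}"
proof -
  have "\<forall>n. \<exists>a. a \<in> F n" using F(2) by blast
  then obtain f where f: "\<And>n. f n \<in> F n" by metis
  then have "\<forall>n. f n \<in> F 0" using decseqD[OF dec, of 0] by blast
  then obtain a r where a: "a \<in> F 0" "strict_mono r" "(f \<circ> r) \<longlonglongrightarrow> a"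
    using F(1)[of 0] unfolding compact_def by blast
  have "a \<in> F n" for n
  proof (rule Lim_in_closed_set[OF compact_imp_closed[OF F(1)] _ _ a(3)])
    show "\<forall>\<^sub>F k in sequentially. (f \<circ> r) k \<in> F n"
      using eventually_ge_at_top[of n]
    proof eventually_elim
      case (elim k)
      then have "n \<le> r k" using seq_suble[OF a(2), of k] by simp
      then show ?case using f[of "r k"] decseqD[OF dec] by auto
    qed
  qed simp
  then show ?thesis by blast
qed

lemma compact_lsc_sublevel:
  assumes "compact K" "lsc_on K f"
  shows "compact {a \<in> K. f a \<le> s}"
proof (rule closedin_compact[OF assms(1)])
  have "K - {a \<in> K. s < f a} = {a \<in> K. f a \<le> s}" by auto
  then show "closedin (top_of_set K) {a \<in> K. f a \<le> s}"
    using assms(2) openin_closedin_eq[of "top_of_set K" "{a \<in> K. s < f a}"] by (auto simp: lsc_on_def)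
qed

text \<open>The sets where \<open>f n a \<le> s n\<close> are nested, nonempty and compact, so one
  point lies in all of them. A constant bound \<open>s\<close> lets minima pass to increasing
  limits; a constant sequence \<open>f\<close> gives attainment of an infimum.\<close>

lemma compact_lsc_incseq_le:
  fixes K :: "'a::metric_space set" and f :: "nat \<Rightarrow> 'a \<Rightarrow> ennreal"
  assumes K: "compact K" and lsc: "\<And>n. lsc_on K (f n)"
    and inc: "\<And>a. a \<in> K \<Longrightarrow> incseq (\<lambda>n. f n a)" and s: "decseq s"
    and ex: "\<And>n. \<exists>a \<in> K. f n a \<le> s n"
  shows "\<exists>a \<in> K. \<forall>n. f n a \<le> s n"
proof -
  have "(\<Inter>n. {a \<in> K. f n a \<le> s n}) \<noteq> {}"
  proof (rule compact_decseq_nonempty)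
    show "decseq (\<lambda>n. {a \<in> K. f n a \<le> s n})"
    proof (rule decseq_SucI, safe)
      fix n a assume "a \<in> K" "f (Suc n) a \<le> s (Suc n)"
      then show "f n a \<le> s n"
        using incseq_SucD[OF inc[OF \<open>a \<in> K\<close>], of n] decseq_SucD[OF s, of n] by (meson order_trans)
    qed
  qed (use ex K lsc in \<open>auto intro: compact_lsc_sublevel\<close>)
  then show ?thesis by blast
qed

lemma lsc_on_compact_attains_INF:
  fixes K :: "'a::metric_space set"
  assumes K: "compact K" "K \<noteq> {}" and lsc: "lsc_on K f"
  shows "\<exists>a \<in> K. f a = (INF a\<in>K. f a)"
proof -
  obtain s :: "nat \<Rightarrow> ennreal" where s: "decseq s" "range s \<subseteq> f ` K" "(INF a\<in>K. f a) = (INF i. s i)"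
    using ennreal_Inf_countable_INF[of "f ` K"] K(2) by auto
  have "\<exists>a \<in> K. f a \<le> s n" for n
  proof -
    have "s n \<in> f ` K" using s(2) by blast
    then show ?thesis by auto
  qed
  then obtain a where a: "a \<in> K" "\<And>n. f a \<le> s n"
    using compact_lsc_incseq_le[OF K(1), of "\<lambda>_. f" s] lsc s(1) by (auto simp: incseq_def)
  then have "f a \<le> (INF a\<in>K. f a)" unfolding s(3) by (intro INF_greatest)
  with a(1) show ?thesis by (intro bexI[of _ a] antisym INF_lower)
qed

text \<open>A neighbourhood of \<open>K\<close> is wanted besides one of \<open>x\<close>, because
  in the application the fibre moves with the point.\<close>

lemma compact_tube:
  fixes x :: "'a::topological_space" and K :: "'b::topological_space set"
  assumes K: "compact K" and W: "open W" "{x} \<times> K \<subseteq> W"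
  obtains U V where "open U" "open V" "x \<in> U" "K \<subseteq> V" "U \<times> V \<subseteq> W"
proof -
  have "\<exists>U V. open U \<and> open V \<and> x \<in> U \<and> y \<in> V \<and> U \<times> V \<subseteq> W" if "y \<in> K" for y
  proof -
    have "(x, y) \<in> W" using W(2) that by blast
    then obtain U V where "open U" "open V" "(x, y) \<in> U \<times> V" "U \<times> V \<subseteq> W"
      using open_prod_elim[OF W(1)] by metis
    then show ?thesis by (intro exI[of _ U] exI[of _ V]) simp
  qed
  then obtain U V where UV: "\<And>y. y \<in> K \<Longrightarrow> open (U y) \<and> open (V y) \<and> x \<in> U y \<and> y \<in> V y \<and> U y \<times> V y \<subseteq> W"
    by metis
  obtain C where C: "C \<subseteq> K" "finite C" "K \<subseteq> (\<Union>y\<in>C. V y)"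
    using compactE_image[OF K, of K V] UV by (metis UN_I subsetI)
  show ?thesis
  proof
    show "open (\<Inter>y\<in>C. U y)" "open (\<Union>y\<in>C. V y)" "x \<in> (\<Inter>y\<in>C. U y)" "K \<subseteq> (\<Union>y\<in>C. V y)"
      using C UV by (auto intro!: open_INT)
    show "(\<Inter>y\<in>C. U y) \<times> (\<Union>y\<in>C. V y) \<subseteq> W" using C(1) UV by blast
  qed
qed

lemma lsc_on_section:
  fixes X :: "'x::metric_space set" and A :: "'x \<Rightarrow> 'a::metric_space set"
  assumes g: "lsc_on (graph A X) g" and x: "x \<in> X"
  shows "lsc_on (A x) (\<lambda>a. g (x, a))"
  unfolding lsc_on_def
proof
  fix r
  obtain W where W: "open W" "\<And>z. z \<in> graph A X \<Longrightarrow> r < g z \<longleftrightarrow> z \<in> W"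
    using lsc_on_openE[OF g, of r] by metis
  have "open (Pair x -` W)" using W(1) by (intro open_vimage) (auto intro!: continuous_intros)
  moreover have "{a \<in> A x. r < g (x, a)} = A x \<inter> Pair x -` W"
    using W(2) x by (auto simp: graph_def)
  ultimately show "openin (top_of_set (A x)) {a \<in> A x. r < g (x, a)}"
    unfolding openin_open by (intro exI conjI)
qed

text \<open>The lower semicontinuous half of Berge's maximum theorem. The closed set
  \<open>F\<close> is there for the selection argument, which asks when minimizers meet
  \<open>F\<close>. Where \<open>A x\<close> misses \<open>F\<close> the infimum is \<infinity>;
  this is compatible with lower semicontinuity because missing \<open>F\<close> is an open condition
  on \<open>x\<close>.\<close>

lemma lsc_on_INF_compact:
  fixes X :: "'x::metric_space set" and T :: "'a::metric_space set"
  assumes compact: "\<And>x. x \<in> X \<Longrightarrow> compact (A x)" and sub: "\<And>x. x \<in> X \<Longrightarrow> A x \<subseteq> T"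
    and usc: "\<And>U. openin (top_of_set T) U \<Longrightarrow> openin (top_of_set X) {x \<in> X. A x \<subseteq> U}"
    and g: "lsc_on (graph A X) g" and F: "closed F"
  shows "lsc_on X (\<lambda>x. INF a\<in>A x \<inter> F. g (x, a))"
  unfolding lsc_on_def
proof
  fix r
  have sect: "lsc_on (A x \<inter> F) (\<lambda>a. g (x, a))" if x: "x \<in> X" for x
    by (rule lsc_on_subset[OF lsc_on_section[OF g x]]) simp
  show "openin (top_of_set X) {x \<in> X. r < (INF a\<in>A x \<inter> F. g (x, a))}"
  \<comment> \<open>For \<open>r < \<infinity>\<close> the superlevel condition can be tested action
    by action, including the case of no actions, where the infimum is \<infinity>.\<close>
  proof (cases "r = \<infinity>")
    case False
    have eq: "{x \<in> X. r < (INF a\<in>A x \<inter> F. g (x, a))} = {x \<in> X. \<forall>a\<in>A x \<inter> F. r < g (x, a)}"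
    proof (intro Collect_cong conj_cong refl iffI ballI)
      fix x a assume "r < (INF a\<in>A x \<inter> F. g (x, a))" "a \<in> A x \<inter> F"
      then show "r < g (x, a)" by (meson INF_lower order_less_le_trans)
    next
      fix x assume x: "x \<in> X" and less: "\<forall>a\<in>A x \<inter> F. r < g (x, a)"
      show "r < (INF a\<in>A x \<inter> F. g (x, a))"
      proof (cases "A x \<inter> F = {}")
        case True
        then show ?thesis using False by (simp add: less_top)
      next
        case False
        have "\<exists>a \<in> A x \<inter> F. g (x, a) = (INF a\<in>A x \<inter> F. g (x, a))"
          by (rule lsc_on_compact_attains_INF[OF compact_Int_closed[OF compact[OF x] F] False sect[OF x]])
        then show ?thesis using less by metis
      qed
    qed
    obtain W where W: "open W" "\<And>z. z \<in> graph A X \<Longrightarrow> r < g z \<longleftrightarrow> z \<in> W"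
      using lsc_on_openE[OF g, of r] by metis
    show ?thesis
      unfolding eq
    proof (subst openin_subopen, safe)
      fix x assume x: "x \<in> X" and less: "\<forall>a\<in>A x \<inter> F. r < g (x, a)"
      have "{x} \<times> (A x \<inter> F) \<subseteq> W" using less x W(2) by (auto simp: graph_def)
      then obtain U V where UV: "open U" "open V" "x \<in> U" "A x \<inter> F \<subseteq> V" "U \<times> V \<subseteq> W"
        using compact_tube[OF compact_Int_closed[OF compact[OF x] F] W(1)] by metis
      \<comment> \<open>For \<open>y\<close> in \<open>?N\<close> those actions of
        \<open>A y\<close> that belong to \<open>F\<close> lie in \<open>V\<close>; the rest of
        \<open>A y\<close> may be anywhere outside \<open>F\<close>.\<close>
      let ?N = "(X \<inter> U) \<inter> {y \<in> X. A y \<subseteq> T \<inter> (V \<union> - F)}"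
      have "openin (top_of_set X) ?N"
        using UV(1,2) F by (intro openin_Int usc openin_open_Int open_Un open_Compl)
      moreover have "x \<in> ?N" using UV x sub by auto
      moreover have "?N \<subseteq> {x \<in> X. \<forall>a\<in>A x \<inter> F. r < g (x, a)}"
      proof clarsimp
        fix y a assume y: "y \<in> X" "y \<in> U" "A y \<subseteq> T" "A y \<subseteq> V \<union> - F" "a \<in> A y" "a \<in> F"
        then have "(y, a) \<in> graph A X \<inter> W" using UV(5) by (auto simp: graph_def)
        then show "r < g (y, a)" using W(2) by blast
      qed
      ultimately show "\<exists>N. openin (top_of_set X) N \<and> x \<in> N \<and> N \<subseteq> {x \<in> X. \<forall>a\<in>A x \<inter> F. r < g (x, a)}"
        by blast
    qed
  qed simp
qed

section \<open>Measurable selection\<close>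

text \<open>Intersecting \<open>D x\<close> successively with balls of radii \<open>1 / 2 ^ n\<close> shrinks it to a point; taking
  the first suitable center of a dense sequence keeps every stage measurable in \<open>x\<close>.\<close>

primrec refine :: "(nat \<Rightarrow> 'a::metric_space) \<Rightarrow> ('x \<Rightarrow> 'a set) \<Rightarrow> nat \<Rightarrow> 'x \<Rightarrow> 'a set" where
  "refine d D 0 x = D x"
| "refine d D (Suc n) x = refine d D n x \<inter>
     cball (d (LEAST k. refine d D n x \<inter> cball (d k) (1 / 2 ^ n) \<noteq> {})) (1 / 2 ^ n)"

lemma measurable_selection_compact:
  fixes D :: "'x \<Rightarrow> 'a::{metric_space, second_countable_topology} set"
  assumes D: "\<And>x. x \<in> space M \<Longrightarrow> compact (D x)" "\<And>x. x \<in> space M \<Longrightarrow> D x \<noteq> {}"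
    and hit: "\<And>F. closed F \<Longrightarrow> {x \<in> space M. D x \<inter> F \<noteq> {}} \<in> sets M"
  obtains \<phi> where "\<phi> \<in> borel_measurable M" "\<And>x. x \<in> space M \<Longrightarrow> \<phi> x \<in> D x"
proof -
  obtain Q :: "'a set" where Q: "countable Q" "\<And>U. open U \<Longrightarrow> U \<noteq> {} \<Longrightarrow> \<exists>q\<in>Q. q \<in> U"
    using countable_dense_setE by blast
  have "Q \<noteq> {}" using Q(2)[of UNIV] by auto
  define d where "d = from_nat_into Q"
  have dense: "\<exists>k. dist (d k) a < e" if e: "0 < e" for a e
  proof -
    obtain q where q: "q \<in> Q" "q \<in> ball a e" using Q(2)[OF open_ball[of a e]] e by auto
    then obtain k where "d k = q" unfolding d_def using from_nat_into_surj[OF Q(1)] by blast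
    then show ?thesis using q by (auto simp: dist_commute)
  qed
  let ?R = "refine d D"
  define k where "k n x = (LEAST k. ?R n x \<inter> cball (d k) (1 / 2 ^ n) \<noteq> {})" for n x
  have ex: "\<exists>k. ?R n x \<inter> cball (d k) (1 / 2 ^ n) \<noteq> {}" if ne: "?R n x \<noteq> {}" for n x
  proof -
    obtain a where "a \<in> ?R n x" using ne by blast
    moreover obtain k where "dist (d k) a < 1 / 2 ^ n" using dense[of "1 / 2 ^ n" a] by auto
    ultimately show ?thesis by (intro exI[of _ k]) auto
  qed
  have R_Suc: "?R (Suc n) x = ?R n x \<inter> cball (d (k n x)) (1 / 2 ^ n)" for n x
    by (simp add: k_def)
  have k: "?R n x \<inter> cball (d (k n x)) (1 / 2 ^ n) \<noteq> {}" if "?R n x \<noteq> {}" for n x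
    unfolding k_def using ex[OF that] by (rule LeastI_ex)
  have R: "compact (?R n x) \<and> ?R n x \<noteq> {}" if x: "x \<in> space M" for n x
  proof (induction n)
    case (Suc n)
    then show ?case unfolding R_Suc using k[of n x] by (intro conjI compact_Int_closed closed_cball) simp_all
  qed (use D x in auto)
  have dec: "decseq (\<lambda>n. ?R n x)" for x by (rule decseq_SucI) (simp add: R_Suc)
  have R_hit: "{x \<in> space M. ?R n x \<inter> F \<noteq> {}} \<in> sets M" if "closed F" for n F
    using that
  proof (induction n arbitrary: F)
    case (Suc n)
    define H where "H F = {x \<in> space M. ?R n x \<inter> F \<noteq> {}}" for F
    have H: "H F \<in> sets M" if "closed F" for F unfolding H_def by (rule Suc.IH[OF that])
    let ?B = "\<lambda>j. cball (d j) (1 / 2 ^ n)"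
    \<comment> \<open>Split by the value \<open>j\<close> of \<open>k n x\<close>: meeting
      \<open>?B j \<inter> F\<close> already means meeting ball \<open>j\<close>, so excluding the
      earlier balls makes \<open>j\<close> the least index.\<close>
    have "{x \<in> space M. ?R (Suc n) x \<inter> F \<noteq> {}} = (\<Union>j. H (?B j \<inter> F) - (\<Union>i\<in>{..<j}. H (?B i)))"
    proof (intro equalityI subsetI)
      fix x assume "x \<in> {x \<in> space M. ?R (Suc n) x \<inter> F \<noteq> {}}"
      then have "x \<in> H (?B (k n x) \<inter> F)" unfolding R_Suc H_def by (simp add: Int_assoc)
      moreover have "x \<notin> H (?B i)" if "i < k n x" for i
        using not_less_Least[OF that[unfolded k_def]] by (simp add: H_def)
      ultimately show "x \<in> (\<Union>j. H (?B j \<inter> F) - (\<Union>i\<in>{..<j}. H (?B i)))" by blast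
    next
      fix x assume "x \<in> (\<Union>j. H (?B j \<inter> F) - (\<Union>i\<in>{..<j}. H (?B i)))"
      then obtain j where j: "x \<in> H (?B j \<inter> F)" "\<And>i. i < j \<Longrightarrow> x \<notin> H (?B i)" by blast
      have x: "x \<in> space M" and ne: "?R n x \<inter> (?B j \<inter> F) \<noteq> {}" using j(1) by (simp_all add: H_def)
      have "k n x = j"
        unfolding k_def
      proof (rule Least_equality)
        show "?R n x \<inter> ?B j \<noteq> {}" using ne by blast
        fix i assume "?R n x \<inter> ?B i \<noteq> {}"
        then have "x \<in> H (?B i)" using x by (simp add: H_def)
        then show "j \<le> i" using j(2)[of i] by (meson not_le)
      qed
      then show "x \<in> {x \<in> space M. ?R (Suc n) x \<inter> F \<noteq> {}}"
        unfolding R_Suc using x ne by (simp add: Int_assoc)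
    qed
    also have "\<dots> \<in> sets M"
      by (rule sets.countable_nat_UN, intro image_subsetI sets.Diff sets.finite_UN H closed_Int closed_cball Suc.prems) simp_all
    finally show ?case .
  qed (use hit in simp)
  define \<phi> where "\<phi> x = (SOME a. a \<in> (\<Inter>n. ?R n x))" for x
  have \<phi>: "\<phi> x \<in> ?R n x" if x: "x \<in> space M" for x n
  proof -
    have "(\<Inter>n. ?R n x) \<noteq> {}" using R[OF x] dec by (intro compact_decseq_nonempty) auto
    then have "\<phi> x \<in> (\<Inter>n. ?R n x)" unfolding \<phi>_def by (rule some_in_eq[THEN iffD2])
    then show ?thesis by blast
  qed
  have unique: "a = \<phi> x" if x: "x \<in> space M" and a: "\<And>n. a \<in> ?R n x" for x a
  proof (rule ccontr)
    assume "a \<noteq> \<phi> x"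
    then have pos: "0 < dist a (\<phi> x) / 2" by simp
    \<comment> \<open>Stage \<open>Suc n\<close> lies in a ball of radius \<open>1 / 2 ^ n\<close>,
      so two of its points are at most twice that apart.\<close>
    obtain n where n: "(1/2::real) ^ n < dist a (\<phi> x) / 2" using real_arch_pow_inv[OF pos, of "1/2"] by auto
    have "dist (d (k n x)) a \<le> 1 / 2 ^ n" "dist (d (k n x)) (\<phi> x) \<le> 1 / 2 ^ n"
      using a[of "Suc n"] \<phi>[OF x, of "Suc n"] by (simp_all add: R_Suc del: refine.simps)
    then have "dist a (\<phi> x) \<le> 2 * (1 / 2 ^ n)" using dist_triangle3[of a "\<phi> x" "d (k n x)"] by linarith
    then show False using n by (simp add: power_divide)
  qed
  show ?thesis
  proof
    show "\<phi> \<in> borel_measurable M"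
      unfolding borel_eq_closed
    proof (rule measurable_measure_of)
      fix F :: "'a set" assume "F \<in> Collect closed"
      then have F: "closed F" by simp
      have "\<phi> -` F \<inter> space M = (\<Inter>n. {x \<in> space M. ?R n x \<inter> F \<noteq> {}})"
      proof (intro equalityI subsetI)
        fix x assume "x \<in> \<phi> -` F \<inter> space M"
        then show "x \<in> (\<Inter>n. {x \<in> space M. ?R n x \<inter> F \<noteq> {}})" using \<phi> by blast
      next
        fix x assume "x \<in> (\<Inter>n. {x \<in> space M. ?R n x \<inter> F \<noteq> {}})"
        then have x: "x \<in> space M" and ne: "\<And>n. ?R n x \<inter> F \<noteq> {}" by auto
        \<comment> \<open>Compactness turns the separate meetings of the stages with
          \<open>F\<close> into a common point, which \<open>unique\<close> identifies with
          \<open>\<phi> x\<close>. Thus membership of \<open>\<phi> x\<close> in \<open>F\<close> is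
          decided by countably many hitting sets.\<close>
        have "(\<Inter>n. ?R n x \<inter> F) \<noteq> {}"
        proof (rule compact_decseq_nonempty)
          show "compact (?R n x \<inter> F)" for n using R[OF x] F by (intro compact_Int_closed) simp_all
          show "decseq (\<lambda>n. ?R n x \<inter> F)" using dec[of x] unfolding decseq_def by blast
        qed (rule ne)
        then obtain a where "a \<in> F" "\<And>n. a \<in> ?R n x" by blast
        then show "x \<in> \<phi> -` F \<inter> space M" using unique[OF x] x by auto
      qed
      then show "\<phi> -` F \<inter> space M \<in> sets M" using R_hit[OF F] by auto
    qed auto
    show "\<phi> x \<in> D x" if "x \<in> space M" for x using \<phi>[OF that, of 0] by simp
  qed
qed

section \<open>Measures on a space with an adjoined point\<close>

text \<open>\<open>graph_space\<close> carries a restricted product of \<sigma>-algebras, whereas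
  \<open>c\<close> and \<open>q\<close> are measurable for the Borel sets of the product topology;
  this reconciles the two.\<close>

lemma sets_pair_restrict_space:
  assumes "X \<inter> space A \<in> sets A" "Y \<inter> space B \<in> sets B"
  shows "sets (restrict_space A X \<Otimes>\<^sub>M restrict_space B Y) = sets (restrict_space (A \<Otimes>\<^sub>M B) (X \<times> Y))"
proof (rule antisym)
  have sp: "space (restrict_space A X) = X \<inter> space A" "space (restrict_space B Y) = Y \<inter> space B"
    by (simp_all add: space_restrict_space)
  show "sets (restrict_space A X \<Otimes>\<^sub>M restrict_space B Y) \<subseteq> sets (restrict_space (A \<Otimes>\<^sub>M B) (X \<times> Y))"
  proof (rule sets_pair_in_sets)
    fix a b assume a: "a \<in> sets (restrict_space A X)" and b: "b \<in> sets (restrict_space B Y)"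
    then obtain a' b' where "a = X \<inter> a'" "a' \<in> sets A" "b = Y \<inter> b'" "b' \<in> sets B"
      unfolding sets_restrict_space by (elim imageE)
    then show "a \<times> b \<in> sets (restrict_space (A \<Otimes>\<^sub>M B) (X \<times> Y))"
      unfolding sets_restrict_space by (intro image_eqI[of _ _ "a' \<times> b'"]) auto
  qed
  show "sets (restrict_space (A \<Otimes>\<^sub>M B) (X \<times> Y)) \<subseteq> sets (restrict_space A X \<Otimes>\<^sub>M restrict_space B Y)"
  proof
    fix U assume "U \<in> sets (restrict_space (A \<Otimes>\<^sub>M B) (X \<times> Y))"
    then obtain W where W: "U = X \<times> Y \<inter> W" "W \<in> sets (A \<Otimes>\<^sub>M B)"
      unfolding sets_restrict_space by (elim imageE)
    have "fst \<in> restrict_space A X \<Otimes>\<^sub>M restrict_space B Y \<rightarrow>\<^sub>M A"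
      by (rule measurable_compose[OF measurable_fst]) (rule measurable_restrict_space1, simp)
    moreover have "snd \<in> restrict_space A X \<Otimes>\<^sub>M restrict_space B Y \<rightarrow>\<^sub>M B"
      by (rule measurable_compose[OF measurable_snd]) (rule measurable_restrict_space1, simp)
    ultimately have "(\<lambda>z. (fst z, snd z)) \<in> restrict_space A X \<Otimes>\<^sub>M restrict_space B Y \<rightarrow>\<^sub>M A \<Otimes>\<^sub>M B"
      by (rule measurable_Pair)
    from measurable_sets[OF this W(2)]
    have "W \<inter> ((X \<inter> space A) \<times> (Y \<inter> space B)) \<in> sets (restrict_space A X \<Otimes>\<^sub>M restrict_space B Y)"
      by (simp add: space_pair_measure sp)
    moreover have "W \<inter> ((X \<inter> space A) \<times> (Y \<inter> space B)) = U"
      using W sets.sets_into_space[OF W(2)] by (auto simp: space_pair_measure)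
    ultimately show "U \<in> sets (restrict_space A X \<Otimes>\<^sub>M restrict_space B Y)" by simp
  qed
qed

lemma space_borel_adjoin: "space (borel_adjoin S) = insert None (Some ` S)"
  unfolding borel_adjoin_def by (rule space_measure_of) auto

lemma borel_adjoin_generator:
  "U \<subseteq> insert None (Some ` S) \<Longrightarrow> openin (top_of_set S) (Some -` U) \<Longrightarrow> U \<in> sets (borel_adjoin S)"
  unfolding borel_adjoin_def by (subst sets_measure_of) auto

lemma Some_image_sets_borel_adjoin:
  assumes "B \<in> sets borel" shows "Some ` (S \<inter> B) \<in> sets (borel_adjoin S)"
  using assms[unfolded borel_def, simplified]
proof (induction rule: sigma_sets.induct)
  case (Basic a)
  then have "openin (top_of_set S) (S \<inter> a)" by (simp add: openin_open_Int)
  then show ?case by (intro borel_adjoin_generator) (auto simp: vimage_def image_iff Int_def)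
next
  case Empty
  then show ?case by simp
next
  case (Compl a)
  have "Some ` S \<in> sets (borel_adjoin S)"
    by (intro borel_adjoin_generator) (auto simp: inj_vimage_image_eq)
  then have "Some ` S - Some ` (S \<inter> a) \<in> sets (borel_adjoin S)" using Compl by blast
  also have "Some ` S - Some ` (S \<inter> a) = Some ` (S \<inter> (UNIV - a))" by auto
  finally show ?case .
next
  case (Union a)
  have "(\<Union>i. Some ` (S \<inter> a i)) \<in> sets (borel_adjoin S)" using Union by blast
  also have "(\<Union>i. Some ` (S \<inter> a i)) = Some ` (S \<inter> (\<Union>i. a i))" by auto
  finally show ?case .
qed

lemma measurable_Some [measurable]: "Some \<in> restrict_space borel S \<rightarrow>\<^sub>M borel_adjoin S"
  unfolding borel_adjoin_def
proof (rule measurable_measure_of)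
  fix U assume "U \<in> {U. U \<subseteq> insert None (Some ` S) \<and> openin (top_of_set S) (Some -` U)}"
  then have U: "U \<subseteq> insert None (Some ` S)" "openin (top_of_set S) (Some -` U)" by blast+
  then have "Some -` U \<inter> S = Some -` U" using openin_imp_subset by blast
  then show "Some -` U \<inter> space (restrict_space borel S) \<in> sets (restrict_space borel S)"
    using openin_sets_restrict_borel[OF U(2)] by (simp add: space_restrict_space)
qed (auto simp: space_restrict_space)

text \<open>\<open>None\<close> is isolated, so a preimage is the copy of a Borel subset of
  \<open>S\<close>, with or without that single point.\<close>

lemma measurable_borel_adjoinI:
  assumes f: "(\<lambda>x. f (Some x)) \<in> restrict_space borel S \<rightarrow>\<^sub>M N" and None: "f None \<in> space N"
  shows "f \<in> borel_adjoin S \<rightarrow>\<^sub>M N"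
proof (rule measurableI)
  show "f x \<in> space N" if "x \<in> space (borel_adjoin S)" for x
    using that None measurable_space[OF f] by (auto simp: space_borel_adjoin space_restrict_space)
  fix B assume B: "B \<in> sets N"
  have "(\<lambda>x. f (Some x)) -` B \<inter> S \<in> sets (restrict_space borel S)"
    using measurable_sets[OF f B] by (simp add: space_restrict_space)
  then obtain T where T: "T \<in> sets borel" "(\<lambda>x. f (Some x)) -` B \<inter> S = S \<inter> T"
    unfolding sets_restrict_space by (elim imageE)
  have N: "{None} \<in> sets (borel_adjoin S)"
    by (intro borel_adjoin_generator) (auto simp: vimage_def)
  have "f -` B \<inter> space (borel_adjoin S) = Some ` (S \<inter> T) \<union> (if f None \<in> B then {None} else {})"
    unfolding T(2)[symmetric] by (auto simp: space_borel_adjoin)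
  then show "f -` B \<inter> space (borel_adjoin S) \<in> sets (borel_adjoin S)"
    using sets.Un[OF Some_image_sets_borel_adjoin[OF T(1), of S] N]
      Some_image_sets_borel_adjoin[OF T(1), of S] by simp
qed

text \<open>The value at \<open>None\<close> is a dummy. It gives a measurable left inverse of
  \<open>Some\<close>, through which measurability on the original space is pulled back.\<close>

definition from_adjoin :: "'x \<Rightarrow> 'x option \<Rightarrow> 'x" where
  "from_adjoin x0 = case_option x0 (\<lambda>x. x)"

lemma from_adjoin_simps [simp]: "from_adjoin x0 (Some x) = x" "from_adjoin x0 None = x0"
  by (simp_all add: from_adjoin_def)

lemma measurable_from_adjoin: "x0 \<in> S \<Longrightarrow> from_adjoin x0 \<in> borel_adjoin S \<rightarrow>\<^sub>M restrict_space borel S"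
  by (rule measurable_borel_adjoinI) (simp_all add: space_restrict_space)

lemma None_sets_borel_adjoin: "{None} \<in> sets (borel_adjoin S)"
  by (intro borel_adjoin_generator) (auto simp: vimage_def)

text \<open>\<open>measure_of\<close> returns the given set function only if that is a measure, and
  the null measure otherwise. Here it is a measure plus two weighted point masses, the shape of the
  transformed transition law.\<close>

lemma
  fixes N :: "'b measure" and \<alpha> \<gamma> :: ennreal
  assumes K0: "sets K0 = sets N" and p: "p \<in> space N" "p' \<in> space N"
    and F: "\<And>B. B \<in> sets N \<Longrightarrow> F B = emeasure K0 B + \<alpha> * indicator B p + \<gamma> * indicator B p'"
  shows emeasure_add_points: "B \<in> sets N \<Longrightarrow> emeasure (measure_of (space N) (sets N) F) B = F B"
    and nn_integral_add_points: "u \<in> borel_measurable N \<Longrightarrow>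
      (\<integral>\<^sup>+x. u x \<partial>measure_of (space N) (sets N) F) = (\<integral>\<^sup>+x. u x \<partial>K0) + \<alpha> * u p + \<gamma> * u p'"
proof -
  let ?K = "measure_of (space N) (sets N) F"
  \<comment> \<open>Point masses are rewritten as Dirac measures, so that countable additivity is
    inherited term by term.\<close>
  have F': "F B = emeasure K0 B + \<alpha> * emeasure (return N p) B + \<gamma> * emeasure (return N p') B"
    if "B \<in> sets N" for B
    using that by (simp add: F)
  have em: "emeasure ?K B = F B" if B: "B \<in> sets N" for B
  proof (rule emeasure_measure_of[OF refl sets.space_closed])
    show "positive (sets ?K) F" by (simp add: positive_def F)
    show "countably_additive (sets ?K) F"
      unfolding countably_additive_def
    proof safe
      fix A :: "nat \<Rightarrow> 'b set" assume A: "range A \<subseteq> sets ?K" "disjoint_family A" "\<Union> (range A) \<in> sets ?K"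
      have A': "A i \<in> sets N" for i using A(1) by auto
      have U: "(\<Union>i. A i) \<in> sets N" using A' by auto
      have "(\<Sum>i. F (A i)) = (\<Sum>i. emeasure K0 (A i)) + \<alpha> * (\<Sum>i. emeasure (return N p) (A i)) +
          \<gamma> * (\<Sum>i. emeasure (return N p') (A i))"
        by (simp add: F'[OF A'] suminf_add[symmetric] del: emeasure_return)
      also have "\<dots> = F (\<Union>i. A i)"
        unfolding F'[OF U] using A A' K0 by (simp add: suminf_emeasure image_subset_iff del: emeasure_return)
      finally show "(\<Sum>i. F (A i)) = F (\<Union> (range A))" .
    qed
  qed (use B in simp)
  then show "B \<in> sets N \<Longrightarrow> emeasure ?K B = F B" .
  have [measurable_cong]: "sets ?K = sets N" by simp
  note K0[measurable_cong]
  show "(\<integral>\<^sup>+x. u x \<partial>?K) = (\<integral>\<^sup>+x. u x \<partial>K0) + \<alpha> * u p + \<gamma> * u p'" if "u \<in> borel_measurable N"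
    using that
  proof (induction rule: borel_measurable_induct)
    case (cong f g)
    then show ?case
      using p sets_eq_imp_space_eq[OF K0] by (simp cong: nn_integral_cong_simp)
  next
    case (set B)
    then show ?case using K0 by (simp add: em F)
  next
    case (mult u c)
    then show ?case by (simp add: nn_integral_cmult distrib_left mult.left_commute)
  next
    case (add u v)
    then show ?case by (simp add: nn_integral_add distrib_left ac_simps)
  next
    case (seq U)
    have inc: "incseq (\<lambda>i. U i x)" for x using seq(3) by (auto simp: incseq_def le_fun_def)
    have "(\<integral>\<^sup>+x. (SUP i. U i) x \<partial>?K) = (SUP i. \<integral>\<^sup>+x. U i x \<partial>?K)"
      using seq by (simp add: nn_integral_monotone_convergence_SUP image_comp)
    also have "\<dots> = (SUP i. (\<integral>\<^sup>+x. U i x \<partial>K0) + \<alpha> * U i p + \<gamma> * U i p')"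
      using seq by simp
    also have "\<dots> = (SUP i. \<integral>\<^sup>+x. U i x \<partial>K0) + (SUP i. \<alpha> * U i p) + (SUP i. \<gamma> * U i p')"
    proof -
      have 1: "incseq (\<lambda>i. \<integral>\<^sup>+x. U i x \<partial>K0)"
        using inc by (auto simp: incseq_def intro!: nn_integral_mono)
      have 2: "incseq (\<lambda>i. \<alpha> * U i p)" "incseq (\<lambda>i. \<gamma> * U i p')"
        using inc by (auto simp: incseq_def intro!: mult_left_mono)
      have 3: "incseq (\<lambda>i. (\<integral>\<^sup>+x. U i x \<partial>K0) + \<alpha> * U i p)"
        using 1 2(1) by (auto simp: incseq_def intro!: add_mono)
      show ?thesis
        by (simp only: ennreal_SUP_add[OF 3 2(2)] ennreal_SUP_add[OF 1 2(1)])
    qed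
    also have "\<dots> = (\<integral>\<^sup>+x. (SUP i. U i) x \<partial>K0) + \<alpha> * (SUP i. U i) p + \<gamma> * (SUP i. U i) p'"
      using seq by (simp add: nn_integral_monotone_convergence_SUP image_comp SUP_mult_left_ennreal)
    finally show ?case .
  qed
qed

text \<open>The mass of \<open>q\<close> may exceed one, so measurability of integrals cannot be
  read off from \<open>subprob_algebra\<close>; the functional monotone class argument is carried
  out directly.\<close>

lemma borel_measurable_nn_integral_kernel:
  fixes q :: "'z \<Rightarrow> 'x measure"
  assumes sets: "\<And>z. z \<in> space G \<Longrightarrow> sets (q z) = sets S"
    and em: "\<And>B. B \<in> sets S \<Longrightarrow> (\<lambda>z. emeasure (q z) B) \<in> borel_measurable G"
    and u: "u \<in> borel_measurable S"
  shows "(\<lambda>z. \<integral>\<^sup>+x. u x \<partial>q z) \<in> borel_measurable G"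
  using u
proof (induction rule: borel_measurable_induct)
  case (cong f g)
  have "(\<integral>\<^sup>+x. f x \<partial>q z) = (\<integral>\<^sup>+x. g x \<partial>q z)" if "z \<in> space G" for z
    using cong(3) sets_eq_imp_space_eq[OF sets[OF that]] by (intro nn_integral_cong) simp
  then show ?case using cong(4) by (simp cong: measurable_cong)
next
  case (set B)
  have "(\<integral>\<^sup>+x. indicator B x \<partial>q z) = emeasure (q z) B" if "z \<in> space G" for z
    using set by (intro nn_integral_indicator) (simp add: sets[OF that])
  then show ?case using em[OF set] by (simp cong: measurable_cong)
next
  case (mult u c)
  have "(\<integral>\<^sup>+x. c * u x \<partial>q z) = c * (\<integral>\<^sup>+x. u x \<partial>q z)" if "z \<in> space G" for z
    using mult(2) by (intro nn_integral_cmult) (simp cong: measurable_cong_sets add: sets[OF that])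
  then show ?case using mult by (simp cong: measurable_cong)
next
  case (add u v)
  have "(\<integral>\<^sup>+x. v x + u x \<partial>q z) = (\<integral>\<^sup>+x. v x \<partial>q z) + (\<integral>\<^sup>+x. u x \<partial>q z)" if "z \<in> space G" for z
    using add by (intro nn_integral_add) (simp_all cong: measurable_cong_sets add: sets[OF that])
  then show ?case using add by (simp cong: measurable_cong)
next
  case (seq U)
  have "(\<integral>\<^sup>+x. (SUP i. U i) x \<partial>q z) = (SUP i. \<integral>\<^sup>+x. U i x \<partial>q z)" if "z \<in> space G" for z
  proof -
    have "U i \<in> borel_measurable (q z)" for i
      using seq(1) by (simp cong: measurable_cong_sets add: sets[OF that])
    then show ?thesis using seq(3) by (simp add: nn_integral_monotone_convergence_SUP image_comp)
  qed
  then show ?case using seq by (simp cong: measurable_cong)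
qed

section \<open>The transformed process\<close>

locale hvag_setting = borel_mdp X Act A c q
  for X :: "'x::polish_space set" and Act :: "'a::polish_space set"
    and A :: "'x \<Rightarrow> 'a set" and c :: "'x \<times> 'a \<Rightarrow> real" and q :: "'x \<times> 'a \<Rightarrow> 'x measure" +
  fixes l :: 'x and K :: real and \<mu> :: "'x \<Rightarrow> real" and \<beta> :: real
  assumes l: "l \<in> X"
    and isolated: "isolated_from l X"
    and A_compact: "\<And>x. x \<in> X \<Longrightarrow> compact (A x)"
    and A_continuous: "continuous_set_map X Act A"
    and q_continuous: "weakly_continuous_kernel X (graph A X) q"
    and c_lsc: "lower_semicontinuous_on (graph A X) c"
    and \<mu>_continuous: "continuous_on X \<mu>"
    and \<mu>_ge: "\<And>x. x \<in> X \<Longrightarrow> 1 \<le> \<mu> x"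
    and \<mu>_le: "\<And>x. x \<in> X \<Longrightarrow> \<mu> x \<le> K"
    and \<mu>_ineq: "\<And>x a. (x, a) \<in> graph A X \<Longrightarrow> 1 + (LINT y : X - {l} | q (x, a). \<mu> y) \<le> \<mu> x"
    and \<beta>_ge: "(K - 1) / K \<le> \<beta>"
begin

abbreviation (input) "S \<equiv> restrict_space borel X"
abbreviation (input) "Gr \<equiv> graph A X"
abbreviation (input) "M \<equiv> borel_mdp_of X Act A c q"
abbreviation (input) "M' \<equiv> hvag X Act A c q l \<mu> \<beta>"

lemma K_ge: "1 \<le> K" using \<mu>_ge[OF l] \<mu>_le[OF l] by simp

lemma \<beta>_nonneg: "0 \<le> \<beta>"
  using K_ge \<beta>_ge by (meson divide_nonneg_nonneg diff_ge_0_iff_ge order_trans zero_le_one)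

lemma \<mu>_pos: "x \<in> X \<Longrightarrow> 0 < \<mu> x" using \<mu>_ge[of x] by simp

lemma Gr_iff [simp]: "(x, a) \<in> Gr \<longleftrightarrow> x \<in> X \<and> a \<in> A x" by (simp add: graph_def)

lemma Gr_subset: "Gr \<subseteq> X \<times> Act" using A_subset by (auto simp: graph_def)

lemma sets_pair: "sets (S \<Otimes>\<^sub>M restrict_space borel Act) = sets (restrict_space borel (X \<times> Act))"
  using X_borel Act_borel by (subst sets_pair_restrict_space) (simp_all add: borel_prod)

lemma graph_sets_pair: "Gr \<in> sets (S \<Otimes>\<^sub>M restrict_space borel Act)"
  unfolding sets_pair sets_restrict_space using graph_borel Gr_subset by (intro image_eqI[of _ _ Gr]) auto

lemma sets_graph_space: "sets (graph_space M) = sets (restrict_space borel Gr)"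
proof -
  have "sets (graph_space M) = sets (restrict_space (restrict_space borel (X \<times> Act)) Gr)"
    unfolding graph_space_def borel_mdp_of_def
    by (simp add: sets_restrict_space_cong[OF sets_pair] space_restrict_space)
  also have "restrict_space (restrict_space borel (X \<times> Act)) Gr = restrict_space borel Gr"
    using Gr_subset graph_borel borel_Times[OF X_borel Act_borel]
    by (subst restrict_restrict_space) (auto simp: Int_absorb1)
  finally show ?thesis .
qed

lemma space_q: "z \<in> Gr \<Longrightarrow> space (q z) = X"
  using sets_eq_imp_space_eq[OF q_sets] by (simp add: space_restrict_space)

lemma measurable_\<mu>: "\<mu> \<in> borel_measurable S"
  by (rule borel_measurable_continuous_on_restrict[OF \<mu>_continuous])

lemma l_sets: "{l} \<in> sets S"
  using l unfolding sets_restrict_space by (intro image_eqI[of _ _ "{l}"]) auto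

lemma X_l_sets: "X - {l} \<in> sets S"
  using sets.compl_sets[OF l_sets] by (simp add: space_restrict_space)

lemma measurable_q_iff: "z \<in> Gr \<Longrightarrow> f \<in> measurable (q z) N \<longleftrightarrow> f \<in> measurable S N"
  by (rule measurable_cong_sets[OF q_sets refl, THEN eqset_imp_iff])

section \<open>The kernel restricted to states other than \<open>l\<close>\<close>

definition taboo :: "('x \<Rightarrow> ennreal) \<Rightarrow> 'x \<times> 'a \<Rightarrow> ennreal" where
  "taboo u z = (\<integral>\<^sup>+y. u y * indicator (X - {l}) y \<partial>q z)"

lemma measurable_taboo:
  assumes "u \<in> borel_measurable S"
  shows "taboo u \<in> borel_measurable (restrict_space borel Gr)"
  unfolding taboo_def
proof (rule borel_measurable_nn_integral_kernel[where S=S])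
  fix B assume B: "B \<in> sets S"
  have "emeasure (q z) B = ennreal (measure (q z) B)" if "z \<in> Gr" for z
    by (rule finite_measure.emeasure_eq_measure[OF q_finite[OF that]])
  then show "(\<lambda>z. emeasure (q z) B) \<in> borel_measurable (restrict_space borel Gr)"
    using measurable_compose[OF q_borel[OF B] measurable_ennreal]
    by (subst measurable_cong[where g="\<lambda>z. ennreal (measure (q z) B)"]) (simp_all add: space_restrict_space)
qed (use assms X_l_sets q_sets in \<open>simp_all add: space_restrict_space\<close>)

lemma taboo_mono: "z \<in> Gr \<Longrightarrow> (\<And>y. y \<in> X \<Longrightarrow> u y \<le> v y) \<Longrightarrow> taboo u z \<le> taboo v z"
  unfolding taboo_def by (intro nn_integral_mono mult_right_mono) (simp_all add: space_q)

lemma taboo_cong: "z \<in> Gr \<Longrightarrow> (\<And>y. y \<in> X \<Longrightarrow> u y = v y) \<Longrightarrow> taboo u z = taboo v z"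
  unfolding taboo_def by (intro nn_integral_cong) (simp add: space_q)

lemma taboo_cmult: "z \<in> Gr \<Longrightarrow> u \<in> borel_measurable S \<Longrightarrow> taboo (\<lambda>y. r * u y) z = r * taboo u z"
  unfolding taboo_def using X_l_sets
  by (subst nn_integral_cmult[symmetric]) (simp_all add: measurable_q_iff mult.assoc)

lemma taboo_SUP:
  assumes z: "z \<in> Gr" and u: "\<And>n. u n \<in> borel_measurable S" and inc: "\<And>y. y \<in> X \<Longrightarrow> incseq (\<lambda>n. u n y)"
  shows "taboo (\<lambda>y. SUP n. u n y) z = (SUP n. taboo (u n) z)"
proof -
  have "taboo (\<lambda>y. SUP n. u n y) z = (\<integral>\<^sup>+y. (SUP n. u n y * indicator (X - {l}) y) \<partial>q z)"
    unfolding taboo_def by (simp add: SUP_mult_right_ennreal)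
  also have "\<dots> = (SUP n. \<integral>\<^sup>+y. u n y * indicator (X - {l}) y \<partial>q z)"
  proof (rule nn_integral_monotone_convergence_SUP_AE)
    show "AE y in q z. u n y * indicator (X - {l}) y \<le> u (Suc n) y * indicator (X - {l}) y" for n
      using inc by (intro AE_I2 mult_right_mono) (auto simp: space_q[OF z] incseq_Suc_iff)
    show "(\<lambda>y. u n y * indicator (X - {l}) y) \<in> borel_measurable (q z)" for n
      using u X_l_sets by (simp add: measurable_q_iff[OF z])
  qed
  finally show ?thesis by (simp add: taboo_def)
qed

lemma integrable_bounded:
  assumes z: "z \<in> Gr" and f: "f \<in> borel_measurable S" and B: "\<And>y. y \<in> X \<Longrightarrow> \<bar>f y\<bar> \<le> (B::real)"
  shows "integrable (q z) f"
  using B f by (intro finite_measure.integrable_const_bound[OF q_finite[OF z], of _ B] AE_I2)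
    (simp_all add: space_q[OF z] measurable_q_iff[OF z])

lemma taboo_eq_integral:
  assumes z: "z \<in> Gr" and f: "f \<in> borel_measurable S" and B: "\<And>y. y \<in> X \<Longrightarrow> 0 \<le> f y \<and> f y \<le> B"
  shows "taboo (\<lambda>y. ennreal (f y)) z = ennreal (LINT y : X - {l} | q z. f y)"
proof -
  have [measurable]: "X - {l} \<in> sets S" by (rule X_l_sets)
  note f[measurable]
  have "\<bar>indicator (X - {l}) y * f y\<bar> \<le> \<bar>B\<bar>" if "y \<in> X" for y
    using B[OF that] by (simp split: split_indicator)
  then have "integrable (q z) (\<lambda>y. indicator (X - {l}) y * f y)"
    by (intro integrable_bounded[OF z, where B="\<bar>B\<bar>"]) simp_all
  then have "(\<integral>\<^sup>+y. ennreal (indicator (X - {l}) y * f y) \<partial>q z) = ennreal (\<integral>y. indicator (X - {l}) y * f y \<partial>q z)"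
    using B by (intro nn_integral_eq_integral AE_I2) (auto simp: space_q[OF z] split: split_indicator)
  also have "(\<integral>\<^sup>+y. ennreal (indicator (X - {l}) y * f y) \<partial>q z) = taboo (\<lambda>y. ennreal (f y)) z"
    unfolding taboo_def by (intro nn_integral_cong) (auto split: split_indicator)
  finally show ?thesis by (simp add: set_lebesgue_integral_def)
qed

text \<open>Isolation of \<open>l\<close> enters here: a small ball around \<open>l\<close> contains
  no other state, while around \<open>x \<noteq> l\<close> the radius \<open>dist l x\<close>
  excludes \<open>l\<close>. Weak continuity can then be applied to functions cut off at
  \<open>l\<close>.\<close>

lemma continuous_on_indicator_X_l: "continuous_on X (indicator (X - {l}) :: 'x \<Rightarrow> real)"
  unfolding continuous_on_iff
proof (intro ballI allI impI)
  fix x and e :: real assume x: "x \<in> X" and e: "0 < e"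
  obtain \<epsilon> where \<epsilon>: "\<epsilon> > 0" "\<And>y. y \<in> X - {l} \<Longrightarrow> \<epsilon> < dist l y"
    using isolated by (auto simp: isolated_from_def)
  show "\<exists>d>0. \<forall>x'\<in>X. dist x' x < d \<longrightarrow> dist (indicator (X - {l}) x' :: real) (indicator (X - {l}) x) < e"
  proof (cases "x = l")
    case True
    have "x' = l" if "x' \<in> X" "dist x' x < \<epsilon>" for x'
      using \<epsilon>(2)[of x'] that True by (force simp: dist_commute)
    then show ?thesis using \<epsilon>(1) e True by (intro exI[of _ \<epsilon>]) auto
  next
    case False
    then show ?thesis using x e by (intro exI[of _ "dist l x"]) (auto simp: indicator_def)
  qed
qed

lemma continuous_on_taboo_integral:
  fixes f :: "'x \<Rightarrow> real"
  assumes f: "continuous_on X f" and B: "\<And>y. y \<in> X \<Longrightarrow> \<bar>f y\<bar> \<le> B"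
  shows "continuous_on Gr (\<lambda>z. LINT y : X - {l} | q z. f y)"
proof -
  have "continuous_on X (\<lambda>y. indicator (X - {l}) y * f y)"
    by (intro continuous_on_mult continuous_on_indicator_X_l f)
  moreover have "bounded ((\<lambda>y. indicator (X - {l}) y * f y) ` X)"
    unfolding bounded_iff using B by (intro exI[of _ "\<bar>B\<bar>"]) (force split: split_indicator)
  ultimately have "continuous_on Gr (\<lambda>z. \<integral>y. indicator (X - {l}) y * f y \<partial>q z)"
    using q_continuous unfolding weakly_continuous_kernel_def by blast
  then show ?thesis by (simp add: set_lebesgue_integral_def)
qed

text \<open>Weak continuity speaks only of bounded continuous functions, hence the increasing
  approximants bounded by \<open>k\<close>; monotone convergence transfers the result to
  \<open>u\<close>.\<close>

lemma lsc_on_taboo: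
  assumes u: "lsc_on X u" shows "lsc_on Gr (taboo u)"
proof -
  obtain g where g: "\<And>k. continuous_on X (g k)" "\<And>k y. y \<in> X \<Longrightarrow> 0 \<le> g k y" "\<And>k y. y \<in> X \<Longrightarrow> g k y \<le> real k"
    "\<And>y. y \<in> X \<Longrightarrow> incseq (\<lambda>k. g k y)" "\<And>y. y \<in> X \<Longrightarrow> u y = (SUP k. ennreal (g k y))"
    using lsc_on_imp_SUP_continuous[OF u] by blast
  have meas: "g k \<in> borel_measurable S" for k
    by (rule borel_measurable_continuous_on_restrict[OF g(1)])
  have "taboo u z = (SUP k. ennreal (LINT y : X - {l} | q z. g k y))" if z: "z \<in> Gr" for z
  proof -
    have "taboo u z = taboo (\<lambda>y. SUP k. ennreal (g k y)) z" by (rule taboo_cong[OF z g(5)])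
    also have "\<dots> = (SUP k. taboo (\<lambda>y. ennreal (g k y)) z)"
      using g(4) meas by (intro taboo_SUP[OF z]) (auto simp: incseq_def intro!: ennreal_leI)
    also have "\<dots> = (SUP k. ennreal (LINT y : X - {l} | q z. g k y))"
      using taboo_eq_integral[OF z meas] g(2,3) by (intro SUP_cong refl) blast
    finally show ?thesis .
  qed
  moreover have "lsc_on Gr (\<lambda>z. SUP k. ennreal (LINT y : X - {l} | q z. g k y))"
    using g(2,3) by (intro lsc_on_SUP continuous_on_imp_lsc_on continuous_on_taboo_integral g(1)) (auto simp: abs_le_iff)
  ultimately show ?thesis by (simp cong: lsc_on_cong)
qed

text \<open>Up to the factor \<open>1 / (\<beta> * \<mu> x)\<close>, the mass that the
  transformation puts on \<open>l\<close>; its sign is the defining inequality of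
  \<open>\<mu>\<close>.\<close>

definition slack :: "'x \<times> 'a \<Rightarrow> real" where
  "slack z = \<mu> (fst z) - 1 - (LINT y : X - {l} | q z. \<mu> y)"

lemma slack_nonneg: "z \<in> Gr \<Longrightarrow> 0 \<le> slack z"
  using \<mu>_ineq[of "fst z" "snd z"] by (simp add: slack_def)

lemma continuous_on_slack: "continuous_on Gr slack"
  unfolding slack_def
proof (intro continuous_on_diff continuous_on_taboo_integral)
  show "continuous_on Gr (\<lambda>z. \<mu> (fst z))"
    by (rule continuous_on_compose2[OF \<mu>_continuous continuous_on_fst[OF continuous_on_id]]) (auto simp: graph_def)
  show "\<bar>\<mu> y\<bar> \<le> K" if "y \<in> X" for y using \<mu>_le[OF that] \<mu>_ge[OF that] by simp
qed (simp_all add: \<mu>_continuous)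

lemma taboo_\<mu>: "z \<in> Gr \<Longrightarrow> taboo (\<lambda>y. ennreal (\<mu> y)) z = ennreal (LINT y : X - {l} | q z. \<mu> y)"
  using \<mu>_le \<mu>_ge by (intro taboo_eq_integral[where B=K] measurable_\<mu>) (auto intro: order_trans[of 0 1])

lemma taboo_integral_\<mu>_nonneg: "z \<in> Gr \<Longrightarrow> 0 \<le> (LINT y : X - {l} | q z. \<mu> y)"
  unfolding set_lebesgue_integral_def using \<mu>_ge
  by (intro integral_nonneg_AE AE_I2) (auto simp: space_q indicator_def intro: order_trans[of 0 1])

section \<open>Transformed transition law at a feasible pair\<close>

context
  fixes x a assumes xa: "x \<in> X" "a \<in> A x"
begin

lemma xa_Gr: "(x, a) \<in> Gr" using xa by simp

text \<open>The part of the transformed law on states other than \<open>l\<close> and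
  \<open>None\<close>: the Doob transform by \<open>\<mu>\<close> of the taboo kernel, divided by
  \<open>\<beta>\<close>.\<close>

definition killed :: "'x option measure" where
  "killed = distr (density (q (x, a)) (\<lambda>y. ennreal (1 / (\<beta> * \<mu> x)) * (ennreal (\<mu> y) * indicator (X - {l}) y)))
     (borel_adjoin X) Some"

lemma nn_integral_killed:
  assumes u: "u \<in> borel_measurable (borel_adjoin X)"
  shows "(\<integral>\<^sup>+y. u y \<partial>killed) = ennreal (1 / (\<beta> * \<mu> x)) * taboo (\<lambda>y. ennreal (\<mu> y) * u (Some y)) (x, a)"
proof -
  have [measurable_cong]: "sets (q (x, a)) = sets S" by (rule q_sets[OF xa_Gr])
  note [measurable] = measurable_\<mu> X_l_sets
  have [measurable]: "(\<lambda>y. u (Some y)) \<in> borel_measurable S" by (rule measurable_compose[OF measurable_Some u])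
  have "(\<integral>\<^sup>+y. u y \<partial>killed) =
     (\<integral>\<^sup>+y. u (Some y) \<partial>density (q (x, a)) (\<lambda>y. ennreal (1 / (\<beta> * \<mu> x)) * (ennreal (\<mu> y) * indicator (X - {l}) y)))"
    unfolding killed_def by (rule nn_integral_distr) (simp_all add: u)
  also have "\<dots> = (\<integral>\<^sup>+y. ennreal (1 / (\<beta> * \<mu> x)) * (ennreal (\<mu> y) * indicator (X - {l}) y) * u (Some y) \<partial>q (x, a))"
    by (rule nn_integral_density) simp_all
  also have "\<dots> = (\<integral>\<^sup>+y. ennreal (1 / (\<beta> * \<mu> x)) * (ennreal (\<mu> y) * u (Some y) * indicator (X - {l}) y) \<partial>q (x, a))"
    by (simp add: ac_simps)
  also have "\<dots> = ennreal (1 / (\<beta> * \<mu> x)) * (\<integral>\<^sup>+y. ennreal (\<mu> y) * u (Some y) * indicator (X - {l}) y \<partial>q (x, a))"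
    by (rule nn_integral_cmult) simp
  finally show ?thesis by (simp add: taboo_def)
qed

text \<open>The lower bound on the discount factor is chosen for this:
  \<open>(\<mu> x - 1) / \<mu> x = 1 - 1 / \<mu> x\<close> is at most \<open>1 - 1 / K\<close>,
  hence at most \<open>\<beta>\<close>. For \<open>\<beta> = 0\<close> the quotient is 0 by
  convention.\<close>

lemma escape_nonneg: "0 \<le> 1 - (\<mu> x - 1) / (\<beta> * \<mu> x)"
proof (cases "\<beta> = 0")
  case False
  then have \<beta>: "0 < \<beta>" using \<beta>_nonneg by simp
  have "(\<mu> x - 1) / \<mu> x = 1 - 1 / \<mu> x" using \<mu>_pos[OF xa(1)] by (simp add: field_simps)
  also have "\<dots> \<le> 1 - 1 / K" using \<mu>_le[OF xa(1)] \<mu>_pos[OF xa(1)] by (simp add: frac_le)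
  also have "\<dots> = (K - 1) / K" using K_ge by (simp add: field_simps)
  finally have "(\<mu> x - 1) / \<mu> x \<le> \<beta>" using \<beta>_ge by simp
  then have "(\<mu> x - 1) / \<mu> x / \<beta> \<le> 1" using \<beta> by (subst pos_divide_le_eq) simp_all
  also have "(\<mu> x - 1) / \<mu> x / \<beta> = (\<mu> x - 1) / (\<beta> * \<mu> x)" by (simp add: mult.commute)
  finally show ?thesis by simp
qed simp

text \<open>All three contributions are nonnegative, so \<open>ennreal\<close> distributes over them
  and the form required by \<open>emeasure_add_points\<close> appears.\<close>

lemma hvag_prob_eq:
  assumes B: "B \<in> sets (borel_adjoin X)"
  shows "ennreal (hvag_prob X q l \<mu> \<beta> x a B) = emeasure killed B +
    ennreal (slack (x, a) / (\<beta> * \<mu> x)) * indicator B (Some l) +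
    ennreal (1 - (\<mu> x - 1) / (\<beta> * \<mu> x)) * indicator B None"
proof -
  let ?f = "\<lambda>y. \<mu> y * indicator B (Some y)"
  let ?I = "LINT y : Some -` B - {l} | q (x, a). \<mu> y"
  have [measurable]: "?f \<in> borel_measurable S"
    by (intro borel_measurable_times measurable_\<mu> measurable_compose[OF measurable_Some borel_measurable_indicator[OF B]])
  have "?I = (LINT y : X - {l} | q (x, a). ?f y)"
    unfolding set_lebesgue_integral_def
    by (intro Bochner_Integration.integral_cong) (auto simp: space_q[OF xa_Gr] split: split_indicator)
  moreover have "taboo (\<lambda>y. ennreal (?f y)) (x, a) = ennreal (LINT y : X - {l} | q (x, a). ?f y)"
    using \<mu>_le \<mu>_ge K_ge by (intro taboo_eq_integral[OF xa_Gr, where B=K])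
      (auto split: split_indicator intro: order_trans[of 0 1])
  moreover have "taboo (\<lambda>y. ennreal (?f y)) (x, a) = taboo (\<lambda>y. ennreal (\<mu> y) * indicator B (Some y)) (x, a)"
    by (rule taboo_cong[OF xa_Gr]) (auto split: split_indicator)
  ultimately have I: "ennreal ?I = taboo (\<lambda>y. ennreal (\<mu> y) * indicator B (Some y)) (x, a)" by simp
  have I0: "0 \<le> ?I"
    unfolding set_lebesgue_integral_def using \<mu>_ge
    by (intro integral_nonneg_AE AE_I2) (auto simp: space_q[OF xa_Gr] indicator_def intro: order_trans[of 0 1])
  have b: "0 \<le> 1 / (\<beta> * \<mu> x)" using \<beta>_nonneg \<mu>_pos[OF xa(1)] by simp
  have "sets killed = sets (borel_adjoin X)" by (simp add: killed_def)
  then have "emeasure killed B = (\<integral>\<^sup>+y. indicator B y \<partial>killed)" using B by simp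
  also have "\<dots> = ennreal (1 / (\<beta> * \<mu> x)) * ennreal ?I"
    using nn_integral_killed[of "indicator B"] B I by simp
  also have "\<dots> = ennreal (1 / (\<beta> * \<mu> x) * ?I)"
    by (rule ennreal_mult[OF b I0, symmetric])
  finally have k: "emeasure killed B = ennreal (1 / (\<beta> * \<mu> x) * ?I)" .
  have s: "0 \<le> slack (x, a) / (\<beta> * \<mu> x)" using slack_nonneg[OF xa_Gr] \<beta>_nonneg \<mu>_pos[OF xa(1)] by simp
  have "hvag_prob X q l \<mu> \<beta> x a B = 1 / (\<beta> * \<mu> x) * ?I + slack (x, a) / (\<beta> * \<mu> x) * indicator B (Some l) +
      (1 - (\<mu> x - 1) / (\<beta> * \<mu> x)) * indicator B None"
    by (simp add: hvag_prob_def slack_def)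
  also have "ennreal \<dots> = ennreal (1 / (\<beta> * \<mu> x) * ?I) + ennreal (slack (x, a) / (\<beta> * \<mu> x) * indicator B (Some l)) +
      ennreal ((1 - (\<mu> x - 1) / (\<beta> * \<mu> x)) * indicator B None)"
    using mult_nonneg_nonneg[OF b I0] s escape_nonneg by (simp split: split_indicator)
  also have "\<dots> = emeasure killed B + ennreal (slack (x, a) / (\<beta> * \<mu> x)) * indicator B (Some l) +
    ennreal (1 - (\<mu> x - 1) / (\<beta> * \<mu> x)) * indicator B None"
    unfolding k by (simp split: split_indicator)
  finally show ?thesis .
qed

lemma points_borel_adjoin: "Some l \<in> space (borel_adjoin X)" "None \<in> space (borel_adjoin X)"
  using l by (simp_all add: space_borel_adjoin)

lemma sets_killed: "sets killed = sets (borel_adjoin X)" by (simp add: killed_def)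

lemma emeasure_hvag_kern:
  "B \<in> sets (borel_adjoin X) \<Longrightarrow>
    emeasure (hvag_kern X q l \<mu> \<beta> (Some x, Some a)) B = ennreal (hvag_prob X q l \<mu> \<beta> x a B)"
  using emeasure_add_points[OF sets_killed points_borel_adjoin hvag_prob_eq] by simp

lemma nn_integral_hvag_kern:
  assumes "u \<in> borel_measurable (borel_adjoin X)"
  shows "(\<integral>\<^sup>+y. u y \<partial>hvag_kern X q l \<mu> \<beta> (Some x, Some a)) =
    ennreal (1 / (\<beta> * \<mu> x)) * taboo (\<lambda>y. ennreal (\<mu> y) * u (Some y)) (x, a) +
    ennreal (slack (x, a) / (\<beta> * \<mu> x)) * u (Some l) + ennreal (1 - (\<mu> x - 1) / (\<beta> * \<mu> x)) * u None"
  using nn_integral_add_points[OF sets_killed points_borel_adjoin hvag_prob_eq assms] nn_integral_killed[OF assms]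
  by simp

text \<open>The point \<open>l\<close> receives exactly what the taboo part lacks of
  \<open>(\<mu> x - 1) / (\<beta> * \<mu> x)\<close>, and \<open>None\<close> receives the
  complement to one.\<close>

lemma prob_space_hvag_kern: "prob_space (hvag_kern X q l \<mu> \<beta> (Some x, Some a))"
proof (rule prob_spaceI)
  have "Some -` space (borel_adjoin X) = X" by (auto simp: space_borel_adjoin)
  then have "hvag_prob X q l \<mu> \<beta> x a (space (borel_adjoin X)) = 1"
    using points_borel_adjoin by (simp add: hvag_prob_def diff_divide_distrib)
  then show "emeasure (hvag_kern X q l \<mu> \<beta> (Some x, Some a)) (space (hvag_kern X q l \<mu> \<beta> (Some x, Some a))) = 1"
    using emeasure_hvag_kern[OF sets.top] by simp
qed

text \<open>For \<open>\<beta> = 0\<close>, where \<open>1 / (\<beta> * \<mu> x)\<close> is the junk value \<open>0\<close>, the right-hand side vanishes as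
  well: then \<open>K = 1\<close>, so \<open>\<mu> = 1\<close> and \<open>q(X - {l} | x, a) = 0\<close>.\<close>

lemma discounted_hvag_kern:
  assumes u: "u \<in> borel_measurable (borel_adjoin X)" and None: "u None = 0"
  shows "ennreal \<beta> * (\<integral>\<^sup>+y. u y \<partial>hvag_kern X q l \<mu> \<beta> (Some x, Some a)) =
    ennreal (1 / \<mu> x) * (taboo (\<lambda>y. ennreal (\<mu> y) * u (Some y)) (x, a) + ennreal (slack (x, a)) * u (Some l))"
proof (cases "\<beta> = 0")
  case False
  then have \<beta>: "0 < \<beta>" using \<beta>_nonneg by simp
  note \<mu> = \<mu>_pos[OF xa(1)]
  have 1: "ennreal \<beta> * ennreal (1 / (\<beta> * \<mu> x)) = ennreal (1 / \<mu> x)"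
    using \<beta> \<mu> by (simp add: ennreal_mult[symmetric])
  have 2: "ennreal \<beta> * ennreal (slack (x, a) / (\<beta> * \<mu> x)) = ennreal (1 / \<mu> x) * ennreal (slack (x, a))"
    using \<beta> \<mu> slack_nonneg[OF xa_Gr] by (simp add: ennreal_mult[symmetric])
  show ?thesis
    unfolding nn_integral_hvag_kern[OF u] None
    by (simp add: distrib_left mult.assoc[symmetric] 1 2)
next
  case True
  then have "K \<le> 1" using \<beta>_ge K_ge by (simp add: divide_le_0_iff)
  then have \<mu>1: "\<mu> x = 1" using \<mu>_ge[OF xa(1)] \<mu>_le[OF xa(1)] by simp
  then have I: "(LINT y : X - {l} | q (x, a). \<mu> y) = 0"
    using \<mu>_ineq[OF xa_Gr] taboo_integral_\<mu>_nonneg[OF xa_Gr] by simp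
  then have "taboo (\<lambda>y. ennreal (\<mu> y)) (x, a) = 0" using taboo_\<mu>[OF xa_Gr] by simp
  moreover have "(\<lambda>y. ennreal (\<mu> y) * indicator (X - {l}) y) \<in> borel_measurable (q (x, a))"
    using measurable_\<mu> X_l_sets by (simp add: measurable_q_iff[OF xa_Gr])
  ultimately have ae: "AE y in q (x, a). ennreal (\<mu> y) * indicator (X - {l}) y = 0"
    unfolding taboo_def by (simp add: nn_integral_0_iff_AE)
  have "taboo (\<lambda>y. ennreal (\<mu> y) * u (Some y)) (x, a) = (\<integral>\<^sup>+y. 0 \<partial>q (x, a))"
    unfolding taboo_def using ae by (intro nn_integral_cong_AE) (auto elim!: eventually_mono split: split_indicator_asm)
  moreover have "slack (x, a) = 0" using I \<mu>1 by (simp add: slack_def)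
  ultimately show ?thesis using True by simp
qed

end

end

section \<open>Measurability of the original and the transformed process\<close>

context hvag_setting begin

lemma M_simps [simp]: "states M = S" "actions M = restrict_space borel Act" "avail M = A" "cost M = c" "kern M = q"
  by (simp_all add: borel_mdp_of_def)

lemma M'_simps [simp]: "states M' = borel_adjoin X" "actions M' = borel_adjoin Act" "avail M' = hvag_avail A"
    "cost M' = hvag_cost c \<mu>" "kern M' = hvag_kern X q l \<mu> \<beta>"
  by (simp_all add: hvag_def)

lemma space_S [simp]: "space S = X" by (simp add: space_restrict_space)

lemma mdp_kernel_original:
  assumes prob: "probability_kernel Gr q" shows "mdp_kernel M"
proof
  note sp = sets_eq_imp_space_eq[OF sets_graph_space]
  show "graph (avail M) (space (states M)) \<in> sets (states M \<Otimes>\<^sub>M actions M)"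
    by (simp add: graph_sets_pair)
  have "q \<in> restrict_space borel Gr \<rightarrow>\<^sub>M prob_algebra S"
  proof (rule measurable_prob_algebraI)
    fix z assume "z \<in> space (restrict_space borel Gr)"
    then show "prob_space (q z)" using prob by (simp add: space_restrict_space probability_kernel_def)
  next
    show "q \<in> restrict_space borel Gr \<rightarrow>\<^sub>M subprob_algebra S"
    proof (rule measurable_subprob_algebra)
      fix B assume B: "B \<in> sets S"
      have "emeasure (q z) B = ennreal (measure (q z) B)" if "z \<in> Gr" for z
        by (rule finite_measure.emeasure_eq_measure[OF q_finite[OF that]])
      then show "(\<lambda>z. emeasure (q z) B) \<in> borel_measurable (restrict_space borel Gr)"
        using measurable_compose[OF q_borel[OF B] measurable_ennreal]
        by (subst measurable_cong[where g="\<lambda>z. ennreal (measure (q z) B)"]) (simp_all add: space_restrict_space)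
    qed (use prob q_sets in \<open>simp_all add: space_restrict_space probability_kernel_def prob_space_imp_subprob_space\<close>)
  qed
  then show "kern M \<in> graph_space M \<rightarrow>\<^sub>M prob_algebra (states M)"
    by (simp cong: measurable_cong_sets add: sets_graph_space)
  show "cost M \<in> borel_measurable (graph_space M)"
    using c_borel by (simp cong: measurable_cong_sets add: sets_graph_space)
  show "0 \<le> cost M z" if "z \<in> space (graph_space M)" for z
    using that c_nonneg by (simp add: sp space_restrict_space)
qed

definition a0 :: 'a where "a0 = (SOME a. a \<in> A l)"

lemma a0: "a0 \<in> A l"
  unfolding a0_def using A_nonempty[OF l] by (rule some_in_eq[THEN iffD2])

text \<open>The adjoined pair goes to the feasible pair \<open>(l, a0)\<close>, so the transformed
  graph is mapped into \<open>Gr\<close> and functions defined on \<open>Gr\<close> can be pulled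
  back.\<close>

definition retract :: "'x option \<times> 'a option \<Rightarrow> 'x \<times> 'a" where
  "retract z = (from_adjoin l (fst z), from_adjoin a0 (snd z))"

lemma retract_simps [simp]: "retract (Some x, Some a) = (x, a)" "retract (None, None) = (l, a0)"
  by (simp_all add: retract_def)

lemma measurable_retract:
  "retract \<in> borel_adjoin X \<Otimes>\<^sub>M borel_adjoin Act \<rightarrow>\<^sub>M S \<Otimes>\<^sub>M restrict_space borel Act"
  unfolding retract_def using l a0 A_subset[OF l]
  by (intro measurable_Pair measurable_compose[OF measurable_fst measurable_from_adjoin]
      measurable_compose[OF measurable_snd measurable_from_adjoin]) auto

abbreviation (input) "Gr' \<equiv> graph (hvag_avail A) (space (borel_adjoin X))"

lemma Gr'_cases:
  assumes "z \<in> Gr'"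
  obtains "z = (None, None)" | x a where "z = (Some x, Some a)" "x \<in> X" "a \<in> A x"
  using assms by (auto simp: graph_def space_borel_adjoin)

lemma Gr'_sets: "Gr' \<in> sets (borel_adjoin X \<Otimes>\<^sub>M borel_adjoin Act)"
proof -
  let ?P = "borel_adjoin X \<Otimes>\<^sub>M borel_adjoin Act"
  \<comment> \<open>The preimage of \<open>Gr\<close> also contains pairs with a single
    \<open>None\<close>, such as \<open>(None, Some a)\<close> with \<open>a \<in> A l\<close>;
    these are removed before \<open>(None, None)\<close> is put back.\<close>
  have "retract -` Gr \<inter> space ?P - fst -` {None} \<inter> space ?P - snd -` {None} \<inter> space ?P \<union> {None} \<times> {None} \<in> sets ?P"
    by (intro sets.Un sets.Diff pair_measureI measurable_sets[OF measurable_retract graph_sets_pair]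
        measurable_sets[OF measurable_fst] measurable_sets[OF measurable_snd] None_sets_borel_adjoin)
  also have "retract -` Gr \<inter> space ?P - fst -` {None} \<inter> space ?P - snd -` {None} \<inter> space ?P \<union> {None} \<times> {None} = Gr'"
    (is "?L = _")
  proof (intro equalityI subsetI)
    fix z assume "z \<in> ?L"
    then show "z \<in> Gr'" by (cases z) (auto simp: graph_def space_borel_adjoin space_pair_measure)
  next
    fix z assume "z \<in> Gr'"
    then show "z \<in> ?L"
    proof (cases rule: Gr'_cases)
      case (2 x a)
      then show ?thesis using A_subset[OF 2(2)] by (auto simp: space_borel_adjoin space_pair_measure)
    qed simp
  qed
  finally show ?thesis .
qed

lemma space_graph_space': "space (graph_space M') = Gr'"
  using sets.sets_into_space[OF Gr'_sets] by (auto simp: graph_space_def space_restrict_space)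

lemma measurable_retract_graph: "retract \<in> graph_space M' \<rightarrow>\<^sub>M restrict_space borel Gr"
proof -
  have "retract \<in> graph_space M' \<rightarrow>\<^sub>M graph_space M"
    unfolding graph_space_def
  proof (rule measurable_restrict_space3)
    show "retract \<in> states M' \<Otimes>\<^sub>M actions M' \<rightarrow>\<^sub>M states M \<Otimes>\<^sub>M actions M"
      using measurable_retract by simp
    show "retract \<in> graph (avail M') (space (states M')) \<rightarrow> graph (avail M) (space (states M))"
    proof (rule funcsetI)
      fix z assume "z \<in> graph (avail M') (space (states M'))"
      then have "z \<in> Gr'" by simp
      then show "retract z \<in> graph (avail M) (space (states M))"
        using l a0 by (cases rule: Gr'_cases) simp_all
    qed
  qed
  then show ?thesis by (simp cong: measurable_cong_sets add: sets_graph_space)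
qed

text \<open>The transformed graph is a copy of \<open>Gr\<close> together with the single point
  \<open>(None, None)\<close>, so the behaviour on the copy decides.\<close>

lemma measurable_graph_space'I:
  fixes f :: "'x option \<times> 'a option \<Rightarrow> 'b::topological_space"
  assumes g: "g \<in> borel_measurable (restrict_space borel Gr)"
    and f: "\<And>x a. x \<in> X \<Longrightarrow> a \<in> A x \<Longrightarrow> f (Some x, Some a) = g (x, a)"
  shows "f \<in> borel_measurable (graph_space M')"
proof -
  have "fst \<in> graph_space M' \<rightarrow>\<^sub>M borel_adjoin X"
    unfolding graph_space_def by (rule measurable_restrict_space1) simp
  from measurable_sets[OF this None_sets_borel_adjoin]
  have "{z \<in> space (graph_space M'). fst z = None} \<in> sets (graph_space M')"
    by (simp add: vimage_def Int_def conj_commute)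
  then have "(\<lambda>z. if fst z = None then f (None, None) else g (retract z)) \<in> borel_measurable (graph_space M')"
    by (intro measurable_If measurable_compose[OF measurable_retract_graph g]) simp_all
  moreover have "f z = (if fst z = None then f (None, None) else g (retract z))" if "z \<in> space (graph_space M')" for z
    using that unfolding space_graph_space' by (cases rule: Gr'_cases) (simp_all add: f)
  ultimately show ?thesis by (simp cong: measurable_cong)
qed

lemma measurable_fst_Gr: "f \<in> borel_measurable S \<Longrightarrow> (\<lambda>z. f (fst z)) \<in> borel_measurable (restrict_space borel Gr)"
proof (erule measurable_compose[rotated])
  have "fst \<in> graph_space M \<rightarrow>\<^sub>M S"
    unfolding graph_space_def by (rule measurable_restrict_space1) simp
  then show "fst \<in> restrict_space borel Gr \<rightarrow>\<^sub>M S"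
    by (simp cong: measurable_cong_sets add: sets_graph_space)
qed

sublocale transformed: mdp_kernel "hvag X Act A c q l \<mu> \<beta>"
proof
  show "graph (avail M') (space (states M')) \<in> sets (states M' \<Otimes>\<^sub>M actions M')"
    by (simp add: Gr'_sets)
  show "0 \<le> cost M' z" if "z \<in> space (graph_space M')" for z
    using that unfolding space_graph_space'
    by (cases rule: Gr'_cases) (auto intro!: divide_nonneg_nonneg c_nonneg less_imp_le[OF \<mu>_pos])
  show "cost M' \<in> borel_measurable (graph_space M')"
    by (rule measurable_graph_space'I[where g="\<lambda>z. c z / \<mu> (fst z)"])
      (use c_borel measurable_fst_Gr[OF measurable_\<mu>] in simp_all)
  show "kern M' \<in> graph_space M' \<rightarrow>\<^sub>M prob_algebra (states M')"
  proof (rule measurable_prob_algebraI)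
    fix z assume "z \<in> space (graph_space M')"
    then show "prob_space (kern M' z)"
      unfolding space_graph_space'
      by (cases rule: Gr'_cases) (simp_all add: prob_space_return space_borel_adjoin prob_space_hvag_kern del: hvag_kern.simps(1))
  next
    show "kern M' \<in> graph_space M' \<rightarrow>\<^sub>M subprob_algebra (states M')"
    proof (rule measurable_subprob_algebra)
      fix z assume z: "z \<in> space (graph_space M')"
      then show "subprob_space (kern M' z)"
        unfolding space_graph_space'
        by (cases rule: Gr'_cases)
          (simp_all add: prob_space_return space_borel_adjoin prob_space_hvag_kern prob_space_imp_subprob_space del: hvag_kern.simps(1))
      show "sets (kern M' z) = sets (states M')"
        using z unfolding space_graph_space' by (cases rule: Gr'_cases) simp_all
    next
      fix B assume "B \<in> sets (states M')"
      then have B: "B \<in> sets (borel_adjoin X)" by simp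
      \<comment> \<open>The mass of \<open>B\<close> as an explicit function on \<open>Gr\<close>,
        where each factor is visibly measurable.\<close>
      define F where "F z = ennreal (1 / (\<beta> * \<mu> (fst z))) * taboo (\<lambda>y. ennreal (\<mu> y) * indicator B (Some y)) z +
        ennreal (slack z / (\<beta> * \<mu> (fst z))) * indicator B (Some l) +
        ennreal (1 - (\<mu> (fst z) - 1) / (\<beta> * \<mu> (fst z))) * indicator B None" for z
      have [measurable]: "slack \<in> borel_measurable (restrict_space borel Gr)"
        by (rule borel_measurable_continuous_on_restrict[OF continuous_on_slack])
      have [measurable]: "taboo (\<lambda>y. ennreal (\<mu> y) * indicator B (Some y)) \<in> borel_measurable (restrict_space borel Gr)"
        by (intro measurable_taboo borel_measurable_times_ennreal
            measurable_compose[OF measurable_\<mu> measurable_ennreal]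
            measurable_compose[OF measurable_Some borel_measurable_indicator[OF B]])
      note [measurable] = measurable_fst_Gr[OF measurable_\<mu>]
      show "(\<lambda>z. emeasure (kern M' z) B) \<in> borel_measurable (graph_space M')"
      proof (rule measurable_graph_space'I[where g=F])
        show "F \<in> borel_measurable (restrict_space borel Gr)" unfolding F_def by measurable
        fix x a assume xa: "x \<in> X" "a \<in> A x"
        have "emeasure (kern M' (Some x, Some a)) B = (\<integral>\<^sup>+y. indicator B y \<partial>kern M' (Some x, Some a))"
          using B by simp
        also have "\<dots> = F (x, a)"
          using nn_integral_hvag_kern[OF xa, of "indicator B"] B by (simp add: F_def del: hvag_kern.simps(1))
        finally show "emeasure (kern M' (Some x, Some a)) B = F (x, a)" .
      qed
    qed
  qed
qed

end

section \<open>Value iteration\<close>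

context hvag_setting begin

text \<open>The iterates approximate \<open>\<mu> x * v x\<close> instead of the discounted value \<open>v x\<close> itself, which
  removes the factors \<open>1 / (\<beta> * \<mu> x)\<close>.\<close>

definition bellman :: "('x \<Rightarrow> ennreal) \<Rightarrow> 'x \<times> 'a \<Rightarrow> ennreal" where
  "bellman u z = ennreal (c z) + taboo u z + ennreal (1 / \<mu> l) * u l * ennreal (slack z)"

primrec value_iteration :: "nat \<Rightarrow> 'x \<Rightarrow> ennreal" where
  "value_iteration 0 x = 0"
| "value_iteration (Suc n) x = (INF a\<in>A x. bellman (value_iteration n) (x, a))"

definition W :: "'x \<Rightarrow> ennreal" where
  "W x = (SUP n. value_iteration n x)"

lemma lsc_on_bellman:
  assumes "lsc_on X u" shows "lsc_on Gr (bellman u)"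
  unfolding bellman_def
  by (intro lsc_on_add lower_semicontinuous_on_imp_lsc_on c_lsc c_nonneg lsc_on_taboo assms
      lsc_on_cmult_continuous continuous_on_slack slack_nonneg)

lemma bellman_mono: "z \<in> Gr \<Longrightarrow> (\<And>y. y \<in> X \<Longrightarrow> u y \<le> v y) \<Longrightarrow> bellman u z \<le> bellman v z"
  unfolding bellman_def using l by (intro add_mono mult_right_mono mult_left_mono taboo_mono) auto

lemma A_usc: "openin (top_of_set Act) U \<Longrightarrow> openin (top_of_set X) {x \<in> X. A x \<subseteq> U}"
  using A_continuous by (simp add: continuous_set_map_def)

lemma lsc_on_value_iteration: "lsc_on X (value_iteration n)"
proof (induction n)
  case 0
  then show ?case using continuous_on_imp_lsc_on[of X "\<lambda>_. 0"] by simp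
next
  case (Suc n)
  show ?case
    using lsc_on_INF_compact[OF A_compact A_subset A_usc lsc_on_bellman[OF Suc] closed_UNIV] by simp
qed

lemma value_iteration_Suc_mono: "x \<in> X \<Longrightarrow> value_iteration n x \<le> value_iteration (Suc n) x"
proof (induction n arbitrary: x)
  case (Suc n)
  have eq: "value_iteration (Suc m) x = (INF a\<in>A x. bellman (value_iteration m) (x, a))" for m
    by (rule value_iteration.simps(2))
  have "bellman (value_iteration n) (x, a) \<le> bellman (value_iteration (Suc n)) (x, a)" if "a \<in> A x" for a
    using Suc.prems that by (intro bellman_mono Suc.IH) simp_all
  then show ?case unfolding eq[of n] eq[of "Suc n"] by (intro INF_mono) blast
qed simp

lemma incseq_value_iteration: "x \<in> X \<Longrightarrow> incseq (\<lambda>n. value_iteration n x)"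
  by (intro incseq_SucI value_iteration_Suc_mono)

lemma measurable_value_iteration: "value_iteration n \<in> borel_measurable S"
  by (rule lsc_on_borel_measurable[OF lsc_on_value_iteration])

lemma lsc_on_W: "lsc_on X W"
  unfolding W_def by (intro lsc_on_SUP lsc_on_value_iteration)

lemma measurable_W: "W \<in> borel_measurable S"
  by (rule lsc_on_borel_measurable[OF lsc_on_W])

lemma incseq_bellman_value_iteration: "z \<in> Gr \<Longrightarrow> incseq (\<lambda>n. bellman (value_iteration n) z)"
  by (intro incseq_SucI bellman_mono value_iteration_Suc_mono)

lemma bellman_W_eq_SUP:
  assumes z: "z \<in> Gr" shows "bellman W z = (SUP n. bellman (value_iteration n) z)"
proof -
  have 1: "incseq (\<lambda>n. taboo (value_iteration n) z)"
    by (intro incseq_SucI taboo_mono[OF z] value_iteration_Suc_mono)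
  have 2: "incseq (\<lambda>n. ennreal (1 / \<mu> l) * value_iteration n l * ennreal (slack z))"
    by (intro incseq_SucI mult_right_mono mult_left_mono value_iteration_Suc_mono[OF l]) auto
  have 3: "incseq (\<lambda>n. ennreal (c z) + taboo (value_iteration n) z)"
    using 1 by (auto simp: incseq_def intro: add_left_mono)
  have "taboo W z = (SUP n. taboo (value_iteration n) z)"
    unfolding W_def by (intro taboo_SUP[OF z] measurable_value_iteration incseq_value_iteration)
  then show ?thesis
    unfolding bellman_def ennreal_SUP_add[OF 3 2]
    by (simp add: ennreal_SUP_add_right W_def SUP_mult_right_ennreal SUP_mult_left_ennreal)
qed

lemma W_le_bellman:
  assumes "x \<in> X" "a \<in> A x" shows "W x \<le> bellman W (x, a)"
  unfolding W_def
proof (rule SUP_least)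
  fix n
  have "value_iteration n x \<le> value_iteration (Suc n) x" by (rule value_iteration_Suc_mono[OF assms(1)])
  also have "\<dots> \<le> bellman (value_iteration n) (x, a)" using assms(2) by (auto intro: INF_lower)
  also have "\<dots> \<le> bellman W (x, a)"
    using assms by (simp add: bellman_W_eq_SUP) (rule SUP_upper, simp)
  finally show "value_iteration n x \<le> bellman (\<lambda>x. SUP n. value_iteration n x) (x, a)"
    by (simp add: W_def[abs_def])
qed

text \<open>Minimizers for the single iterates may change with \<open>n\<close>. Compactness gives
  one action whose \<open>n\<close>-th Bellman value is at most \<open>W x\<close> for all
  \<open>n\<close> simultaneously, and monotone convergence passes to \<open>W\<close>.\<close>

lemma W_attained:
  assumes x: "x \<in> X" shows "\<exists>a \<in> A x. bellman W (x, a) \<le> W x"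
proof -
  have "\<exists>a \<in> A x. \<forall>n. bellman (value_iteration n) (x, a) \<le> W x"
  proof (rule compact_lsc_incseq_le[OF A_compact[OF x]])
    show lsc: "lsc_on (A x) (\<lambda>a. bellman (value_iteration n) (x, a))" for n
      by (rule lsc_on_section[OF lsc_on_bellman[OF lsc_on_value_iteration] x])
    show "incseq (\<lambda>n. bellman (value_iteration n) (x, a))" if "a \<in> A x" for a
      using x that by (intro incseq_bellman_value_iteration) simp
    show "\<exists>a \<in> A x. bellman (value_iteration n) (x, a) \<le> W x" for n
    proof -
      obtain a where "a \<in> A x" "bellman (value_iteration n) (x, a) = value_iteration (Suc n) x"
        using lsc_on_compact_attains_INF[OF A_compact[OF x] A_nonempty[OF x] lsc] by auto
      then show ?thesis unfolding W_def by (metis SUP_upper UNIV_I)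
    qed
  qed simp
  then show ?thesis using x by (auto simp: bellman_W_eq_SUP intro: SUP_least)
qed

text \<open>The sets \<open>D x\<close> of minimizers are compact, and whether they meet a closed
  \<open>F\<close> is decided by comparing the infimum over \<open>A x \<inter> F\<close> with
  \<open>W x\<close>, both Borel functions of \<open>x\<close>.\<close>

lemma minimizing_selector:
  obtains \<phi> where "\<phi> \<in> stationary_policies M" "\<And>x. x \<in> X \<Longrightarrow> bellman W (x, \<phi> x) = W x"
proof -
  define D where "D x = {a \<in> A x. bellman W (x, a) \<le> W x}" for x
  have sect: "lsc_on (A x) (\<lambda>a. bellman W (x, a))" if "x \<in> X" for x
    by (rule lsc_on_section[OF lsc_on_bellman[OF lsc_on_W] that])
  obtain \<phi> where \<phi>: "\<phi> \<in> borel_measurable S" "\<And>x. x \<in> space S \<Longrightarrow> \<phi> x \<in> D x"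
  proof (rule measurable_selection_compact[of S D])
    show "compact (D x)" if "x \<in> space S" for x
      unfolding D_def using that by (intro compact_lsc_sublevel A_compact sect) simp_all
    show "D x \<noteq> {}" if "x \<in> space S" for x
      using W_attained[of x] that by (auto simp: D_def)
    fix F :: "'a set" assume F: "closed F"
    \<comment> \<open>The first factor is essential where \<open>W x = \<infinity>\<close>: if
      \<open>A x\<close> misses \<open>F\<close>, the infimum is also \<infinity> and the inequality
      alone would hold.\<close>
    have "{x \<in> space S. D x \<inter> F \<noteq> {}} =
      (X - {x \<in> X. A x \<subseteq> Act \<inter> - F}) \<inter> {x \<in> space S. (INF a\<in>A x \<inter> F. bellman W (x, a)) \<le> W x}"
    proof (intro equalityI subsetI)
      fix x assume "x \<in> {x \<in> space S. D x \<inter> F \<noteq> {}}"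
      then obtain a where a: "x \<in> X" "a \<in> A x \<inter> F" "bellman W (x, a) \<le> W x" by (auto simp: D_def)
      then have "(INF a\<in>A x \<inter> F. bellman W (x, a)) \<le> W x" by (meson INF_lower2)
      then show "x \<in> (X - {x \<in> X. A x \<subseteq> Act \<inter> - F}) \<inter> {x \<in> space S. (INF a\<in>A x \<inter> F. bellman W (x, a)) \<le> W x}"
        using a by auto
    next
      fix x assume x: "x \<in> (X - {x \<in> X. A x \<subseteq> Act \<inter> - F}) \<inter> {x \<in> space S. (INF a\<in>A x \<inter> F. bellman W (x, a)) \<le> W x}"
      then have xX: "x \<in> X" and ne: "A x \<inter> F \<noteq> {}" using A_subset[of x] by auto
      have "lsc_on (A x \<inter> F) (\<lambda>a. bellman W (x, a))" by (rule lsc_on_subset[OF sect[OF xX]]) simp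
      then obtain a where "a \<in> A x \<inter> F" "bellman W (x, a) = (INF a\<in>A x \<inter> F. bellman W (x, a))"
        using lsc_on_compact_attains_INF[OF compact_Int_closed[OF A_compact[OF xX] F] ne] by blast
      then show "x \<in> {x \<in> space S. D x \<inter> F \<noteq> {}}" using x by (auto simp: D_def)
    qed
    also have "\<dots> \<in> sets S"
    proof (intro sets.Int)
      have "openin (top_of_set X) {x \<in> X. A x \<subseteq> Act \<inter> - F}"
        using F by (intro A_usc openin_open_Int open_Compl)
      from sets.compl_sets[OF openin_sets_restrict_borel[OF this]]
      show "X - {x \<in> X. A x \<subseteq> Act \<inter> - F} \<in> sets S" by simp
      have "(\<lambda>x. INF a\<in>A x \<inter> F. bellman W (x, a)) \<in> borel_measurable S"
        by (rule lsc_on_borel_measurable[OF lsc_on_INF_compact[OF A_compact A_subset A_usc lsc_on_bellman[OF lsc_on_W] F]])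
      then show "{x \<in> space S. (INF a\<in>A x \<inter> F. bellman W (x, a)) \<le> W x} \<in> sets S"
        by (rule borel_measurable_le[OF _ measurable_W])
    qed
    finally show "{x \<in> space S. D x \<inter> F \<noteq> {}} \<in> sets S" .
  qed blast
  show ?thesis
  proof
    have "\<phi> \<in> S \<rightarrow>\<^sub>M restrict_space borel Act"
      using \<phi> A_subset by (intro measurable_restrict_space2) (auto simp: D_def)
    then show "\<phi> \<in> stationary_policies M" using \<phi>(2) by (simp add: stationary_policies_def D_def)
    show "bellman W (x, \<phi> x) = W x" if "x \<in> X" for x
      using \<phi>(2)[of x] that W_le_bellman[of x "\<phi> x"] by (auto simp: D_def intro: antisym)
  qed
qed

text \<open>Translates from the scale of \<open>W\<close> back to that of the discounted value. The
  state \<open>None\<close> is absorbing and free of cost, hence the value 0.\<close>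

definition adjoin :: "('x \<Rightarrow> ennreal) \<Rightarrow> 'x option \<Rightarrow> ennreal" where
  "adjoin u = case_option 0 (\<lambda>x. ennreal (1 / \<mu> x) * u x)"

lemma adjoin_simps [simp]: "adjoin u None = 0" "adjoin u (Some x) = ennreal (1 / \<mu> x) * u x"
  by (simp_all add: adjoin_def)

lemma measurable_adjoin:
  assumes "u \<in> borel_measurable S" shows "adjoin u \<in> borel_measurable (borel_adjoin X)"
proof (rule measurable_borel_adjoinI)
  have "(\<lambda>x. ennreal (1 / \<mu> x)) \<in> borel_measurable S" using measurable_\<mu> by simp
  then show "(\<lambda>x. adjoin u (Some x)) \<in> borel_measurable S"
    using assms by (simp add: borel_measurable_times_ennreal)
qed simp

lemma ennreal_inverse_\<mu>: "x \<in> X \<Longrightarrow> ennreal (\<mu> x) * (ennreal (1 / \<mu> x) * r) = r"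
  using \<mu>_pos[of x] by (simp add: mult.assoc[symmetric] ennreal_mult[symmetric])

text \<open>The density \<open>\<mu> y\<close> of the transformed law cancels the factor
  \<open>1 / \<mu> y\<close> of \<open>adjoin u\<close>. Only the mass at \<open>l\<close>, which is
  given by \<open>slack\<close>, keeps its factor \<open>1 / \<mu> l\<close>.\<close>

lemma discounted_bellman:
  assumes xa: "x \<in> X" "a \<in> A x" and u: "u \<in> borel_measurable S"
  shows "ennreal (cost M' (Some x, Some a)) + ennreal \<beta> * (\<integral>\<^sup>+y. adjoin u y \<partial>kern M' (Some x, Some a)) =
    ennreal (1 / \<mu> x) * bellman u (x, a)"
proof -
  have "ennreal (c (x, a) / \<mu> x) = ennreal (1 / \<mu> x) * ennreal (c (x, a))"
    using c_nonneg[OF xa_Gr[OF xa]] \<mu>_pos[OF xa(1)] by (simp add: ennreal_mult[symmetric])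
  moreover have "taboo (\<lambda>y. ennreal (\<mu> y) * adjoin u (Some y)) (x, a) = taboo u (x, a)"
    using xa by (intro taboo_cong) (simp_all add: ennreal_inverse_\<mu>)
  ultimately show ?thesis
    using discounted_hvag_kern[OF xa measurable_adjoin[OF u]]
    by (simp add: bellman_def distrib_left ac_simps del: hvag_kern.simps(1))
qed

lemma discounted_None:
  "ennreal (cost M' (None, None)) + ennreal \<beta> * (\<integral>\<^sup>+y. adjoin u y \<partial>kern M' (None, None)) = 0"
  if "u \<in> borel_measurable S"
  using measurable_adjoin[OF that] by (simp add: nn_integral_return space_borel_adjoin)

section \<open>Identification of the discounted value and of optimal policies\<close>

lemma discounted_value_ge:
  assumes z: "z \<in> space (borel_adjoin X)" and \<pi>: "\<pi> \<in> policies M'"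
  shows "adjoin W z \<le> discounted_cost M' \<beta> \<pi> z"
proof -
  have *: "adjoin (value_iteration n) z \<le> discounted_cost M' \<beta> \<pi> z" for n
  proof (rule transformed.discounted_cost_ge[OF \<pi> _ \<beta>_nonneg])
    show "adjoin (value_iteration n) \<in> borel_measurable (states M')" for n
      using measurable_adjoin[OF measurable_value_iteration] by simp
    show "adjoin (value_iteration 0) y = 0" for y by (cases y) simp_all
    fix n y a assume "y \<in> space (states M')" "a \<in> avail M' y"
    then have "(y, a) \<in> Gr'" by (simp add: graph_def)
    then show "adjoin (value_iteration (Suc n)) y \<le>
      ennreal (cost M' (y, a)) + ennreal \<beta> * (\<integral>\<^sup>+z. adjoin (value_iteration n) z \<partial>kern M' (y, a))"
    proof (cases rule: Gr'_cases)
      case 1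
      then show ?thesis by simp
    next
      case (2 x a')
      then have y: "y = Some x" and a: "a = Some a'" by simp_all
      show ?thesis
        unfolding y a discounted_bellman[OF 2(2,3) measurable_value_iteration]
        using 2(3) by (auto intro!: mult_left_mono INF_lower)
    qed
  qed (use z in simp)
  show ?thesis
  proof (cases z)
    case None
    then show ?thesis by simp
  next
    case (Some x)
    then show ?thesis
      using * by (auto simp: W_def SUP_mult_left_ennreal intro: SUP_least)
  qed
qed

lemma map_option_stationary:
  assumes \<phi>: "\<phi> \<in> stationary_policies M" shows "map_option \<phi> \<in> stationary_policies M'"
proof -
  have "\<phi> \<in> S \<rightarrow>\<^sub>M restrict_space borel Act" "\<And>x. x \<in> X \<Longrightarrow> \<phi> x \<in> A x"
    using \<phi> by (simp_all add: stationary_policies_def)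
  then have "map_option \<phi> \<in> borel_adjoin X \<rightarrow>\<^sub>M borel_adjoin Act"
    by (intro measurable_borel_adjoinI) (auto simp: space_borel_adjoin intro: measurable_compose)
  then show ?thesis using \<open>\<And>x. x \<in> X \<Longrightarrow> \<phi> x \<in> A x\<close>
    by (auto simp: stationary_policies_def space_borel_adjoin)
qed

lemma discounted_cost_le:
  assumes \<phi>: "\<phi> \<in> stationary_policies M" "\<And>x. x \<in> X \<Longrightarrow> bellman W (x, \<phi> x) = W x"
    and z: "z \<in> space (borel_adjoin X)"
  shows "discounted_cost M' \<beta> (stationary M' (map_option \<phi>)) z \<le> adjoin W z"
proof (rule transformed.discounted_cost_stationary_le[OF map_option_stationary[OF \<phi>(1)] _ \<beta>_nonneg])
  show "adjoin W \<in> borel_measurable (states M')" using measurable_adjoin[OF measurable_W] by simp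
  fix y assume "y \<in> space (states M')"
  then show "ennreal (cost M' (y, map_option \<phi> y)) +
      ennreal \<beta> * (\<integral>\<^sup>+z. adjoin W z \<partial>kern M' (y, map_option \<phi> y)) \<le> adjoin W y"
  proof (cases y)
    case None
    then show ?thesis using discounted_None[OF measurable_W] by (simp del: hvag_kern.simps)
  next
    case (Some x)
    with \<open>y \<in> space (states M')\<close> have x: "x \<in> X" by (auto simp: space_borel_adjoin)
    then have a: "\<phi> x \<in> A x" using \<phi>(1) by (simp add: stationary_policies_def)
    show ?thesis
      using discounted_bellman[OF x a measurable_W] \<phi>(2)[OF x] Some by (simp del: hvag_kern.simps M'_simps)
  qed
qed (use z in simp)

lemma discounted_value_eq:
  assumes z: "z \<in> space (borel_adjoin X)" shows "discounted_value M' \<beta> z = adjoin W z"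
  unfolding discounted_value_def
proof (rule antisym)
  obtain \<phi> where \<phi>: "\<phi> \<in> stationary_policies M" "\<And>x. x \<in> X \<Longrightarrow> bellman W (x, \<phi> x) = W x"
    by (rule minimizing_selector) blast
  show "(INF \<pi>\<in>policies M'. discounted_cost M' \<beta> \<pi> z) \<le> adjoin W z"
    using discounted_cost_le[OF \<phi> z]
    by (rule INF_lower2[OF transformed.stationary_in_policies[OF map_option_stationary[OF \<phi>(1)]]])
  show "adjoin W z \<le> (INF \<pi>\<in>policies M'. discounted_cost M' \<beta> \<pi> z)"
    by (intro INF_greatest discounted_value_ge z)
qed

lemma discounted_value_Some: "x \<in> X \<Longrightarrow> discounted_value M' \<beta> (Some x) = ennreal (1 / \<mu> x) * W x"
  by (simp add: discounted_value_eq space_borel_adjoin)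

lemma ex_discounted_optimal: "\<exists>\<phi> \<in> stationary_policies M'. discounted_optimal M' \<beta> (stationary M' \<phi>)"
proof -
  obtain \<phi> where \<phi>: "\<phi> \<in> stationary_policies M" "\<And>x. x \<in> X \<Longrightarrow> bellman W (x, \<phi> x) = W x"
    by (rule minimizing_selector) blast
  note st = map_option_stationary[OF \<phi>(1)]
  note pol = transformed.stationary_in_policies[OF st]
  have "discounted_optimal M' \<beta> (stationary M' (map_option \<phi>))"
    unfolding discounted_optimal_def
  proof (intro conjI pol ballI)
    fix z assume "z \<in> space (states M')"
    then have z: "z \<in> space (borel_adjoin X)" by simp
    show "discounted_cost M' \<beta> (stationary M' (map_option \<phi>)) z = discounted_value M' \<beta> z"
      unfolding discounted_value_eq[OF z]
      by (rule antisym[OF discounted_cost_le[OF \<phi> z] discounted_value_ge[OF z pol]])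
  qed
  with st show ?thesis by blast
qed

text \<open>The cost of a stationary policy satisfies its own evaluation equation. Optimality
  replaces that cost by \<open>adjoin W\<close> on both sides, and multiplication by
  \<open>\<mu> x\<close> yields equality in the Bellman equation.\<close>

lemma discounted_optimal_imp_bellman:
  assumes \<phi>: "\<phi> \<in> stationary_policies M'" and opt: "discounted_optimal M' \<beta> (stationary M' \<phi>)"
  shows "original_policy \<phi> \<in> stationary_policies M"
    and "x \<in> X \<Longrightarrow> bellman W (x, original_policy \<phi> x) = W x"
proof -
  have meas: "\<phi> \<in> borel_adjoin X \<rightarrow>\<^sub>M borel_adjoin Act"
    and av: "\<And>z. z \<in> space (borel_adjoin X) \<Longrightarrow> \<phi> z \<in> hvag_avail A z"
    using \<phi> by (simp_all add: stationary_policies_def)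
  have Some: "\<phi> (Some x) = Some (original_policy \<phi> x)" "original_policy \<phi> x \<in> A x" if "x \<in> X" for x
    using av[of "Some x"] that by (auto simp: space_borel_adjoin original_policy_def)
  \<comment> \<open>\<open>from_adjoin a0\<close> agrees with \<open>the\<close> on all
    \<open>Some\<close> values and is measurable on the whole adjoined space.\<close>
  have "(\<lambda>x. from_adjoin a0 (\<phi> (Some x))) \<in> S \<rightarrow>\<^sub>M restrict_space borel Act"
    using a0 A_subset[OF l] by (intro measurable_compose[OF measurable_compose[OF measurable_Some meas] measurable_from_adjoin]) auto
  then have "original_policy \<phi> \<in> S \<rightarrow>\<^sub>M restrict_space borel Act"
    by (subst measurable_cong[where g="\<lambda>x. from_adjoin a0 (\<phi> (Some x))"]) (simp_all add: Some)
  then show "original_policy \<phi> \<in> stationary_policies M" using Some by (simp add: stationary_policies_def)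
  show "bellman W (x, original_policy \<phi> x) = W x" if x: "x \<in> X"
  proof -
    note a = Some(2)[OF x]
    have J: "discounted_cost M' \<beta> (stationary M' \<phi>) z = adjoin W z" if "z \<in> space (borel_adjoin X)" for z
      using opt that by (simp add: discounted_optimal_def discounted_value_eq)
    have sp: "space (kern M' (Some x, Some (original_policy \<phi> x))) = space (borel_adjoin X)" by simp
    have "Some x \<in> space (borel_adjoin X)" using x by (simp add: space_borel_adjoin)
    then have "adjoin W (Some x) = ennreal (cost M' (Some x, Some (original_policy \<phi> x))) +
        ennreal \<beta> * (\<integral>\<^sup>+y. discounted_cost M' \<beta> (stationary M' \<phi>) y \<partial>kern M' (Some x, Some (original_policy \<phi> x)))"
      using transformed.discounted_cost_stationary[OF \<phi> _ \<beta>_nonneg, of "Some x"] J[of "Some x"] Some(1)[OF x]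
      by (simp del: hvag_kern.simps hvag_cost.simps adjoin_simps)
    also have "(\<integral>\<^sup>+y. discounted_cost M' \<beta> (stationary M' \<phi>) y \<partial>kern M' (Some x, Some (original_policy \<phi> x))) =
        (\<integral>\<^sup>+y. adjoin W y \<partial>kern M' (Some x, Some (original_policy \<phi> x)))"
      by (intro nn_integral_cong J) (simp add: sp)
    also note discounted_bellman[OF x a measurable_W]
    finally have "ennreal (\<mu> x) * (ennreal (1 / \<mu> x) * W x) =
        ennreal (\<mu> x) * (ennreal (1 / \<mu> x) * bellman W (x, original_policy \<phi> x))" by simp
    then show ?thesis unfolding ennreal_inverse_\<mu>[OF x] by simp
  qed
qed

end

section \<open>The average-cost equation\<close>

lemma ext_integral_ereal:
  assumes "integrable Q f" shows "ext_integral Q (\<lambda>x. ereal (f x)) = ereal (\<integral>x. f x \<partial>Q)"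
proof -
  have fin: "(\<integral>\<^sup>+x. ennreal (f x) \<partial>Q) \<noteq> \<infinity>" "(\<integral>\<^sup>+x. ennreal (- f x) \<partial>Q) \<noteq> \<infinity>"
    using assms by (auto simp: real_integrable_def)
  then have "ereal (\<integral>x. f x \<partial>Q) = ereal (enn2real (\<integral>\<^sup>+x. ennreal (f x) \<partial>Q)) - ereal (enn2real (\<integral>\<^sup>+x. ennreal (- f x) \<partial>Q))"
    by (simp add: real_lebesgue_integral_def[OF assms])
  also have "\<dots> = enn2ereal (\<integral>\<^sup>+x. ennreal (f x) \<partial>Q) - enn2ereal (\<integral>\<^sup>+x. ennreal (- f x) \<partial>Q)"
    using fin by (cases "\<integral>\<^sup>+x. ennreal (f x) \<partial>Q"; cases "\<integral>\<^sup>+x. ennreal (- f x) \<partial>Q") simp_all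
  finally show ?thesis by (simp add: ext_integral_def)
qed

lemma ext_integral_cong: "(\<And>x. x \<in> space Q \<Longrightarrow> f x = g x) \<Longrightarrow> ext_integral Q f = ext_integral Q g"
  unfolding ext_integral_def
  by (intro arg_cong2[where f="(-)"] arg_cong[where f=enn2ereal] nn_integral_cong) simp_all

text \<open>Positive and negative parts of a difference become truncated differences in
  \<open>ennreal\<close>; finiteness of \<open>s\<close> keeps this valid for infinite
  \<open>r\<close>.\<close>

lemma e2ennreal_enn2ereal_diff:
  assumes s: "0 \<le> s"
  shows "e2ennreal (enn2ereal r - ereal s) = r - ennreal s"
    and "e2ennreal (- (enn2ereal r - ereal s)) = ennreal s - r"
proof -
  have s': "ereal s = enn2ereal (ennreal s)" using s by (simp add: enn2ereal_ennreal)
  show "e2ennreal (enn2ereal r - ereal s) = r - ennreal s"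
    unfolding s' by (rule e2eenreal_enn2ereal_diff)
  have "- (enn2ereal r - ereal s) = ereal s - enn2ereal r"
    by (rule ereal_minus_diff_eq) simp_all
  then show "e2ennreal (- (enn2ereal r - ereal s)) = ennreal s - r"
    unfolding s' by (simp only: e2eenreal_enn2ereal_diff)
qed

context hvag_setting begin

abbreviation (input) relative_value :: "'x \<Rightarrow> ereal" where
  "relative_value x \<equiv> ereal (\<mu> x) *
     (enn2ereal (discounted_value M' \<beta> (Some x)) - enn2ereal (discounted_value M' \<beta> (Some l)))"

context
  fixes b :: real
  assumes b: "0 \<le> b" and value_l: "discounted_value M' \<beta> (Some l) = ennreal b"
begin

lemma relative_value_eq:
  assumes x: "x \<in> X" shows "relative_value x = enn2ereal (W x) - ereal (\<mu> x * b)"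
proof (cases "W x")
  case (real r)
  have "ennreal (1 / \<mu> x) * ennreal r = ennreal (r / \<mu> x)"
    using real \<mu>_pos[OF x] by (simp add: ennreal_mult[symmetric])
  then show ?thesis
    using real \<mu>_pos[OF x] b by (simp add: value_l discounted_value_Some[OF x] right_diff_distrib)
next
  case top
  then show ?thesis
    using \<mu>_pos[OF x] b by (simp add: value_l discounted_value_Some[OF x] ennreal_mult_top)
qed

lemma W_l: "W l = ennreal (\<mu> l * b)"
proof -
  have "ennreal (\<mu> l) * (ennreal (1 / \<mu> l) * W l) = ennreal (\<mu> l) * ennreal b"
    using value_l discounted_value_Some[OF l] by simp
  then show ?thesis unfolding ennreal_inverse_\<mu>[OF l] using b \<mu>_pos[OF l] by (simp add: ennreal_mult)
qed

lemma nn_integral_eq_taboo: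
  assumes "z \<in> Gr" "f l = 0" shows "(\<integral>\<^sup>+y. f y \<partial>q z) = taboo f z"
  unfolding taboo_def using assms by (intro nn_integral_cong) (auto simp: space_q split: split_indicator)

text \<open>Since \<open>h l = 0\<close>, integrating \<open>h\<close> over \<open>X\<close> is a
  taboo integral of \<open>W y - \<mu> y * b\<close>. With I the taboo integral of
  \<open>\<mu>\<close>, \<open>bellman W\<close> equals c + taboo W + b * (\<open>\<mu> x\<close> -
  1 - I), so c + taboo W - b * I is \<open>bellman W\<close> plus \<open>b - \<mu> x * b\<close>.
  The same shift turns \<open>W x\<close> into \<open>w + h x\<close>.\<close>

lemma cost_plus_ext_integral:
  assumes xa: "x \<in> X" "a \<in> A x"
  shows "ereal (c (x, a)) + ext_integral (q (x, a)) relative_value =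
    enn2ereal (bellman W (x, a)) + ereal (b - \<mu> x * b)"
proof -
  note z = xa_Gr[OF xa]
  let ?z = "(x, a)" and ?s = "\<lambda>y. ennreal (\<mu> y * b)"
  let ?I = "LINT y : X - {l} | q ?z. \<mu> y"
  have \<mu>b: "0 \<le> \<mu> y * b" if "y \<in> X" for y using b \<mu>_pos[OF that] by simp
  have ext: "ext_integral (q ?z) relative_value =
      enn2ereal (taboo (\<lambda>y. W y - ?s y) ?z) - enn2ereal (taboo (\<lambda>y. ?s y - W y) ?z)"
  proof -
    have "ext_integral (q ?z) relative_value =
      enn2ereal (\<integral>\<^sup>+y. W y - ?s y \<partial>q ?z) - enn2ereal (\<integral>\<^sup>+y. ?s y - W y \<partial>q ?z)"
      unfolding ext_integral_def using \<mu>b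
      by (intro arg_cong2[where f="(-)"] arg_cong[where f=enn2ereal] nn_integral_cong)
        (simp_all add: space_q[OF z] relative_value_eq e2ennreal_enn2ereal_diff del: ereal_minus_diff_eq)
    then show ?thesis by (simp add: nn_integral_eq_taboo[OF z] W_l)
  qed
  have [measurable]: "W \<in> borel_measurable S" "?s \<in> borel_measurable S" "X - {l} \<in> sets S"
    using measurable_\<mu> by (simp_all add: measurable_W X_l_sets)
  have [measurable_cong]: "sets (q ?z) = sets S" by (rule q_sets[OF z])
  \<comment> \<open>Both sides are the maximum of \<open>r\<close> and \<open>ennreal t\<close>.
    Integrating this identity relates the two parts of \<open>h\<close> to \<open>W\<close> without
    assuming \<open>W\<close> integrable.\<close>
  have pos_neg: "(r - ennreal t) + ennreal t = r + (ennreal t - r)" for r t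
  proof (cases "ennreal t \<le> r")
    case True
    moreover have "ennreal t - r = 0" using True by (simp add: diff_eq_0_iff_ennreal)
    ultimately show ?thesis by (simp add: diff_add_cancel_ennreal)
  next
    case False
    then have "r < ennreal t" by simp
    then have "r - ennreal t = 0"
      by (auto simp: diff_eq_0_iff_ennreal intro: less_le_trans[OF _ top_greatest])
    then have "r - ennreal t + ennreal t = ennreal t" by simp
    also have "\<dots> = ennreal t - r + r" using False by (intro diff_add_cancel_ennreal[symmetric]) simp
    also have "\<dots> = r + (ennreal t - r)" by (rule add.commute)
    finally show ?thesis .
  qed
  have "taboo (\<lambda>y. W y - ?s y) ?z + taboo ?s ?z = taboo (\<lambda>y. (W y - ?s y) + ?s y) ?z"
    unfolding taboo_def by (subst nn_integral_add[symmetric]) (simp_all add: distrib_right)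
  also have "\<dots> = taboo (\<lambda>y. W y + (?s y - W y)) ?z" by (simp add: pos_neg)
  also have "\<dots> = taboo W ?z + taboo (\<lambda>y. ?s y - W y) ?z"
    unfolding taboo_def by (subst nn_integral_add[symmetric]) (simp_all add: distrib_right)
  finally have eq: "taboo (\<lambda>y. W y - ?s y) ?z + taboo ?s ?z = taboo W ?z + taboo (\<lambda>y. ?s y - W y) ?z" .
  have s: "taboo ?s ?z = ennreal (b * ?I)"
  proof -
    have "taboo ?s ?z = taboo (\<lambda>y. ennreal b * ennreal (\<mu> y)) ?z"
      using b by (intro taboo_cong[OF z]) (simp add: ennreal_mult' mult.commute)
    also have "\<dots> = ennreal b * ennreal ?I"
      using measurable_\<mu> by (simp add: taboo_cmult[OF z] taboo_\<mu>[OF z])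
    finally show ?thesis using b by (simp add: ennreal_mult')
  qed
  \<comment> \<open>The negative part of \<open>h\<close> is at most \<open>\<mu> y * b\<close>, so
    its integral is finite and the difference in \<open>ext\<close> is never \<infinity> -
    \<infinity>.\<close>
  have "taboo (\<lambda>y. ?s y - W y) ?z \<le> taboo ?s ?z" by (intro taboo_mono[OF z]) simp
  then obtain n where n: "taboo (\<lambda>y. ?s y - W y) ?z = ennreal n" "0 \<le> n"
    unfolding s by (cases "taboo (\<lambda>y. ?s y - W y) ?z") (auto simp: top_unique)
  have I: "0 \<le> b * ?I" using b taboo_integral_\<mu>_nonneg[OF z] by simp
  have bs: "0 \<le> b * slack ?z" using b slack_nonneg[OF z] by simp
  have c: "0 \<le> c ?z" by (rule c_nonneg[OF z])
  have bell: "bellman W ?z = ennreal (c ?z) + taboo W ?z + ennreal (b * slack ?z)"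
    using value_l b by (simp add: bellman_def discounted_value_Some[OF l] ennreal_mult')
  show ?thesis
  proof (cases "taboo W ?z")
    case top
    then have "taboo (\<lambda>y. W y - ?s y) ?z = \<infinity>" using eq s by simp
    then show ?thesis unfolding ext bell n top using n(2) by simp
  next
    case (real t)
    have sum: "taboo (\<lambda>y. W y - ?s y) ?z + ennreal (b * ?I) = ennreal (t + n)"
      using eq s n real by simp
    then have "taboo (\<lambda>y. W y - ?s y) ?z \<noteq> \<infinity>" by (metis ennreal_add_eq_top ennreal_neq_top infinity_ennreal_def)
    then obtain p where p: "taboo (\<lambda>y. W y - ?s y) ?z = ennreal p" "0 \<le> p"
      by (cases "taboo (\<lambda>y. W y - ?s y) ?z") auto
    have "ennreal (p + b * ?I) = ennreal (t + n)"
      using sum unfolding p(1) ennreal_plus[OF p(2) I] .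
    then have pt: "p + b * ?I = t + n" using p n real I by (subst (asm) ennreal_inj) simp_all
    have "b * slack ?z + (b - \<mu> x * b) = - (b * ?I)" by (simp add: slack_def algebra_simps)
    then have "c ?z + (p - n) = c ?z + t + b * slack ?z + (b - \<mu> x * b)" using pt by simp
    moreover have "enn2ereal (bellman W ?z) = ereal (c ?z + t + b * slack ?z)"
      unfolding bell real using real c bs by (simp add: ennreal_plus[symmetric] del: ennreal_plus)
    ultimately show ?thesis unfolding ext p n using p n by simp
  qed
qed

lemma average_cost_optimality_equation:
  assumes x: "x \<in> X"
  shows "is_minimum (ereal b + relative_value x)
    (\<lambda>a. ereal (c (x, a)) + ext_integral (q (x, a)) relative_value) (A x)"
proof -
  have w: "ereal b + relative_value x = enn2ereal (W x) + ereal (b - \<mu> x * b)"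
    unfolding relative_value_eq[OF x] by (cases "W x") auto
  have le: "enn2ereal (W x) + ereal (b - \<mu> x * b) \<le> enn2ereal (bellman W (x, a)) + ereal (b - \<mu> x * b)"
    if "a \<in> A x" for a
    using W_le_bellman[OF x that] by (intro add_right_mono) (simp add: less_eq_ennreal.rep_eq)
  obtain a where a: "a \<in> A x" "bellman W (x, a) \<le> W x" using W_attained[OF x] by blast
  then have "bellman W (x, a) = W x" using W_le_bellman[OF x a(1)] by simp
  then show ?thesis
    unfolding is_minimum_def w using a(1) le x
    by (auto simp: cost_plus_ext_integral intro!: bexI[of _ a])
qed

lemma bellman_imp_equality:
  assumes "x \<in> X" "a \<in> A x" "bellman W (x, a) = W x"
  shows "ereal b + relative_value x = ereal (c (x, a)) + ext_integral (q (x, a)) relative_value"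
  unfolding cost_plus_ext_integral[OF assms(1,2)] relative_value_eq[OF assms(1)] assms(3)
  by (cases "W x") auto

end

text \<open>The function \<open>\<mu> x * C\<close> is a supersolution: its Bellman value is at most
  C + C * I + C * slack, with I the taboo integral of \<open>\<mu>\<close>, and I + slack =
  \<open>\<mu> x - 1\<close>.\<close>

lemma W_le:
  assumes C: "\<And>z. z \<in> Gr \<Longrightarrow> c z \<le> C" "0 \<le> C" and x: "x \<in> X"
  shows "W x \<le> ennreal (\<mu> x * C)"
proof -
  have "value_iteration n x \<le> ennreal (\<mu> x * C)" for n
    using x
  proof (induction n arbitrary: x)
    case (Suc n)
    obtain a where a: "a \<in> A x" using A_nonempty[OF Suc.prems] by blast
    note z = xa_Gr[OF Suc.prems a]
    let ?I = "LINT y : X - {l} | q (x, a). \<mu> y"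
    have "value_iteration (Suc n) x \<le> bellman (value_iteration n) (x, a)" using a by (auto intro: INF_lower)
    also have "\<dots> \<le> bellman (\<lambda>y. ennreal (\<mu> y * C)) (x, a)" by (rule bellman_mono[OF z Suc.IH])
    also have "\<dots> = ennreal (c (x, a)) + ennreal (C * ?I) + ennreal (C * slack (x, a))"
    proof -
      have "taboo (\<lambda>y. ennreal (\<mu> y * C)) (x, a) = taboo (\<lambda>y. ennreal C * ennreal (\<mu> y)) (x, a)"
        using C(2) by (intro taboo_cong[OF z]) (simp add: ennreal_mult' mult.commute)
      also have "\<dots> = ennreal (C * ?I)"
        using measurable_\<mu> C(2) by (simp add: taboo_cmult[OF z] taboo_\<mu>[OF z] ennreal_mult')
      finally have 1: "taboo (\<lambda>y. ennreal (\<mu> y * C)) (x, a) = ennreal (C * ?I)" .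
      have "ennreal (1 / \<mu> l) * ennreal (\<mu> l * C) = ennreal C"
        using C(2) \<mu>_pos[OF l] by (simp add: ennreal_mult[symmetric])
      then have 2: "ennreal (1 / \<mu> l) * ennreal (\<mu> l * C) * ennreal (slack (x, a)) = ennreal (C * slack (x, a))"
        using C(2) by (simp add: ennreal_mult')
      show ?thesis unfolding bellman_def 1 2 ..
    qed
    also have "\<dots> = ennreal (c (x, a) + C * ?I + C * slack (x, a))"
      using c_nonneg[OF z] C(2) taboo_integral_\<mu>_nonneg[OF z] slack_nonneg[OF z] by simp
    also have "\<dots> \<le> ennreal (\<mu> x * C)"
      using C(1)[OF z] by (intro ennreal_leI) (simp add: slack_def algebra_simps)
    finally show ?case .
  qed simp
  then show ?thesis unfolding W_def by (intro SUP_least)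
qed

section \<open>Average optimality for bounded costs and probability kernels\<close>

context
  assumes bounded_cost: "bounded (c ` Gr)" and prob: "probability_kernel Gr q"
begin

lemma cost_bound: obtains C where "0 \<le> C" "\<And>z. z \<in> Gr \<Longrightarrow> c z \<le> C"
proof -
  obtain B where B: "\<And>z. z \<in> Gr \<Longrightarrow> \<bar>c z\<bar> \<le> B" using bounded_cost by (auto simp: bounded_iff)
  show ?thesis
  proof (rule that[of "max 0 B"])
    show "c z \<le> max 0 B" if "z \<in> Gr" for z using B[OF that] by simp
  qed simp
qed

lemma value_l_finite: obtains b where "0 \<le> b" "discounted_value M' \<beta> (Some l) = ennreal b"
proof -
  obtain C where C: "0 \<le> C" "\<And>z. z \<in> Gr \<Longrightarrow> c z \<le> C" by (rule cost_bound) blast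
  have "ennreal (1 / \<mu> l) * W l \<le> ennreal (1 / \<mu> l) * ennreal (\<mu> l * C)"
    by (intro mult_left_mono W_le[OF C(2) C(1) l]) simp_all
  also have "\<dots> < \<infinity>" by (simp add: ennreal_mult_less_top)
  finally show ?thesis
    using that by (cases "ennreal (1 / \<mu> l) * W l") (auto simp: discounted_value_Some[OF l])
qed

text \<open>Bounded costs make \<open>h\<close> a bounded real function. The minimum inequality
  bounds every policy from below by \<open>b\<close>, the assumed equality bounds
  \<open>\<phi>\<close> from above by \<open>b\<close>, so \<open>b\<close> is the optimal average
  cost from every state.\<close>

lemma average_optimal_if_equality:
  assumes \<phi>: "\<phi> \<in> stationary_policies M"
    and eq: "\<And>x. x \<in> X \<Longrightarrow> enn2ereal (discounted_value M' \<beta> (Some l)) + relative_value x =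
      ereal (c (x, \<phi> x)) + ext_integral (q (x, \<phi> x)) relative_value"
  shows "average_optimal M (stationary M \<phi>)"
proof -
  interpret original: mdp_kernel M by (rule mdp_kernel_original[OF prob])
  obtain C where C: "0 \<le> C" "\<And>z. z \<in> Gr \<Longrightarrow> c z \<le> C" by (rule cost_bound) blast
  obtain b where b: "0 \<le> b" "discounted_value M' \<beta> (Some l) = ennreal b" by (rule value_l_finite) blast
  note pol = original.stationary_in_policies[OF \<phi>]
  define hr where "hr y = enn2real (W y) - \<mu> y * b" for y
  have W: "enn2ereal (W y) = ereal (enn2real (W y))" "0 \<le> enn2real (W y)" "enn2real (W y) \<le> K * C" if "y \<in> X" for y
  proof -
    have le: "W y \<le> ennreal (\<mu> y * C)" by (rule W_le[OF C(2) C(1) that])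
    then have "W y \<noteq> top" by (auto simp: top_unique)
    then show "enn2ereal (W y) = ereal (enn2real (W y))" by (cases "W y") auto
    show "0 \<le> enn2real (W y)" by simp
    have "enn2real (W y) \<le> \<mu> y * C" using le C(1) \<mu>_pos[OF that] by (intro enn2real_leI) simp_all
    also have "\<dots> \<le> K * C" by (rule mult_right_mono[OF \<mu>_le[OF that] C(1)])
    finally show "enn2real (W y) \<le> K * C" .
  qed
  have h: "relative_value y = ereal (hr y)" if "y \<in> X" for y
    unfolding relative_value_eq[OF b that] hr_def W(1)[OF that] by simp
  have \<mu>b: "0 \<le> \<mu> y * b" "\<mu> y * b \<le> K * b" if "y \<in> X" for y
    using \<mu>_pos[OF that] \<mu>_le[OF that] b(1) by (auto intro: mult_right_mono)
  have hr_bounds: "0 \<le> hr y + K * b" "\<bar>hr y\<bar> \<le> K * C + K * b" "hr y + K * b \<le> K * C + K * b" if "y \<in> X" for y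
    using W(2,3)[OF that] \<mu>b[OF that] unfolding hr_def by linarith+
  have hr_meas: "hr \<in> borel_measurable S"
    unfolding hr_def using measurable_W measurable_\<mu> by simp
  have int: "integrable (q z) hr" if "z \<in> Gr" for z
    by (rule integrable_bounded[OF that hr_meas hr_bounds(2)])
  have ext: "ext_integral (q z) relative_value = ereal (\<integral>y. hr y \<partial>q z)" if z: "z \<in> Gr" for z
  proof -
    have "ext_integral (q z) relative_value = ext_integral (q z) (\<lambda>y. ereal (hr y))"
      by (rule ext_integral_cong) (simp add: space_q[OF z] h)
    then show ?thesis by (simp add: ext_integral_ereal[OF int[OF z]])
  qed
  \<comment> \<open>\<open>h y\<close> is at least \<open>- \<mu> y * b\<close>, hence at least
    \<open>- K * b\<close>, so this shift is nonnegative and fits the \<open>ennreal\<close>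
    estimates. A probability kernel preserves constants, so the shift cancels in the
    inequality.\<close>
  define g where "g y = ennreal (hr y + K * b)" for y
  have g_int: "ennreal (c z) + (\<integral>\<^sup>+y. g y \<partial>q z) = ennreal (c z + (\<integral>y. hr y \<partial>q z) + K * b)" if z: "z \<in> Gr" for z
  proof -
    interpret Q: prob_space "q z" using prob z by (simp add: probability_kernel_def)
    have "(\<integral>\<^sup>+y. g y \<partial>q z) = ennreal (\<integral>y. hr y + K * b \<partial>q z)"
      unfolding g_def using int[OF z] hr_bounds(1)
      by (intro nn_integral_eq_integral AE_I2) (simp_all add: space_q[OF z])
    moreover have "(\<integral>y. hr y + K * b \<partial>q z) = (\<integral>y. hr y \<partial>q z) + K * b"
      using int[OF z] by (simp add: Q.prob_space)
    moreover have "0 \<le> (\<integral>y. hr y + K * b \<partial>q z)"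
      using hr_bounds(1) by (intro integral_nonneg_AE AE_I2) (simp add: space_q[OF z])
    ultimately show ?thesis using c_nonneg[OF z] by (simp add: ennreal_plus[symmetric] add.assoc del: ennreal_plus)
  qed
  have g_sum: "ennreal b + g y = ennreal (b + hr y + K * b)" if "y \<in> X" for y
    using hr_bounds(1)[OF that] b(1) by (simp add: g_def ennreal_plus[symmetric] add.assoc del: ennreal_plus)
  have g_le: "ennreal b + g y \<le> ennreal (c (y, a)) + (\<integral>\<^sup>+z. g z \<partial>q (y, a))" if y: "y \<in> X" "a \<in> A y" for y a
  proof -
    have "ereal b + relative_value y \<le> ereal (c (y, a)) + ext_integral (q (y, a)) relative_value"
      using average_cost_optimality_equation[OF b y(1)] y(2) unfolding is_minimum_def by blast
    then have "b + hr y \<le> c (y, a) + (\<integral>z. hr z \<partial>q (y, a))"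
      unfolding h[OF y(1)] ext[OF xa_Gr[OF y]] by simp
    then show ?thesis unfolding g_sum[OF y(1)] g_int[OF xa_Gr[OF y]] by (intro ennreal_leI) simp
  qed
  have g_eq: "ennreal (c (y, \<phi> y)) + (\<integral>\<^sup>+z. g z \<partial>q (y, \<phi> y)) \<le> ennreal b + g y" if y: "y \<in> X" for y
  proof -
    have a: "\<phi> y \<in> A y" using \<phi> y by (simp add: stationary_policies_def)
    have "ereal b + relative_value y = ereal (c (y, \<phi> y)) + ext_integral (q (y, \<phi> y)) relative_value"
      using eq[OF y] b by simp
    then have "b + hr y = c (y, \<phi> y) + (\<integral>z. hr z \<partial>q (y, \<phi> y))"
      unfolding h[OF y] ext[OF xa_Gr[OF y a]] by simp
    then show ?thesis unfolding g_sum[OF y] g_int[OF xa_Gr[OF y a]] by simp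
  qed
  have g_meas: "g \<in> borel_measurable (states M)" unfolding g_def using hr_meas by simp
  have gB: "g y \<le> ennreal (K * C + K * b)" if "y \<in> space (states M)" for y
    unfolding g_def using that hr_bounds(3)[of y] by (intro ennreal_leI) simp
  have lower: "ennreal b \<le> average_cost M \<pi> x" if "\<pi> \<in> policies M" "x \<in> X" for \<pi> x
    using that(2) g_le by (intro original.average_cost_ge[OF that(1) _ g_meas gB]) simp_all
  have upper: "average_cost M (stationary M \<phi>) x \<le> ennreal b" if "x \<in> X" for x
    using that g_eq by (intro original.average_cost_stationary_le[OF \<phi> _ g_meas gB]) simp_all
  show ?thesis
    unfolding average_optimal_def
  proof (intro conjI pol ballI)
    fix x assume "x \<in> space (states M)"
    then have x: "x \<in> X" by simp
    show "average_cost M (stationary M \<phi>) x = (INF \<pi>'\<in>policies M. average_cost M \<pi>' x)"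
    proof (rule antisym)
      show "average_cost M (stationary M \<phi>) x \<le> (INF \<pi>'\<in>policies M. average_cost M \<pi>' x)"
        using upper[OF x] lower[OF _ x] by (meson INF_greatest order_trans)
      show "(INF \<pi>'\<in>policies M. average_cost M \<pi>' x) \<le> average_cost M (stationary M \<phi>) x"
        by (rule INF_lower[OF pol])
    qed
  qed
qed

lemma average_optimal_if_bellman:
  assumes \<phi>: "\<phi> \<in> stationary_policies M" and bell: "\<And>x. x \<in> X \<Longrightarrow> bellman W (x, \<phi> x) = W x"
  shows "average_optimal M (stationary M \<phi>)"
proof (rule average_optimal_if_equality[OF \<phi>])
  fix x assume x: "x \<in> X"
  obtain b where b: "0 \<le> b" "discounted_value M' \<beta> (Some l) = ennreal b" by (rule value_l_finite) blast
  have "\<phi> x \<in> A x" using \<phi> x by (simp add: stationary_policies_def)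
  from bellman_imp_equality[OF b x this bell[OF x]] b
  show "enn2ereal (discounted_value M' \<beta> (Some l)) + relative_value x =
      ereal (c (x, \<phi> x)) + ext_integral (q (x, \<phi> x)) relative_value" by simp
qed

end

end

theorem corollary7:
  fixes X :: "'x::polish_space set" and Act :: "'a::polish_space set"
    and A :: "'x \<Rightarrow> 'a set" and c :: "'x \<times> 'a \<Rightarrow> real" and q :: "'x \<times> 'a \<Rightarrow> 'x measure"
    and l :: 'x and K :: real and \<mu> :: "'x \<Rightarrow> real" and \<beta> :: real
  assumes setting: "borel_mdp X Act A c q"
    and HT_state: "l \<in> X"
    and HT_bound: "\<forall>\<phi> \<in> stationary_policies (borel_mdp_of X Act A c q). \<forall>x \<in> X.
      (\<Sum>n. (taboo_op X q \<phi> l ^^ n) (\<lambda>_. 1) x) \<le> ennreal K"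
    and HT_isolated: "isolated_from l X"
    and W_compact: "\<forall>x \<in> X. compact (A x)"
    and W_continuous: "continuous_set_map X Act A"
    and W_kernel: "weakly_continuous_kernel X (graph A X) q"
    and W_cost: "lower_semicontinuous_on (graph A X) c"
    and \<mu>_continuous: "continuous_on X \<mu>"
    and \<mu>_bounds: "\<forall>x \<in> X. 1 \<le> \<mu> x \<and> \<mu> x \<le> K"
    and \<mu>_ineq: "\<forall>(x, a) \<in> graph A X. \<mu> x \<ge> 1 + (LINT y : X - {l} | q (x, a). \<mu> y)"
    and \<beta>: "\<beta> \<in> {(K - 1) / K ..< 1}"
  shows "let
      M = borel_mdp_of X Act A c q;
      M' = hvag X Act A c q l \<mu> \<beta>;
      v = (\<lambda>x. discounted_value M' \<beta> x);
      w = enn2ereal (v (Some l));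
      h = (\<lambda>x. ereal (\<mu> x) * (enn2ereal (v (Some x)) - enn2ereal (v (Some l))))
    in
      (v (Some l) < \<infinity> \<longrightarrow>
        (\<forall>x \<in> X. is_minimum (w + h x)
          (\<lambda>a. ereal (c (x, a)) + ext_integral (q (x, a)) h) (A x)))
      \<and>
      (bounded (c ` graph A X) \<and> probability_kernel (graph A X) q \<longrightarrow>
        (\<exists>\<phi> \<in> stationary_policies M. average_optimal M (stationary M \<phi>)) \<and>
        (\<forall>\<phi> \<in> stationary_policies M.
          (\<forall>x \<in> X. w + h x = ereal (c (x, \<phi> x)) + ext_integral (q (x, \<phi> x)) h) \<longrightarrow>
          average_optimal M (stationary M \<phi>)))
      \<and>
      (\<exists>\<phi> \<in> stationary_policies M'. discounted_optimal M' \<beta> (stationary M' \<phi>)) \<and>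
      (bounded (c ` graph A X) \<and> probability_kernel (graph A X) q \<longrightarrow>
        (\<forall>\<phi> \<in> stationary_policies M'. discounted_optimal M' \<beta> (stationary M' \<phi>) \<longrightarrow>
          average_optimal M (stationary M (original_policy \<phi>))))"
proof -
  interpret hvag_setting X Act A c q l K \<mu> \<beta>
  proof (rule hvag_setting.intro[OF setting hvag_setting_axioms.intro])
    show "compact (A x)" if "x \<in> X" for x by (rule bspec[OF W_compact that])
    show "1 \<le> \<mu> x" "\<mu> x \<le> K" if "x \<in> X" for x using bspec[OF \<mu>_bounds that] by simp_all
    show "1 + (LINT y : X - {l} | q (x, a). \<mu> y) \<le> \<mu> x" if "(x, a) \<in> graph A X" for x a
      using bspec[OF \<mu>_ineq that] by (simp only: prod.case)
    show "(K - 1) / K \<le> \<beta>" using \<beta> by simp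
  qed (fact HT_state HT_isolated W_continuous W_kernel W_cost \<mu>_continuous)+
  show ?thesis
    unfolding Let_def
  proof (intro conjI impI ballI)
    fix x assume fin: "discounted_value (hvag X Act A c q l \<mu> \<beta>) \<beta> (Some l) < \<infinity>" and x: "x \<in> X"
    \<comment> \<open>Only the value at \<open>l\<close> is known to be finite here; elsewhere
      \<open>h\<close> may be infinite.\<close>
    obtain b where b: "0 \<le> b" "discounted_value (hvag X Act A c q l \<mu> \<beta>) \<beta> (Some l) = ennreal b"
      using fin by (cases "discounted_value (hvag X Act A c q l \<mu> \<beta>) \<beta> (Some l)") auto
    have "enn2ereal (discounted_value (hvag X Act A c q l \<mu> \<beta>) \<beta> (Some l)) = ereal b"
      using b by (simp add: enn2ereal_ennreal)
    then show "is_minimum (enn2ereal (discounted_value (hvag X Act A c q l \<mu> \<beta>) \<beta> (Some l)) +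
        ereal (\<mu> x) * (enn2ereal (discounted_value (hvag X Act A c q l \<mu> \<beta>) \<beta> (Some x)) -
          enn2ereal (discounted_value (hvag X Act A c q l \<mu> \<beta>) \<beta> (Some l))))
      (\<lambda>a. ereal (c (x, a)) + ext_integral (q (x, a)) (\<lambda>x. ereal (\<mu> x) *
        (enn2ereal (discounted_value (hvag X Act A c q l \<mu> \<beta>) \<beta> (Some x)) -
          enn2ereal (discounted_value (hvag X Act A c q l \<mu> \<beta>) \<beta> (Some l))))) (A x)"
      using average_cost_optimality_equation[OF b x] by (simp only:)
  next
    assume bp: "bounded (c ` graph A X) \<and> probability_kernel (graph A X) q"
    obtain \<phi> where \<phi>: "\<phi> \<in> stationary_policies (borel_mdp_of X Act A c q)"
      "\<And>x. x \<in> X \<Longrightarrow> bellman W (x, \<phi> x) = W x"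
      by (rule minimizing_selector) blast
    show "\<exists>\<phi> \<in> stationary_policies (borel_mdp_of X Act A c q).
        average_optimal (borel_mdp_of X Act A c q) (stationary (borel_mdp_of X Act A c q) \<phi>)"
      by (rule bexI[of _ \<phi>], rule average_optimal_if_bellman[OF conjunct1[OF bp] conjunct2[OF bp]])
        (simp_all add: \<phi>)
  next
    fix \<phi> assume bp: "bounded (c ` graph A X) \<and> probability_kernel (graph A X) q"
      and \<phi>: "\<phi> \<in> stationary_policies (borel_mdp_of X Act A c q)"
      and eq: "\<forall>x \<in> X. enn2ereal (discounted_value (hvag X Act A c q l \<mu> \<beta>) \<beta> (Some l)) +
        ereal (\<mu> x) * (enn2ereal (discounted_value (hvag X Act A c q l \<mu> \<beta>) \<beta> (Some x)) -
          enn2ereal (discounted_value (hvag X Act A c q l \<mu> \<beta>) \<beta> (Some l))) =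
      ereal (c (x, \<phi> x)) + ext_integral (q (x, \<phi> x)) (\<lambda>x. ereal (\<mu> x) *
        (enn2ereal (discounted_value (hvag X Act A c q l \<mu> \<beta>) \<beta> (Some x)) -
          enn2ereal (discounted_value (hvag X Act A c q l \<mu> \<beta>) \<beta> (Some l))))"
    show "average_optimal (borel_mdp_of X Act A c q) (stationary (borel_mdp_of X Act A c q) \<phi>)"
      by (rule average_optimal_if_equality[OF conjunct1[OF bp] conjunct2[OF bp] \<phi>]) (rule bspec[OF eq])
  next
    show "\<exists>\<phi> \<in> stationary_policies (hvag X Act A c q l \<mu> \<beta>).
        discounted_optimal (hvag X Act A c q l \<mu> \<beta>) \<beta> (stationary (hvag X Act A c q l \<mu> \<beta>) \<phi>)"
      by (rule ex_discounted_optimal)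
  next
    fix \<phi> assume bp: "bounded (c ` graph A X) \<and> probability_kernel (graph A X) q"
      and \<phi>: "\<phi> \<in> stationary_policies (hvag X Act A c q l \<mu> \<beta>)"
        "discounted_optimal (hvag X Act A c q l \<mu> \<beta>) \<beta> (stationary (hvag X Act A c q l \<mu> \<beta>) \<phi>)"
    show "average_optimal (borel_mdp_of X Act A c q) (stationary (borel_mdp_of X Act A c q) (original_policy \<phi>))"
      by (rule average_optimal_if_bellman[OF conjunct1[OF bp] conjunct2[OF bp]
            discounted_optimal_imp_bellman(1)[OF \<phi>]])
        (rule discounted_optimal_imp_bellman(2)[OF \<phi>])
  qed
qed

end
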